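(* Let $k$ be a commutative ring and let $A$ be a $k$-linear Hopf category whose underlying class $X$ is a finite set. Then $A=\bigoplus_{x,y\in X}A_{x,y}$, with the algebra structure, comultiplication, counit and antipode described in the context, is a weak Hopf algebra over $k$.
   Context: A $k$-linear Hopf category $A$ with underlying class $X$ consists of $k$-coalgebras $A_{x,y}$ ($x,y\in X$) with comultiplication $\Delta_{x,y}(h)=h_{(1)}\otimes h_{(2)}$ and counit $\varepsilon_{x,y}$, coalgebra morphisms $m_{x,y,z}:A_{x,y}\otimes A_{y,z}\to A_{x,z}$, $h\otimes l\mapsto hl$, and $k\to A_{x,x}$, $1\mapsto1_x$, which are associative and unital, and $k$-linear maps $S_{x,y}:A_{x,y}\to A_{y,x}$ satisfying $h_{(1)}S_{x,y}(h_{(2)})=\varepsilon_{x,y}(h)1_x$ and $S_{x,y}(h_{(1)})h_{(2)}=\varepsilon_{x,y}(h)1_y$ for all $h\in A_{x,y}$. Structure on $\bigoplus_{x,y}A_{x,y}$: for $h\in A_{x,y}$, $l\in A_{z,u}$, the product $hl$ is $m_{x,y,u}(h\otimes l)$ if $y=z$ and $0$ if $y\ne z$, extended linearly; the unit is $1=\sum_{x\in X}1_x$. The maps $\Delta:A\to A\otimes A$, $\varepsilon:A\to k$, $S:A\to A$ are the $k$-linear maps whose restrictions to $A_{x,y}$ are $\Delta_{x,y}$, $\varepsilon_{x,y}$, $S_{x,y}$. A weak Hopf algebra over $k$ is a $k$-module $H$ with an (associative unital) algebra structure and a (coassociative counital) coalgebra structure $(\Delta,\varepsilon)$ such that $\Delta(hl)=\Delta(h)\Delta(l)$;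 $\varepsilon(hkl)=\varepsilon(hk_{(1)})\varepsilon(k_{(2)}l)=\varepsilon(hk_{(2)})\varepsilon(k_{(1)}l)$; $(\Delta\otimes\mathrm{id})\Delta(1)=(\Delta(1)\otimes1)(1\otimes\Delta(1))=(1\otimes\Delta(1))(\Delta(1)\otimes1)$; together with a $k$-linear map $S:H\to H$ such that $h_{(1)}S(h_{(2)})=\varepsilon(1_{(1)}h)1_{(2)}$, $S(h_{(1)})h_{(2)}=1_{(1)}\varepsilon(h1_{(2)})$ and $S(h_{(1)})h_{(2)}S(h_{(3)})=S(h)$ for all $h,k,l\in H$. *)

theory Defs
  imports "HOL-Algebra.Module" "HOL-Algebra.AbelCoset"
begin

section \<open>Modules, linear maps and direct sums\<close>

text \<open>
  The record type for modules inherits the fields \<open>mult\<close> and \<open>one\<close> from rings. They are left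
  undefined for modules that carry no multiplication, and no module-theoretic notion below looks
  at them.
\<close>

definition lin_map ::
  "('k, 'r) ring_scheme \<Rightarrow> ('k, 'a, 'm) module_scheme \<Rightarrow> ('k, 'b, 'n) module_scheme \<Rightarrow> ('a \<Rightarrow> 'b) \<Rightarrow> bool"
  where "lin_map R M N f \<longleftrightarrow>
    f \<in> carrier M \<rightarrow> carrier N \<and>
    (\<forall>x\<in>carrier M. \<forall>y\<in>carrier M. f (x \<oplus>\<^bsub>M\<^esub> y) = f x \<oplus>\<^bsub>N\<^esub> f y) \<and>
    (\<forall>a\<in>carrier R. \<forall>x\<in>carrier M. f (a \<odot>\<^bsub>M\<^esub> x) = a \<odot>\<^bsub>N\<^esub> f x)"

definition base_module :: "('k, 'r) ring_scheme \<Rightarrow> ('k, 'k) module"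
  where "base_module R =
    \<lparr>carrier = carrier R, mult = mult R, one = one R, zero = zero R, add = add R, smult = mult R\<rparr>"

definition direct_sum :: "'i set \<Rightarrow> ('i \<Rightarrow> ('k, 'a, 'm) module_scheme) \<Rightarrow> ('k, 'i \<Rightarrow> 'a) module"
  where "direct_sum I M =
    \<lparr>carrier = {f \<in> (\<Pi>\<^sub>E i\<in>I. carrier (M i)). finite {i \<in> I. f i \<noteq> \<zero>\<^bsub>M i\<^esub>}},
     mult = undefined, one = undefined,
     zero = (\<lambda>i\<in>I. \<zero>\<^bsub>M i\<^esub>),
     add = (\<lambda>f g. \<lambda>i\<in>I. f i \<oplus>\<^bsub>M i\<^esub> g i),
     smult = (\<lambda>a f. \<lambda>i\<in>I. a \<odot>\<^bsub>M i\<^esub> f i)\<rparr>"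

definition inj_sum :: "'i set \<Rightarrow> ('i \<Rightarrow> ('k, 'a, 'm) module_scheme) \<Rightarrow> 'i \<Rightarrow> 'a \<Rightarrow> ('i \<Rightarrow> 'a)"
  where "inj_sum I M j a = (\<lambda>i\<in>I. if i = j then a else \<zero>\<^bsub>M i\<^esub>)"

definition free_module :: "('k, 'r) ring_scheme \<Rightarrow> 's set \<Rightarrow> ('k, 's \<Rightarrow> 'k) module"
  where "free_module R B = direct_sum B (\<lambda>_. base_module R)"

definition free_basis :: "('k, 'r) ring_scheme \<Rightarrow> 's set \<Rightarrow> 's \<Rightarrow> ('s \<Rightarrow> 'k)"
  where "free_basis R B s = inj_sum B (\<lambda>_. base_module R) s \<one>\<^bsub>R\<^esub>"

definition submodule_span ::
  "('k, 'r) ring_scheme \<Rightarrow> ('k, 'a, 'm) module_scheme \<Rightarrow> 'a set \<Rightarrow> 'a set"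
  where "submodule_span R M B = \<Inter> {N. submodule N R M \<and> B \<subseteq> N}"

definition quotient_module :: "('k, 'a, 'm) module_scheme \<Rightarrow> 'a set \<Rightarrow> ('k, 'a set) module"
  where "quotient_module M N =
    \<lparr>carrier = a_rcosets\<^bsub>M\<^esub> N,
     mult = undefined, one = undefined,
     zero = N,
     add = set_add M,
     smult = (\<lambda>a C. \<Union>c\<in>C. N +>\<^bsub>M\<^esub> (a \<odot>\<^bsub>M\<^esub> c))\<rparr>"


section \<open>Tensor products\<close>

definition tensor_relations ::
  "('k, 'r) ring_scheme \<Rightarrow> ('k, 'a, 'm) module_scheme \<Rightarrow> ('k, 'b, 'n) module_scheme \<Rightarrow> ('a \<times> 'b \<Rightarrow> 'k) set"
  where "tensor_relations R M N =
    (let F = free_module R (carrier M \<times> carrier N);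
         \<beta> = (\<lambda>x y. free_basis R (carrier M \<times> carrier N) (x, y))
     in {\<beta> (x \<oplus>\<^bsub>M\<^esub> x') y \<ominus>\<^bsub>F\<^esub> (\<beta> x y \<oplus>\<^bsub>F\<^esub> \<beta> x' y) | x x' y.
           x \<in> carrier M \<and> x' \<in> carrier M \<and> y \<in> carrier N} \<union>
        {\<beta> x (y \<oplus>\<^bsub>N\<^esub> y') \<ominus>\<^bsub>F\<^esub> (\<beta> x y \<oplus>\<^bsub>F\<^esub> \<beta> x y') | x y y'.
           x \<in> carrier M \<and> y \<in> carrier N \<and> y' \<in> carrier N} \<union>
        {\<beta> (a \<odot>\<^bsub>M\<^esub> x) y \<ominus>\<^bsub>F\<^esub> a \<odot>\<^bsub>F\<^esub> \<beta> x y | a x y.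
           a \<in> carrier R \<and> x \<in> carrier M \<and> y \<in> carrier N} \<union>
        {\<beta> x (a \<odot>\<^bsub>N\<^esub> y) \<ominus>\<^bsub>F\<^esub> a \<odot>\<^bsub>F\<^esub> \<beta> x y | a x y.
           a \<in> carrier R \<and> x \<in> carrier M \<and> y \<in> carrier N})"

definition tensor_null ::
  "('k, 'r) ring_scheme \<Rightarrow> ('k, 'a, 'm) module_scheme \<Rightarrow> ('k, 'b, 'n) module_scheme \<Rightarrow> ('a \<times> 'b \<Rightarrow> 'k) set"
  where "tensor_null R M N =
    submodule_span R (free_module R (carrier M \<times> carrier N)) (tensor_relations R M N)"

definition tensor ::
  "('k, 'r) ring_scheme \<Rightarrow> ('k, 'a, 'm) module_scheme \<Rightarrow> ('k, 'b, 'n) module_scheme \<Rightarrow>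
    ('k, ('a \<times> 'b \<Rightarrow> 'k) set) module"
  where "tensor R M N =
    quotient_module (free_module R (carrier M \<times> carrier N)) (tensor_null R M N)"

definition pure ::
  "('k, 'r) ring_scheme \<Rightarrow> ('k, 'a, 'm) module_scheme \<Rightarrow> ('k, 'b, 'n) module_scheme \<Rightarrow>
    'a \<Rightarrow> 'b \<Rightarrow> ('a \<times> 'b \<Rightarrow> 'k) set"
  where "pure R M N x y =
    tensor_null R M N +>\<^bsub>free_module R (carrier M \<times> carrier N)\<^esub>
      free_basis R (carrier M \<times> carrier N) (x, y)"

text \<open>
  \<open>tensor_lift R M N P f t\<close> is the value at \<open>t\<close> of the linear map from \<open>tensor R M N\<close> to \<open>P\<close>
  induced by a bilinear map \<open>f\<close>. It is computed from a representative \<open>c\<close> of the coset \<open>t\<close>; for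
  bilinear \<open>f\<close> the choice does not matter. In Sweedler notation, for \<open>\<Delta>(h) = h\<^sub>1 \<otimes> h\<^sub>2\<close>, the element
  \<open>f(h\<^sub>1, h\<^sub>2)\<close> is \<open>tensor_lift R M N P f (\<Delta> h)\<close>.
\<close>

definition tensor_lift ::
  "('k, 'r) ring_scheme \<Rightarrow> ('k, 'a, 'm) module_scheme \<Rightarrow> ('k, 'b, 'n) module_scheme \<Rightarrow>
    ('k, 'c, 'p) module_scheme \<Rightarrow> ('a \<Rightarrow> 'b \<Rightarrow> 'c) \<Rightarrow> ('a \<times> 'b \<Rightarrow> 'k) set \<Rightarrow> 'c"
  where "tensor_lift R M N P f t =
    (let c = (SOME c. c \<in> t)
     in \<Oplus>\<^bsub>P\<^esub> p \<in> {p \<in> carrier M \<times> carrier N. c p \<noteq> \<zero>\<^bsub>R\<^esub>}. c p \<odot>\<^bsub>P\<^esub> f (fst p) (snd p))"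

definition tensor_map ::
  "('k, 'r) ring_scheme \<Rightarrow> ('k, 'a, 'm) module_scheme \<Rightarrow> ('k, 'b, 'n) module_scheme \<Rightarrow>
    ('k, 'c, 'p) module_scheme \<Rightarrow> ('k, 'd, 'q) module_scheme \<Rightarrow>
    ('a \<Rightarrow> 'c) \<Rightarrow> ('b \<Rightarrow> 'd) \<Rightarrow> ('a \<times> 'b \<Rightarrow> 'k) set \<Rightarrow> ('c \<times> 'd \<Rightarrow> 'k) set"
  where "tensor_map R M N P Q f g =
    tensor_lift R M N (tensor R P Q) (\<lambda>x y. pure R P Q (f x) (g y))"

text \<open>The canonical isomorphism from \<open>L \<otimes> (M \<otimes> N)\<close> to \<open>(L \<otimes> M) \<otimes> N\<close>.\<close>

definition tensor_assoc ::
  "('k, 'r) ring_scheme \<Rightarrow> ('k, 'a, 'm) module_scheme \<Rightarrow> ('k, 'b, 'n) module_scheme \<Rightarrow>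
    ('k, 'c, 'p) module_scheme \<Rightarrow>
    ('a \<times> ('b \<times> 'c \<Rightarrow> 'k) set \<Rightarrow> 'k) set \<Rightarrow> (('a \<times> 'b \<Rightarrow> 'k) set \<times> 'c \<Rightarrow> 'k) set"
  where "tensor_assoc R L M N =
    (let T = tensor R (tensor R L M) N
     in tensor_lift R L (tensor R M N) T
          (\<lambda>x. tensor_lift R M N T (\<lambda>y z. pure R (tensor R L M) N (pure R L M x y) z)))"

definition tensor_algebra ::
  "('k, 'r) ring_scheme \<Rightarrow> ('k, 'a, 'm) module_scheme \<Rightarrow> ('k, 'b, 'n) module_scheme \<Rightarrow>
    ('k, ('a \<times> 'b \<Rightarrow> 'k) set) module"
  where "tensor_algebra R M N = (tensor R M N)
    \<lparr>mult := (\<lambda>s t.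
       tensor_lift R M N (tensor R M N)
         (\<lambda>x y. tensor_lift R M N (tensor R M N)
            (\<lambda>x' y'. pure R M N (x \<otimes>\<^bsub>M\<^esub> x') (y \<otimes>\<^bsub>N\<^esub> y')) t) s),
     one := pure R M N \<one>\<^bsub>M\<^esub> \<one>\<^bsub>N\<^esub>\<rparr>"


section \<open>Algebras and coalgebras\<close>

text \<open>The library's locale \<open>algebra\<close> is restricted to commutative algebras.\<close>

locale assoc_algebra = module R M + ring M for R (structure) and M (structure) +
  assumes smult_mult_left:
      "\<lbrakk>a \<in> carrier R; x \<in> carrier M; y \<in> carrier M\<rbrakk> \<Longrightarrow>
        (a \<odot>\<^bsub>M\<^esub> x) \<otimes>\<^bsub>M\<^esub> y = a \<odot>\<^bsub>M\<^esub> (x \<otimes>\<^bsub>M\<^esub> y)"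
    and smult_mult_right:
      "\<lbrakk>a \<in> carrier R; x \<in> carrier M; y \<in> carrier M\<rbrakk> \<Longrightarrow>
        x \<otimes>\<^bsub>M\<^esub> (a \<odot>\<^bsub>M\<^esub> y) = a \<odot>\<^bsub>M\<^esub> (x \<otimes>\<^bsub>M\<^esub> y)"

locale coalgebra = module R C for R (structure) and C (structure) +
  fixes \<Delta> \<epsilon>
  assumes comult_linear: "lin_map R C (tensor R C C) \<Delta>"
    and counit_linear: "lin_map R C (base_module R) \<epsilon>"
    and coassoc: "h \<in> carrier C \<Longrightarrow>
      tensor_map R C C (tensor R C C) C \<Delta> (\<lambda>x. x) (\<Delta> h) =
      tensor_assoc R C C C (tensor_map R C C C (tensor R C C) (\<lambda>x. x) \<Delta> (\<Delta> h))"
    and counit_left: "h \<in> carrier C \<Longrightarrow>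
      tensor_lift R C C C (\<lambda>x y. \<epsilon> x \<odot>\<^bsub>C\<^esub> y) (\<Delta> h) = h"
    and counit_right: "h \<in> carrier C \<Longrightarrow>
      tensor_lift R C C C (\<lambda>x y. \<epsilon> y \<odot>\<^bsub>C\<^esub> x) (\<Delta> h) = h"

definition coalgebra_hom ::
  "('k, 'r) ring_scheme \<Rightarrow>
    ('k, 'a, 'm) module_scheme \<Rightarrow> ('a \<Rightarrow> ('a \<times> 'a \<Rightarrow> 'k) set) \<Rightarrow> ('a \<Rightarrow> 'k) \<Rightarrow>
    ('k, 'b, 'n) module_scheme \<Rightarrow> ('b \<Rightarrow> ('b \<times> 'b \<Rightarrow> 'k) set) \<Rightarrow> ('b \<Rightarrow> 'k) \<Rightarrow>
    ('a \<Rightarrow> 'b) \<Rightarrow> bool"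
  where "coalgebra_hom R C \<Delta> \<epsilon> D \<Delta>' \<epsilon>' f \<longleftrightarrow>
    lin_map R C D f \<and>
    (\<forall>c\<in>carrier C. \<Delta>' (f c) = tensor_map R C C D D f f (\<Delta> c)) \<and>
    (\<forall>c\<in>carrier C. \<epsilon>' (f c) = \<epsilon> c)"

text \<open>The comultiplication \<open>c \<otimes> d \<mapsto> (c\<^sub>1 \<otimes> d\<^sub>1) \<otimes> (c\<^sub>2 \<otimes> d\<^sub>2)\<close> of a tensor product of coalgebras.\<close>

definition tensor_comult ::
  "('k, 'r) ring_scheme \<Rightarrow>
    ('k, 'a, 'm) module_scheme \<Rightarrow> ('a \<Rightarrow> ('a \<times> 'a \<Rightarrow> 'k) set) \<Rightarrow>
    ('k, 'b, 'n) module_scheme \<Rightarrow> ('b \<Rightarrow> ('b \<times> 'b \<Rightarrow> 'k) set) \<Rightarrow>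
    ('a \<times> 'b \<Rightarrow> 'k) set \<Rightarrow> (('a \<times> 'b \<Rightarrow> 'k) set \<times> ('a \<times> 'b \<Rightarrow> 'k) set \<Rightarrow> 'k) set"
  where "tensor_comult R C \<Delta> D \<Delta>' =
    (let T = tensor R C D; TT = tensor R T T
     in tensor_lift R C D TT (\<lambda>c d.
          tensor_lift R C C TT (\<lambda>c1 c2.
            tensor_lift R D D TT (\<lambda>d1 d2. pure R T T (pure R C D c1 d1) (pure R C D c2 d2))
              (\<Delta>' d)) (\<Delta> c)))"

definition tensor_counit ::
  "('k, 'r) ring_scheme \<Rightarrow>
    ('k, 'a, 'm) module_scheme \<Rightarrow> ('a \<Rightarrow> 'k) \<Rightarrow> ('k, 'b, 'n) module_scheme \<Rightarrow> ('b \<Rightarrow> 'k) \<Rightarrow>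
    ('a \<times> 'b \<Rightarrow> 'k) set \<Rightarrow> 'k"
  where "tensor_counit R C \<epsilon> D \<epsilon>' =
    tensor_lift R C D (base_module R) (\<lambda>c d. \<epsilon> c \<otimes>\<^bsub>R\<^esub> \<epsilon>' d)"

definition base_comult :: "('k, 'r) ring_scheme \<Rightarrow> 'k \<Rightarrow> ('k \<times> 'k \<Rightarrow> 'k) set"
  where "base_comult R a = pure R (base_module R) (base_module R) a \<one>\<^bsub>R\<^esub>"


section \<open>Weak Hopf algebras\<close>

text \<open>
  Triple tensors live in \<open>(H \<otimes> H) \<otimes> H\<close>, so \<open>1 \<otimes> \<Delta>(1)\<close> is moved there by \<open>tensor_assoc\<close>, and
  \<open>h\<^sub>1 \<otimes> h\<^sub>2 \<otimes> h\<^sub>3\<close> is \<open>(\<Delta> \<otimes> id)(\<Delta>(h))\<close>.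
\<close>

locale weak_hopf_algebra =
  assoc_algebra R H + coalgebra R H \<Delta> \<epsilon> for R (structure) and H (structure) and \<Delta> \<epsilon> +
  fixes S
  assumes comult_mult: "\<lbrakk>h \<in> carrier H; l \<in> carrier H\<rbrakk> \<Longrightarrow>
      \<Delta> (h \<otimes>\<^bsub>H\<^esub> l) = \<Delta> h \<otimes>\<^bsub>tensor_algebra R H H\<^esub> \<Delta> l"
    and counit_weak1: "\<lbrakk>h \<in> carrier H; k \<in> carrier H; l \<in> carrier H\<rbrakk> \<Longrightarrow>
      \<epsilon> (h \<otimes>\<^bsub>H\<^esub> k \<otimes>\<^bsub>H\<^esub> l) =
      tensor_lift R H H (base_module R)
        (\<lambda>k1 k2. \<epsilon> (h \<otimes>\<^bsub>H\<^esub> k1) \<otimes>\<^bsub>R\<^esub> \<epsilon> (k2 \<otimes>\<^bsub>H\<^esub> l)) (\<Delta> k)"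
    and counit_weak2: "\<lbrakk>h \<in> carrier H; k \<in> carrier H; l \<in> carrier H\<rbrakk> \<Longrightarrow>
      \<epsilon> (h \<otimes>\<^bsub>H\<^esub> k \<otimes>\<^bsub>H\<^esub> l) =
      tensor_lift R H H (base_module R)
        (\<lambda>k1 k2. \<epsilon> (h \<otimes>\<^bsub>H\<^esub> k2) \<otimes>\<^bsub>R\<^esub> \<epsilon> (k1 \<otimes>\<^bsub>H\<^esub> l)) (\<Delta> k)"
    and comult_one1:
      "tensor_map R H H (tensor R H H) H \<Delta> (\<lambda>x. x) (\<Delta> \<one>\<^bsub>H\<^esub>) =
       pure R (tensor R H H) H (\<Delta> \<one>\<^bsub>H\<^esub>) \<one>\<^bsub>H\<^esub>
         \<otimes>\<^bsub>tensor_algebra R (tensor_algebra R H H) H\<^esub>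
       tensor_assoc R H H H (pure R H (tensor R H H) \<one>\<^bsub>H\<^esub> (\<Delta> \<one>\<^bsub>H\<^esub>))"
    and comult_one2:
      "tensor_map R H H (tensor R H H) H \<Delta> (\<lambda>x. x) (\<Delta> \<one>\<^bsub>H\<^esub>) =
       tensor_assoc R H H H (pure R H (tensor R H H) \<one>\<^bsub>H\<^esub> (\<Delta> \<one>\<^bsub>H\<^esub>))
         \<otimes>\<^bsub>tensor_algebra R (tensor_algebra R H H) H\<^esub>
       pure R (tensor R H H) H (\<Delta> \<one>\<^bsub>H\<^esub>) \<one>\<^bsub>H\<^esub>"
    and antipode_linear: "lin_map R H H S"
    and antipode_right: "h \<in> carrier H \<Longrightarrow>
      tensor_lift R H H H (\<lambda>h1 h2. h1 \<otimes>\<^bsub>H\<^esub> S h2) (\<Delta> h) =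
      tensor_lift R H H H (\<lambda>e1 e2. \<epsilon> (e1 \<otimes>\<^bsub>H\<^esub> h) \<odot>\<^bsub>H\<^esub> e2) (\<Delta> \<one>\<^bsub>H\<^esub>)"
    and antipode_left: "h \<in> carrier H \<Longrightarrow>
      tensor_lift R H H H (\<lambda>h1 h2. S h1 \<otimes>\<^bsub>H\<^esub> h2) (\<Delta> h) =
      tensor_lift R H H H (\<lambda>e1 e2. \<epsilon> (h \<otimes>\<^bsub>H\<^esub> e2) \<odot>\<^bsub>H\<^esub> e1) (\<Delta> \<one>\<^bsub>H\<^esub>)"
    and antipode_sandwich: "h \<in> carrier H \<Longrightarrow>
      tensor_lift R (tensor R H H) H H
        (\<lambda>t h3. tensor_lift R H H H (\<lambda>h1 h2. S h1 \<otimes>\<^bsub>H\<^esub> h2 \<otimes>\<^bsub>H\<^esub> S h3) t)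
        (tensor_map R H H (tensor R H H) H \<Delta> (\<lambda>x. x) (\<Delta> h)) = S h"


section \<open>Hopf categories\<close>

text \<open>
  \<open>m x y z\<close> is a map on the tensor product of \<open>A x y\<close> and \<open>A y z\<close>, \<open>u x\<close> is the element \<open>1\<^sub>x\<close>, and
  \<open>hprod R A m x y z h l\<close> is the composite \<open>hl\<close>.
\<close>

definition hprod ::
  "('k, 'r) ring_scheme \<Rightarrow> ('x \<Rightarrow> 'x \<Rightarrow> ('k, 'a, 'm) module_scheme) \<Rightarrow>
    ('x \<Rightarrow> 'x \<Rightarrow> 'x \<Rightarrow> ('a \<times> 'a \<Rightarrow> 'k) set \<Rightarrow> 'a) \<Rightarrow> 'x \<Rightarrow> 'x \<Rightarrow> 'x \<Rightarrow> 'a \<Rightarrow> 'a \<Rightarrow> 'a"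
  where "hprod R A m x y z h l = m x y z (pure R (A x y) (A y z) h l)"

locale hopf_category = cring R for R (structure) +
  fixes X :: "'x set"
    and A :: "'x \<Rightarrow> 'x \<Rightarrow> ('a, 'b, 'm) module_scheme"
    and \<Delta> :: "'x \<Rightarrow> 'x \<Rightarrow> 'b \<Rightarrow> ('b \<times> 'b \<Rightarrow> 'a) set"
    and \<epsilon> :: "'x \<Rightarrow> 'x \<Rightarrow> 'b \<Rightarrow> 'a"
    and m :: "'x \<Rightarrow> 'x \<Rightarrow> 'x \<Rightarrow> ('b \<times> 'b \<Rightarrow> 'a) set \<Rightarrow> 'b"
    and u :: "'x \<Rightarrow> 'b"
    and S :: "'x \<Rightarrow> 'x \<Rightarrow> 'b \<Rightarrow> 'b"
  assumes hom_coalgebra: "\<lbrakk>x \<in> X; y \<in> X\<rbrakk> \<Longrightarrow> coalgebra R (A x y) (\<Delta> x y) (\<epsilon> x y)"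
    and mult_coalgebra_hom: "\<lbrakk>x \<in> X; y \<in> X; z \<in> X\<rbrakk> \<Longrightarrow>
      coalgebra_hom R
        (tensor R (A x y) (A y z))
        (tensor_comult R (A x y) (\<Delta> x y) (A y z) (\<Delta> y z))
        (tensor_counit R (A x y) (\<epsilon> x y) (A y z) (\<epsilon> y z))
        (A x z) (\<Delta> x z) (\<epsilon> x z) (m x y z)"
    and unit_closed: "x \<in> X \<Longrightarrow> u x \<in> carrier (A x x)"
    and unit_coalgebra_hom: "x \<in> X \<Longrightarrow>
      coalgebra_hom R (base_module R) (base_comult R) (\<lambda>a. a)
        (A x x) (\<Delta> x x) (\<epsilon> x x) (\<lambda>a. a \<odot>\<^bsub>A x x\<^esub> u x)"
    and hprod_assoc:
      "\<lbrakk>x \<in> X; y \<in> X; z \<in> X; w \<in> X;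
        h \<in> carrier (A x y); l \<in> carrier (A y z); k \<in> carrier (A z w)\<rbrakk> \<Longrightarrow>
        hprod R A m x z w (hprod R A m x y z h l) k = hprod R A m x y w h (hprod R A m y z w l k)"
    and unit_left: "\<lbrakk>x \<in> X; y \<in> X; h \<in> carrier (A x y)\<rbrakk> \<Longrightarrow> hprod R A m x x y (u x) h = h"
    and unit_right: "\<lbrakk>x \<in> X; y \<in> X; h \<in> carrier (A x y)\<rbrakk> \<Longrightarrow> hprod R A m x y y h (u y) = h"
    and antipode_linear: "\<lbrakk>x \<in> X; y \<in> X\<rbrakk> \<Longrightarrow> lin_map R (A x y) (A y x) (S x y)"
    and antipode_right: "\<lbrakk>x \<in> X; y \<in> X; h \<in> carrier (A x y)\<rbrakk> \<Longrightarrow>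
      tensor_lift R (A x y) (A x y) (A x x)
        (\<lambda>h1 h2. hprod R A m x y x h1 (S x y h2)) (\<Delta> x y h) = \<epsilon> x y h \<odot>\<^bsub>A x x\<^esub> u x"
    and antipode_left: "\<lbrakk>x \<in> X; y \<in> X; h \<in> carrier (A x y)\<rbrakk> \<Longrightarrow>
      tensor_lift R (A x y) (A x y) (A y y)
        (\<lambda>h1 h2. hprod R A m y x y (S x y h1) h2) (\<Delta> x y h) = \<epsilon> x y h \<odot>\<^bsub>A y y\<^esub> u y"


section \<open>The structure on the direct sum\<close>

definition hsum_module ::
  "'x set \<Rightarrow> ('x \<Rightarrow> 'x \<Rightarrow> ('k, 'a, 'm) module_scheme) \<Rightarrow> ('k, 'x \<times> 'x \<Rightarrow> 'a) module"
  where "hsum_module X A = direct_sum (X \<times> X) (\<lambda>(x, y). A x y)"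

definition hsum_inj ::
  "'x set \<Rightarrow> ('x \<Rightarrow> 'x \<Rightarrow> ('k, 'a, 'm) module_scheme) \<Rightarrow> 'x \<Rightarrow> 'x \<Rightarrow> 'a \<Rightarrow> ('x \<times> 'x \<Rightarrow> 'a)"
  where "hsum_inj X A x y = inj_sum (X \<times> X) (\<lambda>(x, y). A x y) (x, y)"

text \<open>The sums over \<open>X\<close> below are meaningful for finite \<open>X\<close> only.\<close>

definition hsum_algebra ::
  "('k, 'r) ring_scheme \<Rightarrow> 'x set \<Rightarrow> ('x \<Rightarrow> 'x \<Rightarrow> ('k, 'a, 'm) module_scheme) \<Rightarrow>
    ('x \<Rightarrow> 'x \<Rightarrow> 'x \<Rightarrow> ('a \<times> 'a \<Rightarrow> 'k) set \<Rightarrow> 'a) \<Rightarrow> ('x \<Rightarrow> 'a) \<Rightarrow> ('k, 'x \<times> 'x \<Rightarrow> 'a) module"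
  where "hsum_algebra R X A m u =
    (let D = hsum_module X A
     in D\<lparr>mult := (\<lambda>f g.
            \<Oplus>\<^bsub>D\<^esub> x\<in>X. \<Oplus>\<^bsub>D\<^esub> y\<in>X. \<Oplus>\<^bsub>D\<^esub> z\<in>X. \<Oplus>\<^bsub>D\<^esub> w\<in>X.
              if y = z then hsum_inj X A x w (hprod R A m x y w (f (x, y)) (g (z, w))) else \<zero>\<^bsub>D\<^esub>),
          one := (\<Oplus>\<^bsub>D\<^esub> x\<in>X. hsum_inj X A x x (u x))\<rparr>)"

definition hsum_comult ::
  "('k, 'r) ring_scheme \<Rightarrow> 'x set \<Rightarrow> ('x \<Rightarrow> 'x \<Rightarrow> ('k, 'a, 'm) module_scheme) \<Rightarrow>
    ('x \<Rightarrow> 'x \<Rightarrow> 'a \<Rightarrow> ('a \<times> 'a \<Rightarrow> 'k) set) \<Rightarrow>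
    ('x \<times> 'x \<Rightarrow> 'a) \<Rightarrow> (('x \<times> 'x \<Rightarrow> 'a) \<times> ('x \<times> 'x \<Rightarrow> 'a) \<Rightarrow> 'k) set"
  where "hsum_comult R X A \<Delta> f =
    (let D = hsum_module X A
     in \<Oplus>\<^bsub>tensor R D D\<^esub> x\<in>X. \<Oplus>\<^bsub>tensor R D D\<^esub> y\<in>X.
          tensor_map R (A x y) (A x y) D D (hsum_inj X A x y) (hsum_inj X A x y) (\<Delta> x y (f (x, y))))"

definition hsum_counit ::
  "('k, 'r) ring_scheme \<Rightarrow> 'x set \<Rightarrow> ('x \<Rightarrow> 'x \<Rightarrow> 'a \<Rightarrow> 'k) \<Rightarrow> ('x \<times> 'x \<Rightarrow> 'a) \<Rightarrow> 'k"
  where "hsum_counit R X \<epsilon> f = (\<Oplus>\<^bsub>R\<^esub> x\<in>X. \<Oplus>\<^bsub>R\<^esub> y\<in>X. \<epsilon> x y (f (x, y)))"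

definition hsum_antipode ::
  "'x set \<Rightarrow> ('x \<Rightarrow> 'x \<Rightarrow> ('k, 'a, 'm) module_scheme) \<Rightarrow> ('x \<Rightarrow> 'x \<Rightarrow> 'a \<Rightarrow> 'a) \<Rightarrow>
    ('x \<times> 'x \<Rightarrow> 'a) \<Rightarrow> ('x \<times> 'x \<Rightarrow> 'a)"
  where "hsum_antipode X A S f =
    (let D = hsum_module X A
     in \<Oplus>\<^bsub>D\<^esub> x\<in>X. \<Oplus>\<^bsub>D\<^esub> y\<in>X. hsum_inj X A y x (S x y (f (x, y))))"

end

theory Submission
  imports Defs
begin

text \<open>
  Every weak Hopf algebra axiom is an identity between maps that are linear in each argument, so it
  suffices to check it on elements of the components \<open>A x y\<close>. Products of elements that are not
  composable vanish, and for composable ones the axioms reduce to the corresponding facts in the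
  Hopf category: \<open>\<Delta>\<close> and \<open>\<epsilon>\<close> are multiplicative there. The units \<open>1\<^sub>x\<close> are orthogonal
  idempotents and group-like, so \<open>\<Delta>(1) = \<Sum>\<^sub>x 1\<^sub>x \<otimes> 1\<^sub>x\<close>; both sides of the two antipode axioms for
  \<open>h \<in> A x y\<close> are then \<open>\<epsilon>(h) 1\<^sub>x\<close> and \<open>\<epsilon>(h) 1\<^sub>y\<close>, respectively.
\<close>

section \<open>Linear maps and direct sums\<close>

text \<open>An element of a tensor product is a coset of formal sums, and \<open>tensor_lift\<close>
  evaluates at a representative picked by choice, so no legs \<open>h\<^sub>1\<close> and
  \<open>h\<^sub>2\<close> can be manipulated directly. The universal property takes the place of
  Sweedler notation: a lift is well defined and linear, and linear maps that agree on pure tensors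
  are equal. A Sweedler computation becomes a chain that moves linear maps in and out of lifts and
  rewrites the bilinear map under a lift; the many lemmas on linearity are the side conditions of
  these moves. The product of the direct sum is a quadruple sum, which would burden every such
  chain. The axioms are therefore derived for an abstract module \<open>H\<close> with injections of
  the components, and the quadruple sum is met only where the direct sum is shown to be such an
  \<open>H\<close>.\<close>

lemma lin_mapI:
  assumes "\<And>x. x \<in> carrier M \<Longrightarrow> f x \<in> carrier N"
    and "\<And>x y. \<lbrakk>x \<in> carrier M; y \<in> carrier M\<rbrakk> \<Longrightarrow> f (x \<oplus>\<^bsub>M\<^esub> y) = f x \<oplus>\<^bsub>N\<^esub> f y"
    and "\<And>a x. \<lbrakk>a \<in> carrier R; x \<in> carrier M\<rbrakk> \<Longrightarrow> f (a \<odot>\<^bsub>M\<^esub> x) = a \<odot>\<^bsub>N\<^esub> f x"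
  shows "lin_map R M N f"
  using assms unfolding lin_map_def by blast

lemma lin_map_closed: "\<lbrakk>lin_map R M N f; x \<in> carrier M\<rbrakk> \<Longrightarrow> f x \<in> carrier N"
  and lin_map_add: "\<lbrakk>lin_map R M N f; x \<in> carrier M; y \<in> carrier M\<rbrakk> \<Longrightarrow>
    f (x \<oplus>\<^bsub>M\<^esub> y) = f x \<oplus>\<^bsub>N\<^esub> f y"
  and lin_map_smult: "\<lbrakk>lin_map R M N f; a \<in> carrier R; x \<in> carrier M\<rbrakk> \<Longrightarrow>
    f (a \<odot>\<^bsub>M\<^esub> x) = a \<odot>\<^bsub>N\<^esub> f x"
  unfolding lin_map_def by blast+

lemma lin_map_id: "lin_map R M M (\<lambda>x. x)"
  by (rule lin_mapI) simp_all

lemma lin_map_comp: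
  "\<lbrakk>lin_map R N P g; lin_map R M N f\<rbrakk> \<Longrightarrow> lin_map R M P (\<lambda>x. g (f x))"
  unfolding lin_map_def by (auto simp: Pi_def)

text \<open>The module hypothesis supplies closure of the carrier under addition and scaling,
  through which agreement on the carrier reaches the values at sums and multiples.\<close>

lemma lin_map_cong:
  assumes "module R M" and "\<And>x. x \<in> carrier M \<Longrightarrow> f x = g x"
  shows "lin_map R M N f \<longleftrightarrow> lin_map R M N g"
proof -
  interpret M: module R M by fact
  show ?thesis unfolding lin_map_def using assms(2) by (auto simp: Pi_def)
qed

lemma lin_map_zero:
  assumes "module R M" "module R N" "lin_map R M N f"
  shows "f \<zero>\<^bsub>M\<^esub> = \<zero>\<^bsub>N\<^esub>"
proof -
  interpret M: module R M by fact
  interpret N: module R N by fact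
  have "f (\<zero>\<^bsub>R\<^esub> \<odot>\<^bsub>M\<^esub> \<zero>\<^bsub>M\<^esub>) = \<zero>\<^bsub>R\<^esub> \<odot>\<^bsub>N\<^esub> f \<zero>\<^bsub>M\<^esub>"
    using assms(3) by (rule lin_map_smult) simp_all
  then show ?thesis using lin_map_closed[OF assms(3)] by simp
qed

lemma lin_map_minus:
  assumes "module R M" "module R N" "lin_map R M N f" "x \<in> carrier M" "y \<in> carrier M"
  shows "f (x \<ominus>\<^bsub>M\<^esub> y) = f x \<ominus>\<^bsub>N\<^esub> f y"
proof -
  interpret M: module R M by fact
  interpret N: module R N by fact
  \<comment> \<open>Writing subtraction as adding a multiple by minus one reduces it to additivity
    and homogeneity.\<close>
  have eq: "x \<ominus>\<^bsub>M\<^esub> y = x \<oplus>\<^bsub>M\<^esub> (\<ominus>\<^bsub>R\<^esub> \<one>\<^bsub>R\<^esub>) \<odot>\<^bsub>M\<^esub> y"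
    using assms by (simp add: M.smult_l_minus M.minus_eq)
  show ?thesis
    unfolding eq using assms lin_map_closed[OF assms(3)]
    by (simp add: lin_map_add[OF assms(3)] lin_map_smult[OF assms(3)] N.smult_l_minus N.minus_eq)
qed

text \<open>Over an infinite index set \<open>finsum\<close> is zero by convention, and a linear map
  preserves zero, so the induction covers every \<open>I\<close>.\<close>

lemma lin_map_finsum:
  assumes "module R M" "module R N" "lin_map R M N f" "g \<in> I \<rightarrow> carrier M"
  shows "f (\<Oplus>\<^bsub>M\<^esub> i\<in>I. g i) = (\<Oplus>\<^bsub>N\<^esub> i\<in>I. f (g i))"
proof -
  interpret M: module R M by fact
  interpret N: module R N by fact
  show ?thesis using assms(4)
  proof (induct I rule: infinite_finite_induct)
    case (infinite I)
    then show ?case using lin_map_zero[OF assms(1-3)] by (simp add: M.finsum_infinite N.finsum_infinite)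
  next
    case empty
    then show ?case using lin_map_zero[OF assms(1-3)] by simp
  next
    case (insert i I)
    then have "(\<lambda>j. f (g j)) \<in> I \<rightarrow> carrier N" "f (g i) \<in> carrier N"
      using lin_map_closed[OF assms(3)] by auto
    with insert show ?case by (simp add: lin_map_add[OF assms(3)])
  qed
qed

lemma lin_map_const_zero:
  assumes "module R N"
  shows "lin_map R M N (\<lambda>x. \<zero>\<^bsub>N\<^esub>)"
proof -
  interpret N: module R N by fact
  show ?thesis by (rule lin_mapI) simp_all
qed

text \<open>Here the variable sits inside the summands, whereas \<open>lin_map_finsum\<close> moves
  a fixed map through a sum. The structure maps of the direct sum and the right-hand sides of the
  antipode axioms have this form.\<close>

lemma lin_map_finsum_fun:
  assumes "module R N" "\<And>i. i \<in> I \<Longrightarrow> lin_map R M N (\<lambda>x. f x i)"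
  shows "lin_map R M N (\<lambda>x. \<Oplus>\<^bsub>N\<^esub> i\<in>I. f x i)"
proof -
  interpret N: module R N by fact
  have c: "x \<in> carrier M \<Longrightarrow> f x \<in> I \<rightarrow> carrier N" for x
    using lin_map_closed[OF assms(2)] by fastforce
  show ?thesis
  proof (rule lin_mapI)
    fix x y assume xy: "x \<in> carrier M" "y \<in> carrier M"
    have "(\<Oplus>\<^bsub>N\<^esub> i\<in>I. f (x \<oplus>\<^bsub>M\<^esub> y) i) = (\<Oplus>\<^bsub>N\<^esub> i\<in>I. f x i \<oplus>\<^bsub>N\<^esub> f y i)"
      by (rule N.finsum_cong') (use xy c lin_map_add[OF assms(2)] in auto)
    then show "(\<Oplus>\<^bsub>N\<^esub> i\<in>I. f (x \<oplus>\<^bsub>M\<^esub> y) i) = (\<Oplus>\<^bsub>N\<^esub> i\<in>I. f x i) \<oplus>\<^bsub>N\<^esub> (\<Oplus>\<^bsub>N\<^esub> i\<in>I. f y i)"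
      using xy c by (simp add: N.finsum_addf)
  next
    fix a x assume ax: "a \<in> carrier R" "x \<in> carrier M"
    have "(\<Oplus>\<^bsub>N\<^esub> i\<in>I. f (a \<odot>\<^bsub>M\<^esub> x) i) = (\<Oplus>\<^bsub>N\<^esub> i\<in>I. a \<odot>\<^bsub>N\<^esub> f x i)"
      by (rule N.finsum_cong') (use ax c lin_map_smult[OF assms(2)] in \<open>auto simp: Pi_def\<close>)
    \<comment> \<open>Commutativity of \<open>R\<close> makes scaling by \<open>a\<close> linear, so
      it passes through the sum by \<open>lin_map_finsum\<close>.\<close>
    moreover have "lin_map R N N (\<lambda>x. a \<odot>\<^bsub>N\<^esub> x)"
      using ax by (intro lin_mapI)
        (simp_all add: N.smult_r_distr N.smult_assoc1[symmetric] N.R.m_comm)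
    ultimately show "(\<Oplus>\<^bsub>N\<^esub> i\<in>I. f (a \<odot>\<^bsub>M\<^esub> x) i) = a \<odot>\<^bsub>N\<^esub> (\<Oplus>\<^bsub>N\<^esub> i\<in>I. f x i)"
      using lin_map_finsum[OF assms(1,1) _ c] ax by simp
  qed (use c in simp)
qed

lemma lin_map_smult_left:
  assumes "module R N" "lin_map R M (base_module R) f" "y \<in> carrier N"
  shows "lin_map R M N (\<lambda>x. f x \<odot>\<^bsub>N\<^esub> y)"
proof -
  interpret N: module R N by fact
  have s: "carrier (base_module R) = carrier R" "add (base_module R) = add R" "smult (base_module R) = mult R"
    by (simp_all add: base_module_def)
  show ?thesis
    using assms(3) lin_map_closed[OF assms(2)]
    by (intro lin_mapI)
      (simp_all add: lin_map_add[OF assms(2)] lin_map_smult[OF assms(2)] s N.smult_l_distr N.smult_assoc1)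
qed

lemma lin_map_smult_right:
  assumes "module R N" "lin_map R M N f" "a \<in> carrier R"
  shows "lin_map R M N (\<lambda>x. a \<odot>\<^bsub>N\<^esub> f x)"
proof -
  interpret N: module R N by fact
  show ?thesis
    using assms(3) lin_map_closed[OF assms(2)]
    by (intro lin_mapI)
      (simp_all add: lin_map_add[OF assms(2)] lin_map_smult[OF assms(2)] N.smult_r_distr
        N.smult_assoc1[symmetric] N.R.m_comm)
qed

section \<open>The base ring as a module over itself\<close>

lemma base_module_simps [simp]:
  "carrier (base_module R) = carrier R" "add (base_module R) = add R"
  "zero (base_module R) = zero R" "smult (base_module R) = mult R"
  by (simp_all add: base_module_def)

lemma module_base_module:
  assumes "cring R"
  shows "module R (base_module R)"
proof -
  interpret cring R by fact
  show ?thesis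
    by (rule moduleI[OF assms]; (rule abelian_groupI)?)
      (auto simp: a_ac m_assoc l_distr r_distr intro: add.inv_closed l_neg)
qed

text \<open>\<open>finsum\<close> consults only the carrier, addition and zero of its record. Sums
  can thus be moved between records that differ elsewhere: the base module and \<open>R\<close>, or
  the algebra and the module on the direct sum.\<close>

lemma finsum_eqI:
  assumes "carrier M = carrier N" "add M = add N" "zero M = zero N"
  shows "finsum M f I = finsum N f I"
  using assms by (simp add: finsum_def finprod_def)

lemma finsum_base_module [simp]: "finsum (base_module R) = finsum R"
  by (intro ext finsum_eqI) simp_all

section \<open>Direct sums of modules\<close>

lemma direct_sum_simps:
  "carrier (direct_sum I M) = {f \<in> (\<Pi>\<^sub>E i\<in>I. carrier (M i)). finite {i \<in> I. f i \<noteq> \<zero>\<^bsub>M i\<^esub>}}"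
  "zero (direct_sum I M) = (\<lambda>i\<in>I. \<zero>\<^bsub>M i\<^esub>)"
  "f \<oplus>\<^bsub>direct_sum I M\<^esub> g = (\<lambda>i\<in>I. f i \<oplus>\<^bsub>M i\<^esub> g i)"
  "a \<odot>\<^bsub>direct_sum I M\<^esub> f = (\<lambda>i\<in>I. a \<odot>\<^bsub>M i\<^esub> f i)"
  by (simp_all add: direct_sum_def)

lemma abelian_group_minus_zero: "abelian_group G \<Longrightarrow> \<ominus>\<^bsub>G\<^esub> \<zero>\<^bsub>G\<^esub> = \<zero>\<^bsub>G\<^esub>"
  using monoid.inv_one[OF group.is_monoid, OF abelian_group.a_group] by (simp add: a_inv_def)

text \<open>The laws hold coordinatewise. What needs an argument is finite support: the supports of
  sums, negatives and multiples are contained in the union of the supports of the arguments.\<close>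

lemma module_direct_sum:
  assumes "cring R" and M: "\<And>i. i \<in> I \<Longrightarrow> module R (M i)"
  shows "module R (direct_sum I M)"
proof (rule moduleI[OF assms(1)])
  have ab: "i \<in> I \<Longrightarrow> abelian_group (M i)" for i using M by (simp add: module_def)
  have am: "i \<in> I \<Longrightarrow> abelian_monoid (M i)" for i using ab by (simp add: abelian_group_def)
  have add: "f \<oplus>\<^bsub>direct_sum I M\<^esub> g \<in> carrier (direct_sum I M)"
    if "f \<in> carrier (direct_sum I M)" "g \<in> carrier (direct_sum I M)" for f g
  proof -
    have "{i \<in> I. f i \<oplus>\<^bsub>M i\<^esub> g i \<noteq> \<zero>\<^bsub>M i\<^esub>} \<subseteq> {i \<in> I. f i \<noteq> \<zero>\<^bsub>M i\<^esub>} \<union> {i \<in> I. g i \<noteq> \<zero>\<^bsub>M i\<^esub>}"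
      using am by (auto simp: abelian_monoid.l_zero abelian_monoid.zero_closed)
    with that show ?thesis
      by (auto simp: direct_sum_simps PiE_iff am abelian_monoid.a_closed cong: conj_cong intro: finite_subset)
  qed
  show "abelian_group (direct_sum I M)"
  proof (rule abelian_groupI)
    show "\<zero>\<^bsub>direct_sum I M\<^esub> \<in> carrier (direct_sum I M)"
      by (auto simp: direct_sum_simps am abelian_monoid.zero_closed cong: conj_cong)
    show "\<exists>g\<in>carrier (direct_sum I M). g \<oplus>\<^bsub>direct_sum I M\<^esub> f = \<zero>\<^bsub>direct_sum I M\<^esub>"
      if f: "f \<in> carrier (direct_sum I M)" for f
    proof
      have "{i \<in> I. \<ominus>\<^bsub>M i\<^esub> f i \<noteq> \<zero>\<^bsub>M i\<^esub>} \<subseteq> {i \<in> I. f i \<noteq> \<zero>\<^bsub>M i\<^esub>}"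
        using ab by (auto simp: abelian_group_minus_zero)
      with f show "(\<lambda>i\<in>I. \<ominus>\<^bsub>M i\<^esub> f i) \<in> carrier (direct_sum I M)"
        by (auto simp: direct_sum_simps PiE_iff ab abelian_group.a_inv_closed cong: conj_cong intro: finite_subset)
      show "(\<lambda>i\<in>I. \<ominus>\<^bsub>M i\<^esub> f i) \<oplus>\<^bsub>direct_sum I M\<^esub> f = \<zero>\<^bsub>direct_sum I M\<^esub>"
        using f by (auto simp: direct_sum_simps PiE_iff ab abelian_group.l_neg intro!: restrict_ext)
    qed
  qed (auto simp: add, auto simp: direct_sum_simps PiE_iff am ab abelian_monoid.a_assoc
        abelian_monoid.a_comm abelian_monoid.l_zero extensional_def intro!: restrict_ext)
  show "a \<odot>\<^bsub>direct_sum I M\<^esub> f \<in> carrier (direct_sum I M)"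
    if "a \<in> carrier R" "f \<in> carrier (direct_sum I M)" for a f
  proof -
    have "{i \<in> I. a \<odot>\<^bsub>M i\<^esub> f i \<noteq> \<zero>\<^bsub>M i\<^esub>} \<subseteq> {i \<in> I. f i \<noteq> \<zero>\<^bsub>M i\<^esub>}"
      using M that by (auto simp: module.smult_r_null[of R])
    with that show ?thesis
      by (auto simp: direct_sum_simps PiE_iff M module.smult_closed[of R] cong: conj_cong intro: finite_subset)
  qed
qed (auto simp: direct_sum_simps PiE_iff M module.smult_l_distr[of R] module.smult_r_distr[of R] module.smult_assoc1[of R]
      module.smult_one[of R] extensional_def intro!: restrict_ext)

lemma lin_map_inj_sum:
  assumes "\<And>i. i \<in> I \<Longrightarrow> module R (M i)" "j \<in> I"
  shows "lin_map R (M j) (direct_sum I M) (inj_sum I M j)"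
proof -
  have ab: "i \<in> I \<Longrightarrow> abelian_group (M i)" for i using assms by (simp add: module_def)
  have am: "i \<in> I \<Longrightarrow> abelian_monoid (M i)" for i using ab by (simp add: abelian_group_def)
  \<comment> \<open>The support of \<open>inj_sum I M j x\<close> in the form to which
    simplification brings it; it has at most one element.\<close>
  have "{i \<in> I. (i = j \<longrightarrow> x \<noteq> \<zero>\<^bsub>M j\<^esub>) \<and> i = j} \<subseteq> {j}" for x by auto
  then have fin: "finite {i \<in> I. (i = j \<longrightarrow> x \<noteq> \<zero>\<^bsub>M j\<^esub>) \<and> i = j}" for x
    using finite_subset by blast
  show ?thesis
    by (rule lin_mapI)
      (auto simp: direct_sum_simps inj_sum_def fin am ab assms abelian_monoid.l_zero abelian_monoid.zero_closed
        module.smult_r_null[of R] cong: conj_cong intro!: restrict_ext)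
qed

lemma lin_map_direct_sum_proj:
  assumes "i \<in> I"
  shows "lin_map R (direct_sum I M) (M i) (\<lambda>f. f i)"
  using assms by (intro lin_mapI) (auto simp: direct_sum_simps)

text \<open>Induction on a finite set containing the support, splitting off one coordinate at a
  time. The case \<open>inj\<close> ranges over whole summands, so scalar multiples require no case
  of their own.\<close>

lemma direct_sum_induct [consumes 2, case_names zero inj add]:
  assumes M: "\<And>i. i \<in> I \<Longrightarrow> module R (M i)" and f: "f \<in> carrier (direct_sum I M)"
    and zero: "P \<zero>\<^bsub>direct_sum I M\<^esub>"
    and inj: "\<And>i a. \<lbrakk>i \<in> I; a \<in> carrier (M i)\<rbrakk> \<Longrightarrow> P (inj_sum I M i a)"
    and add: "\<And>f g. \<lbrakk>f \<in> carrier (direct_sum I M); g \<in> carrier (direct_sum I M); P f; P g\<rbrakk> \<Longrightarrow>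
      P (f \<oplus>\<^bsub>direct_sum I M\<^esub> g)"
  shows "P f"
proof -
  have am: "i \<in> I \<Longrightarrow> abelian_monoid (M i)" for i using M by (simp add: abelian_group_def module_def)
  have "finite F \<Longrightarrow> f \<in> carrier (direct_sum I M) \<Longrightarrow> {i \<in> I. f i \<noteq> \<zero>\<^bsub>M i\<^esub>} \<subseteq> F \<Longrightarrow> P f" for F f
  proof (induct F arbitrary: f rule: finite_induct)
    case empty
    then have "f = \<zero>\<^bsub>direct_sum I M\<^esub>"
      by (auto simp: direct_sum_simps PiE_iff extensional_def)
    then show ?case using zero by simp
  next
    case (insert j F)
    show ?case
    proof (cases "j \<in> I")
      case True
      \<comment> \<open>\<open>f\<close> with coordinate \<open>j\<close> erased, so that its
        support lies in \<open>F\<close>.\<close>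
      define g where "g = (\<lambda>i\<in>I. if i = j then \<zero>\<^bsub>M j\<^esub> else f i)"
      have "{i \<in> I. g i \<noteq> \<zero>\<^bsub>M i\<^esub>} \<subseteq> {i \<in> I. f i \<noteq> \<zero>\<^bsub>M i\<^esub>}" by (auto simp: g_def)
      moreover have "finite {i \<in> I. f i \<noteq> \<zero>\<^bsub>M i\<^esub>}" using insert.prems(1) by (simp add: direct_sum_simps)
      ultimately have "finite {i \<in> I. g i \<noteq> \<zero>\<^bsub>M i\<^esub>}" by (rule finite_subset)
      then have g: "g \<in> carrier (direct_sum I M)"
        using insert.prems(1) True am
        by (auto simp: direct_sum_simps g_def PiE_iff abelian_monoid.zero_closed)
      have "P g" by (rule insert.hyps(3)[OF g]) (use insert.prems(2) in \<open>auto simp: g_def\<close>)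
      moreover have fj: "f j \<in> carrier (M j)" using insert.prems(1) True by (auto simp: direct_sum_simps)
      ultimately have "P (inj_sum I M j (f j) \<oplus>\<^bsub>direct_sum I M\<^esub> g)"
        using inj[OF True fj] g lin_map_closed[OF lin_map_inj_sum[of I R M, OF M True] fj] by (intro add) auto
      moreover have "inj_sum I M j (f j) \<oplus>\<^bsub>direct_sum I M\<^esub> g = f"
        using insert.prems(1) True am
        by (intro ext) (auto simp: direct_sum_simps inj_sum_def g_def PiE_iff extensional_def
            abelian_monoid.l_zero abelian_monoid.r_zero)
      ultimately show ?thesis by simp
    qed (use insert.hyps(3)[OF insert.prems(1)] insert.prems(2) in auto)
  qed
  from this[of "{i \<in> I. f i \<noteq> \<zero>\<^bsub>M i\<^esub>}" f] f show ?thesis by (simp add: direct_sum_simps)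
qed

section \<open>Quotient modules\<close>

lemma abelian_subgroup_submodule:
  assumes "module R M" "submodule N R M"
  shows "abelian_subgroup N M"
proof -
  interpret M: module R M by fact
  show ?thesis
    using assms(2) by (intro abelian_subgroupI3 additive_subgroupI M.abelian_group_axioms)
      (simp add: submodule_def)
qed

text \<open>Scaling in the quotient is a union over all representatives of a coset. It is a single
  coset because \<open>N\<close> is stable under scaling, so that all cosets united coincide. Zero
  is rewritten from \<open>N\<close> to the coset of zero to give every element of the quotient the
  same shape.\<close>

lemma quotient_module_simps:
  assumes "module R M" "submodule N R M"
  shows "carrier (quotient_module M N) = (\<lambda>x. N +>\<^bsub>M\<^esub> x) ` carrier M"
    and "\<zero>\<^bsub>quotient_module M N\<^esub> = N +>\<^bsub>M\<^esub> \<zero>\<^bsub>M\<^esub>"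
    and "\<lbrakk>x \<in> carrier M; y \<in> carrier M\<rbrakk> \<Longrightarrow>
      (N +>\<^bsub>M\<^esub> x) \<oplus>\<^bsub>quotient_module M N\<^esub> (N +>\<^bsub>M\<^esub> y) = N +>\<^bsub>M\<^esub> (x \<oplus>\<^bsub>M\<^esub> y)"
    and "\<lbrakk>a \<in> carrier R; x \<in> carrier M\<rbrakk> \<Longrightarrow>
      a \<odot>\<^bsub>quotient_module M N\<^esub> (N +>\<^bsub>M\<^esub> x) = N +>\<^bsub>M\<^esub> (a \<odot>\<^bsub>M\<^esub> x)"
proof -
  interpret M: module R M by fact
  interpret N: abelian_subgroup N M by (rule abelian_subgroup_submodule) fact+
  show "carrier (quotient_module M N) = (\<lambda>x. N +>\<^bsub>M\<^esub> x) ` carrier M"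
    by (auto simp: quotient_module_def A_RCOSETS_def')
  show "\<zero>\<^bsub>quotient_module M N\<^esub> = N +>\<^bsub>M\<^esub> \<zero>\<^bsub>M\<^esub>"
    using N.a_subset by (simp add: quotient_module_def)
  show "(N +>\<^bsub>M\<^esub> x) \<oplus>\<^bsub>quotient_module M N\<^esub> (N +>\<^bsub>M\<^esub> y) = N +>\<^bsub>M\<^esub> (x \<oplus>\<^bsub>M\<^esub> y)"
    if "x \<in> carrier M" "y \<in> carrier M"
    using that by (simp add: quotient_module_def N.a_rcos_sum)
  show "a \<odot>\<^bsub>quotient_module M N\<^esub> (N +>\<^bsub>M\<^esub> x) = N +>\<^bsub>M\<^esub> (a \<odot>\<^bsub>M\<^esub> x)"
    if a: "a \<in> carrier R" and x: "x \<in> carrier M"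
  proof -
    have eq: "N +>\<^bsub>M\<^esub> (a \<odot>\<^bsub>M\<^esub> c) = N +>\<^bsub>M\<^esub> (a \<odot>\<^bsub>M\<^esub> x)" if "c \<in> N +>\<^bsub>M\<^esub> x" for c
    proof -
      from that obtain n where n: "n \<in> N" "c = n \<oplus>\<^bsub>M\<^esub> x" by (auto simp: a_r_coset_def')
      have "n \<in> carrier M" using n(1) by simp
      then have "a \<odot>\<^bsub>M\<^esub> c = a \<odot>\<^bsub>M\<^esub> n \<oplus>\<^bsub>M\<^esub> a \<odot>\<^bsub>M\<^esub> x" using n a x by (simp add: M.smult_r_distr)
      moreover have "a \<odot>\<^bsub>M\<^esub> n \<in> N" using a n(1) assms(2) by (simp add: submodule.smult_closed)
      ultimately have "a \<odot>\<^bsub>M\<^esub> c \<in> N +>\<^bsub>M\<^esub> (a \<odot>\<^bsub>M\<^esub> x)" by (auto simp: a_r_coset_def')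
      then show ?thesis using a x by (intro N.a_repr_independence'[symmetric]) auto
    qed
    have "x \<in> N +>\<^bsub>M\<^esub> x" using x by (rule N.a_rcos_self)
    then have "(\<Union>c\<in>N +>\<^bsub>M\<^esub> x. N +>\<^bsub>M\<^esub> (a \<odot>\<^bsub>M\<^esub> c)) = N +>\<^bsub>M\<^esub> (a \<odot>\<^bsub>M\<^esub> x)"
      by (intro SUP_eq_const eq) blast
    then show ?thesis by (simp add: quotient_module_def)
  qed
qed

lemma module_quotient_module:
  assumes "module R M" "submodule N R M"
  shows "module R (quotient_module M N)"
proof -
  interpret M: module R M by fact
  note q = quotient_module_simps[OF assms]
  show ?thesis
  proof (rule moduleI)
    show "abelian_group (quotient_module M N)"
    proof (rule abelian_groupI)
      show "\<exists>y\<in>carrier (quotient_module M N). y \<oplus>\<^bsub>quotient_module M N\<^esub> x = \<zero>\<^bsub>quotient_module M N\<^esub>"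
        if x: "x \<in> carrier (quotient_module M N)" for x
      proof -
        from x obtain c where c: "c \<in> carrier M" "x = N +>\<^bsub>M\<^esub> c" by (auto simp: q)
        then have "(N +>\<^bsub>M\<^esub> (\<ominus>\<^bsub>M\<^esub> c)) \<oplus>\<^bsub>quotient_module M N\<^esub> x = \<zero>\<^bsub>quotient_module M N\<^esub>"
          by (simp add: q(2,3) M.l_neg)
        then show ?thesis using c(1) by (auto simp: q(1))
      qed
    qed (auto simp: q M.a_ac)
  qed (auto simp: q M.R.cring_axioms M.smult_l_distr M.smult_r_distr M.smult_assoc1)
qed

lemma lin_map_coset:
  assumes "module R M" "submodule N R M"
  shows "lin_map R M (quotient_module M N) (\<lambda>x. N +>\<^bsub>M\<^esub> x)"
  by (intro lin_mapI) (auto simp: quotient_module_simps[OF assms])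

lemma submodule_span_submodule:
  assumes "module R M" "B \<subseteq> carrier M"
  shows "submodule (submodule_span R M B) R M"
proof -
  interpret M: module R M by fact
  \<comment> \<open>An empty family would have the whole type as its intersection;
    \<open>carrier M\<close> belongs to the family and bounds it.\<close>
  have ne: "carrier M \<in> {N. submodule N R M \<and> B \<subseteq> N}"
    using assms(2) M.carrier_is_submodule by simp
  show ?thesis
  proof (rule M.submoduleI)
    show "submodule_span R M B \<subseteq> carrier M"
      using ne unfolding submodule_span_def by blast
  qed (auto simp: submodule_span_def M.submoduleE submodule_def subgroup.one_closed
      dest: subgroup.one_closed)
qed

lemma submodule_span_superset: "B \<subseteq> submodule_span R M B"
  unfolding submodule_span_def by blast

lemma submodule_span_minimal: "\<lbrakk>submodule N R M; B \<subseteq> N\<rbrakk> \<Longrightarrow> submodule_span R M B \<subseteq> N"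
  unfolding submodule_span_def by blast

text \<open>Together with \<open>submodule_span_minimal\<close> this shows that a linear map killing
  a set of generators kills their span, which is how the tensor relations are dealt with.\<close>

lemma submodule_lin_map_kernel:
  assumes "module R M" "module R N" "lin_map R M N f"
  shows "submodule {x \<in> carrier M. f x = \<zero>\<^bsub>N\<^esub>} R M"
proof -
  interpret M: module R M by fact
  interpret N: module R N by fact
  have neg: "\<ominus>\<^bsub>M\<^esub> x = (\<ominus>\<^bsub>R\<^esub> \<one>\<^bsub>R\<^esub>) \<odot>\<^bsub>M\<^esub> x" if "x \<in> carrier M" for x
    using that by (simp add: M.smult_l_minus)
  show ?thesis
    by (rule M.submoduleI)
      (auto simp: lin_map_zero[OF assms] lin_map_add[OF assms(3)] lin_map_smult[OF assms(3)] neg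
        simp del: M.add.inv_closed)
qed

section \<open>Bilinear maps and free modules\<close>

text \<open>Phrased through \<open>lin_map\<close> in each slot, so that the composition lemmas for
  linear maps apply slot by slot.\<close>

definition bilin_map ::
  "('k, 'r) ring_scheme \<Rightarrow> ('k, 'a, 'm) module_scheme \<Rightarrow> ('k, 'b, 'n) module_scheme \<Rightarrow>
    ('k, 'c, 'p) module_scheme \<Rightarrow> ('a \<Rightarrow> 'b \<Rightarrow> 'c) \<Rightarrow> bool"
  where "bilin_map R M N P f \<longleftrightarrow>
    (\<forall>x\<in>carrier M. lin_map R N P (f x)) \<and> (\<forall>y\<in>carrier N. lin_map R M P (\<lambda>x. f x y))"

lemma bilin_mapI:
  "\<lbrakk>\<And>x. x \<in> carrier M \<Longrightarrow> lin_map R N P (\<lambda>y. f x y);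
    \<And>y. y \<in> carrier N \<Longrightarrow> lin_map R M P (\<lambda>x. f x y)\<rbrakk> \<Longrightarrow> bilin_map R M N P f"
  by (simp add: bilin_map_def)

lemma bilin_map_right: "\<lbrakk>bilin_map R M N P f; x \<in> carrier M\<rbrakk> \<Longrightarrow> lin_map R N P (\<lambda>y. f x y)"
  and bilin_map_left: "\<lbrakk>bilin_map R M N P f; y \<in> carrier N\<rbrakk> \<Longrightarrow> lin_map R M P (\<lambda>x. f x y)"
  by (simp_all add: bilin_map_def)

lemma bilin_map_closed: 
  "\<lbrakk>bilin_map R M N P f; x \<in> carrier M; y \<in> carrier N\<rbrakk> \<Longrightarrow> f x y \<in> carrier P"
  by (rule lin_map_closed[OF bilin_map_right])

section \<open>Free modules and the linear extension of a map from the basis\<close>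

lemma module_free_module: "cring R \<Longrightarrow> module R (free_module R B)"
  unfolding free_module_def by (intro module_direct_sum module_base_module)

lemma free_basis_closed:
  assumes "cring R" "s \<in> B"
  shows "free_basis R B s \<in> carrier (free_module R B)"
proof -
  interpret cring R by fact
  show ?thesis
    unfolding free_basis_def free_module_def
    using assms by (intro lin_map_closed[OF lin_map_inj_sum[of _ R]]) (simp_all add: module_base_module)
qed

text \<open>The sum inside \<open>tensor_lift\<close>, taken at a given formal sum \<open>c\<close>
  in place of a chosen representative.\<close>

definition free_lift ::
  "('k, 'r) ring_scheme \<Rightarrow> 's set \<Rightarrow> ('k, 'c, 'p) module_scheme \<Rightarrow> ('s \<Rightarrow> 'c) \<Rightarrow> ('s \<Rightarrow> 'k) \<Rightarrow> 'c"
  where "free_lift R B P f c = (\<Oplus>\<^bsub>P\<^esub> p \<in> {p \<in> B. c p \<noteq> \<zero>\<^bsub>R\<^esub>}. c p \<odot>\<^bsub>P\<^esub> f p)"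

text \<open>The index set of \<open>free_lift\<close> is the support of \<open>c\<close> and changes
  with \<open>c\<close>. Enlarging it by zero summands allows values at different arguments to be
  compared over a common finite set.\<close>

lemma free_lift_superset:
  assumes "module R P" "f \<in> B \<rightarrow> carrier P" "c \<in> carrier (free_module R B)"
    and "finite F" "F \<subseteq> B" "{p \<in> B. c p \<noteq> \<zero>\<^bsub>R\<^esub>} \<subseteq> F"
  shows "free_lift R B P f c = (\<Oplus>\<^bsub>P\<^esub> p \<in> F. c p \<odot>\<^bsub>P\<^esub> f p)"
proof -
  interpret P: module R P by fact
  have c: "p \<in> B \<Longrightarrow> c p \<in> carrier R" for p
    using assms(3) by (auto simp: free_module_def direct_sum_simps)
  have F: "c p \<in> carrier R" "f p \<in> carrier P" if "p \<in> F" for p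
    using that assms(2,5) c by auto
  show ?thesis
    unfolding free_lift_def
    by (rule P.add.finprod_mono_neutral_cong_left) (use assms(4-6) F in auto)
qed

lemma lin_map_free_lift:
  assumes "module R P" "f \<in> B \<rightarrow> carrier P"
  shows "lin_map R (free_module R B) P (free_lift R B P f)"
proof -
  interpret P: module R P by fact
  let ?F = "free_module R B"
  interpret F: module R ?F by (rule module_free_module) (rule P.R.cring_axioms)
  have c: "\<lbrakk>c \<in> carrier ?F; p \<in> B\<rbrakk> \<Longrightarrow> c p \<in> carrier R" for p c
    by (auto simp: free_module_def direct_sum_simps)
  have fin: "c \<in> carrier ?F \<Longrightarrow> finite {p \<in> B. c p \<noteq> \<zero>\<^bsub>R\<^esub>}" for c
    by (auto simp: free_module_def direct_sum_simps)
  note eq = free_lift_superset[OF assms]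
  have summand: "c \<in> carrier ?F \<Longrightarrow> A \<subseteq> B \<Longrightarrow> (\<lambda>p. c p \<odot>\<^bsub>P\<^esub> f p) \<in> A \<rightarrow> carrier P" for c A
    using c assms(2) by (intro funcsetI P.smult_closed) (blast dest: funcset_mem)+
  show ?thesis
  proof (rule lin_mapI)
    show "free_lift R B P f x \<in> carrier P" if "x \<in> carrier ?F" for x
      unfolding free_lift_def using summand[OF that] by (intro P.finsum_closed) auto
    fix x y assume x: "x \<in> carrier ?F" and y: "y \<in> carrier ?F"
    \<comment> \<open>The union of the two supports contains the support of the sum, which may be
      smaller through cancellation.\<close>
    define A where "A = {p \<in> B. x p \<noteq> \<zero>\<^bsub>R\<^esub>} \<union> {p \<in> B. y p \<noteq> \<zero>\<^bsub>R\<^esub>}"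
    have A: "finite A" "A \<subseteq> B" using fin x y by (auto simp: A_def)
    have xy: "x \<oplus>\<^bsub>?F\<^esub> y = (\<lambda>p\<in>B. x p \<oplus>\<^bsub>R\<^esub> y p)" by (simp add: free_module_def direct_sum_simps)
    have "free_lift R B P f (x \<oplus>\<^bsub>?F\<^esub> y) = (\<Oplus>\<^bsub>P\<^esub> p \<in> A. (x \<oplus>\<^bsub>?F\<^esub> y) p \<odot>\<^bsub>P\<^esub> f p)"
      by (rule eq[OF F.a_closed[OF x y] A]) (auto simp: xy A_def)
    also have "\<dots> = (\<Oplus>\<^bsub>P\<^esub> p \<in> A. x p \<odot>\<^bsub>P\<^esub> f p \<oplus>\<^bsub>P\<^esub> y p \<odot>\<^bsub>P\<^esub> f p)"
      using summand[OF x A(2)] summand[OF y A(2)] x y A(2) c assms(2)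
      by (intro P.finsum_cong') (auto simp: xy P.smult_l_distr subset_iff Pi_def)
    also have "\<dots> = free_lift R B P f x \<oplus>\<^bsub>P\<^esub> free_lift R B P f y"
      using summand[OF x A(2)] summand[OF y A(2)] eq[OF x A] eq[OF y A]
      by (simp add: P.finsum_addf A_def)
    finally show "free_lift R B P f (x \<oplus>\<^bsub>?F\<^esub> y) = free_lift R B P f x \<oplus>\<^bsub>P\<^esub> free_lift R B P f y" .
  next
    fix a x assume a: "a \<in> carrier R" and x: "x \<in> carrier ?F"
    define A where "A = {p \<in> B. x p \<noteq> \<zero>\<^bsub>R\<^esub>}"
    have A: "finite A" "A \<subseteq> B" using fin x by (auto simp: A_def)
    have ax: "a \<odot>\<^bsub>?F\<^esub> x = (\<lambda>p\<in>B. a \<otimes>\<^bsub>R\<^esub> x p)" by (simp add: free_module_def direct_sum_simps)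
    have "free_lift R B P f (a \<odot>\<^bsub>?F\<^esub> x) = (\<Oplus>\<^bsub>P\<^esub> p \<in> A. (a \<odot>\<^bsub>?F\<^esub> x) p \<odot>\<^bsub>P\<^esub> f p)"
      by (rule eq[OF F.smult_closed[OF a x] A]) (use a in \<open>auto simp: ax A_def\<close>)
    also have "\<dots> = (\<Oplus>\<^bsub>P\<^esub> p \<in> A. a \<odot>\<^bsub>P\<^esub> (x p \<odot>\<^bsub>P\<^esub> f p))"
      using summand[OF x A(2)] x a A(2) c assms(2)
      by (intro P.finsum_cong') (auto simp: ax P.smult_assoc1 subset_iff Pi_def)
    also have "\<dots> = a \<odot>\<^bsub>P\<^esub> free_lift R B P f x"
      using summand[OF x A(2)] eq[OF x A] a A(1) by (simp add: P.finsum_smult_ldistr A_def)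
    finally show "free_lift R B P f (a \<odot>\<^bsub>?F\<^esub> x) = a \<odot>\<^bsub>P\<^esub> free_lift R B P f x" .
  qed
qed

lemma free_lift_basis:
  assumes "module R P" "f \<in> B \<rightarrow> carrier P" "s \<in> B"
  shows "free_lift R B P f (free_basis R B s) = f s"
proof -
  interpret P: module R P by fact
  have fs: "f s \<in> carrier P" using assms by auto
  \<comment> \<open>The index set is \<open>{s}\<close> and not the support, which is empty if
    \<open>\<one> = \<zero>\<close> in \<open>R\<close>.\<close>
  have "free_lift R B P f (free_basis R B s) = (\<Oplus>\<^bsub>P\<^esub> p \<in> {s}. free_basis R B s p \<odot>\<^bsub>P\<^esub> f p)"
    using assms by (intro free_lift_superset free_basis_closed P.R.cring_axioms)
      (auto simp: free_basis_def inj_sum_def)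
  also have "\<dots> = \<one>\<^bsub>R\<^esub> \<odot>\<^bsub>P\<^esub> f s"
    using assms fs by (subst P.finsum_insert) (simp_all add: free_basis_def inj_sum_def)
  also have "\<dots> = f s" using fs by simp
  finally show ?thesis .
qed

text \<open>An injected scalar at \<open>s\<close> is a multiple of the basis element at
  \<open>s\<close>. The case \<open>basis\<close> keeps the latter form because its coset is a
  multiple of a pure tensor.\<close>

lemma free_module_induct [consumes 2, case_names zero basis add]:
  assumes "cring R" and f: "f \<in> carrier (free_module R B)"
    and zero: "P \<zero>\<^bsub>free_module R B\<^esub>"
    and basis: "\<And>a s. \<lbrakk>a \<in> carrier R; s \<in> B\<rbrakk> \<Longrightarrow> P (a \<odot>\<^bsub>free_module R B\<^esub> free_basis R B s)"
    and add: "\<And>f g. \<lbrakk>f \<in> carrier (free_module R B); g \<in> carrier (free_module R B); P f; P g\<rbrakk> \<Longrightarrow>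
      P (f \<oplus>\<^bsub>free_module R B\<^esub> g)"
  shows "P f"
proof (rule direct_sum_induct[where R = R and I = B and M = "\<lambda>_. base_module R"])
  interpret cring R by fact
  show "module R (base_module R)" if "i \<in> B" for i by (rule module_base_module) (rule cring_axioms)
  show "f \<in> carrier (direct_sum B (\<lambda>_. base_module R))" using f by (simp add: free_module_def)
  show "P (inj_sum B (\<lambda>_. base_module R) s a)" if "s \<in> B" "a \<in> carrier (base_module R)" for s a
  proof -
    have "a \<odot>\<^bsub>free_module R B\<^esub> free_basis R B s = inj_sum B (\<lambda>_. base_module R) s a"
      using that by (auto simp: free_module_def direct_sum_simps free_basis_def inj_sum_def
          intro!: restrict_ext)
    moreover have "P (a \<odot>\<^bsub>free_module R B\<^esub> free_basis R B s)" using basis that by simp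
    ultimately show ?thesis by simp
  qed
qed (fact zero[unfolded free_module_def] add[unfolded free_module_def])+

section \<open>Tensor products\<close>

lemma coset_eqI:
  assumes "module R M" "submodule N R M" "x \<in> carrier M" "y \<in> carrier M" "x \<ominus>\<^bsub>M\<^esub> y \<in> N"
  shows "N +>\<^bsub>M\<^esub> x = N +>\<^bsub>M\<^esub> y"
proof -
  interpret M: module R M by fact
  interpret N: abelian_subgroup N M by (rule abelian_subgroup_submodule) fact+
  have "x = (x \<ominus>\<^bsub>M\<^esub> y) \<oplus>\<^bsub>M\<^esub> y"
    using assms(3,4) by (simp add: M.minus_eq M.a_assoc M.l_neg)
  then have "x \<in> N +>\<^bsub>M\<^esub> y" using assms(5) unfolding a_r_coset_def' by blast
  then show ?thesis using assms(4) by (metis N.a_repr_independence')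
qed

lemma tensor_relationsI:
  shows "\<lbrakk>x \<in> carrier M; x' \<in> carrier M; y \<in> carrier N\<rbrakk> \<Longrightarrow>
      free_basis R (carrier M \<times> carrier N) (x \<oplus>\<^bsub>M\<^esub> x', y)
        \<ominus>\<^bsub>free_module R (carrier M \<times> carrier N)\<^esub> (free_basis R (carrier M \<times> carrier N) (x, y)
          \<oplus>\<^bsub>free_module R (carrier M \<times> carrier N)\<^esub> free_basis R (carrier M \<times> carrier N) (x', y))
      \<in> tensor_relations R M N"
    and "\<lbrakk>x \<in> carrier M; y \<in> carrier N; y' \<in> carrier N\<rbrakk> \<Longrightarrow>
      free_basis R (carrier M \<times> carrier N) (x, y \<oplus>\<^bsub>N\<^esub> y')
        \<ominus>\<^bsub>free_module R (carrier M \<times> carrier N)\<^esub> (free_basis R (carrier M \<times> carrier N) (x, y)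
          \<oplus>\<^bsub>free_module R (carrier M \<times> carrier N)\<^esub> free_basis R (carrier M \<times> carrier N) (x, y'))
      \<in> tensor_relations R M N"
    and "\<lbrakk>a \<in> carrier R; x \<in> carrier M; y \<in> carrier N\<rbrakk> \<Longrightarrow>
      free_basis R (carrier M \<times> carrier N) (a \<odot>\<^bsub>M\<^esub> x, y)
        \<ominus>\<^bsub>free_module R (carrier M \<times> carrier N)\<^esub> a \<odot>\<^bsub>free_module R (carrier M \<times> carrier N)\<^esub>
          free_basis R (carrier M \<times> carrier N) (x, y) \<in> tensor_relations R M N"
    and "\<lbrakk>a \<in> carrier R; x \<in> carrier M; y \<in> carrier N\<rbrakk> \<Longrightarrow>
      free_basis R (carrier M \<times> carrier N) (x, a \<odot>\<^bsub>N\<^esub> y)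
        \<ominus>\<^bsub>free_module R (carrier M \<times> carrier N)\<^esub> a \<odot>\<^bsub>free_module R (carrier M \<times> carrier N)\<^esub>
          free_basis R (carrier M \<times> carrier N) (x, y) \<in> tensor_relations R M N"
  unfolding tensor_relations_def Let_def by blast+

lemma tensor_null_submodule:
  assumes "module R M" "module R N"
  shows "submodule (tensor_null R M N) R (free_module R (carrier M \<times> carrier N))"
proof -
  interpret M: module R M by fact
  interpret N: module R N by fact
  let ?B = "carrier M \<times> carrier N"
  interpret F: module R "free_module R ?B" by (rule module_free_module) (rule M.R.cring_axioms)
  note [simp] = free_basis_closed[OF M.R.cring_axioms]
  have "tensor_relations R M N \<subseteq> carrier (free_module R ?B)"
    by (auto simp: tensor_relations_def Let_def)
  then show ?thesis
    unfolding tensor_null_def using submodule_span_submodule[OF F.module_axioms] by simp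
qed

lemma module_tensor:
  assumes "module R M" "module R N"
  shows "module R (tensor R M N)"
  unfolding tensor_def
  using assms by (intro module_quotient_module module_free_module tensor_null_submodule)
    (simp add: module_def)

text \<open>Each law of bilinearity corresponds to one family of generators of
  \<open>tensor_null\<close>: the two sides have representatives that differ by such a
  generator.\<close>

lemma bilin_map_pure:
  assumes "module R M" "module R N"
  shows "bilin_map R M N (tensor R M N) (pure R M N)"
proof -
  interpret M: module R M by fact
  interpret N: module R N by fact
  let ?B = "carrier M \<times> carrier N"
  interpret F: module R "free_module R ?B" by (rule module_free_module) (rule M.R.cring_axioms)
  note sub = tensor_null_submodule[OF assms]
  note q = quotient_module_simps[OF F.module_axioms sub]
  have [simp]: "free_basis R ?B p \<in> carrier (free_module R ?B)" if "p \<in> ?B" for p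
    using that by (rule free_basis_closed[OF M.R.cring_axioms])
  have rel: "x \<in> tensor_relations R M N \<Longrightarrow> x \<in> tensor_null R M N" for x
    unfolding tensor_null_def by (rule subsetD[OF submodule_span_superset])
  let ?Q = "quotient_module (free_module R ?B) (tensor_null R M N)"
  let ?p = "\<lambda>x y. tensor_null R M N +>\<^bsub>free_module R ?B\<^esub> free_basis R ?B (x, y)"
  note eqI = coset_eqI[OF F.module_axioms sub _ _ rel]
  have "?p x y \<in> carrier ?Q" if "x \<in> carrier M" "y \<in> carrier N" for x y
    using that unfolding q(1) by (intro imageI) simp
  moreover have "?p (x \<oplus>\<^bsub>M\<^esub> x') y = ?p x y \<oplus>\<^bsub>?Q\<^esub> ?p x' y"
    if "x \<in> carrier M" "x' \<in> carrier M" "y \<in> carrier N" for x x' y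
    using that eqI[OF _ _ tensor_relationsI(1)[OF that]] by (simp add: q(3))
  moreover have "?p x (y \<oplus>\<^bsub>N\<^esub> y') = ?p x y \<oplus>\<^bsub>?Q\<^esub> ?p x y'"
    if "x \<in> carrier M" "y \<in> carrier N" "y' \<in> carrier N" for x y y'
    using that eqI[OF _ _ tensor_relationsI(2)[OF that]] by (simp add: q(3))
  moreover have "?p (a \<odot>\<^bsub>M\<^esub> x) y = a \<odot>\<^bsub>?Q\<^esub> ?p x y"
    if "a \<in> carrier R" "x \<in> carrier M" "y \<in> carrier N" for a x y
    using that eqI[OF _ _ tensor_relationsI(3)[OF that]] by (simp add: q(4))
  moreover have "?p x (a \<odot>\<^bsub>N\<^esub> y) = a \<odot>\<^bsub>?Q\<^esub> ?p x y"
    if "a \<in> carrier R" "x \<in> carrier M" "y \<in> carrier N" for a x y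
    using that eqI[OF _ _ tensor_relationsI(4)[OF that]] by (simp add: q(4))
  ultimately show ?thesis
    unfolding tensor_def pure_def by (intro bilin_mapI lin_mapI)
qed

lemma pure_closed:
  "\<lbrakk>module R M; module R N; x \<in> carrier M; y \<in> carrier N\<rbrakk> \<Longrightarrow> pure R M N x y \<in> carrier (tensor R M N)"
  by (rule bilin_map_closed[OF bilin_map_pure])

text \<open>Sums of pure tensors exhaust the tensor product, since a scalar can be absorbed into the
  first factor. Zero is covered in the same way, so the cases \<open>pure\<close> and
  \<open>add\<close> suffice.\<close>

lemma tensor_induct [consumes 3, case_names pure add]:
  assumes MN: "module R M" "module R N" and t: "t \<in> carrier (tensor R M N)"
    and pure: "\<And>x y. \<lbrakk>x \<in> carrier M; y \<in> carrier N\<rbrakk> \<Longrightarrow> P (pure R M N x y)"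
    and add: "\<And>s t. \<lbrakk>s \<in> carrier (tensor R M N); t \<in> carrier (tensor R M N); P s; P t\<rbrakk> \<Longrightarrow>
      P (s \<oplus>\<^bsub>tensor R M N\<^esub> t)"
  shows "P t"
proof -
  interpret M: module R M by fact
  interpret N: module R N by fact
  let ?B = "carrier M \<times> carrier N"
  let ?c = "\<lambda>c. tensor_null R M N +>\<^bsub>free_module R ?B\<^esub> c"
  interpret F: module R "free_module R ?B" by (rule module_free_module) (rule M.R.cring_axioms)
  note sub = tensor_null_submodule[OF MN]
  have lin: "lin_map R (free_module R ?B) (tensor R M N) ?c"
    unfolding tensor_def by (rule lin_map_coset[OF F.module_axioms sub])
  have P_smult: "P (?c (a \<odot>\<^bsub>free_module R ?B\<^esub> free_basis R ?B s))"
    if "a \<in> carrier R" "s \<in> ?B" for a s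
  proof -
    have "?c (a \<odot>\<^bsub>free_module R ?B\<^esub> free_basis R ?B s) = a \<odot>\<^bsub>tensor R M N\<^esub> pure R M N (fst s) (snd s)"
      using lin_map_smult[OF lin that(1) free_basis_closed[OF M.R.cring_axioms that(2)]]
      by (simp add: pure_def)
    also have "\<dots> = pure R M N (a \<odot>\<^bsub>M\<^esub> fst s) (snd s)"
      using lin_map_smult[OF bilin_map_left[OF bilin_map_pure[OF MN]]] that by auto
    finally show ?thesis using pure that by auto
  qed
  have "P (?c c)" if "c \<in> carrier (free_module R ?B)" for c
    using M.R.cring_axioms that
  proof (induct c rule: free_module_induct)
    case zero
    \<comment> \<open>Zero is presented as zero times a basis element, which brings it under
      \<open>P_smult\<close>.\<close>
    have "\<zero>\<^bsub>R\<^esub> \<odot>\<^bsub>free_module R ?B\<^esub> free_basis R ?B (\<zero>\<^bsub>M\<^esub>, \<zero>\<^bsub>N\<^esub>) = \<zero>\<^bsub>free_module R ?B\<^esub>"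
      by (intro F.smult_l_null free_basis_closed[OF M.R.cring_axioms]) simp
    then show ?case using P_smult[of "\<zero>\<^bsub>R\<^esub>" "(\<zero>\<^bsub>M\<^esub>, \<zero>\<^bsub>N\<^esub>)"] by simp
  next
    case (basis a s)
    then show ?case by (rule P_smult)
  next
    case (add f g)
    then show ?case
      using assms(5)[OF lin_map_closed[OF lin] lin_map_closed[OF lin]] lin_map_add[OF lin] by simp
  qed
  then show ?thesis
    using t quotient_module_simps(1)[OF F.module_axioms sub] unfolding tensor_def by auto
qed

section \<open>The universal property of the tensor product\<close>

text \<open>This frees the lift from the choice of a representative. The linear extension of
  \<open>f\<close> to the free module kills every tensor relation because \<open>f\<close> is
  bilinear; hence it kills the submodule they span and is constant on cosets.\<close>

lemma tensor_lift_coset: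
  assumes MN: "module R M" "module R N" and P: "module R P" and f: "bilin_map R M N P f"
    and c: "c \<in> carrier (free_module R (carrier M \<times> carrier N))"
  shows "tensor_lift R M N P f (tensor_null R M N +>\<^bsub>free_module R (carrier M \<times> carrier N)\<^esub> c)
    = free_lift R (carrier M \<times> carrier N) P (\<lambda>p. f (fst p) (snd p)) c"
proof -
  interpret M: module R M by fact
  interpret N: module R N by fact
  interpret P: module R P by fact
  let ?B = "carrier M \<times> carrier N"
  let ?F = "free_module R ?B"
  let ?L = "free_lift R ?B P (\<lambda>p. f (fst p) (snd p))"
  interpret F: module R ?F by (rule module_free_module) (rule M.R.cring_axioms)
  interpret N: abelian_subgroup "tensor_null R M N" ?F
    by (rule abelian_subgroup_submodule[OF F.module_axioms tensor_null_submodule[OF MN]])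
  have pf: "(\<lambda>p. f (fst p) (snd p)) \<in> ?B \<rightarrow> carrier P"
    using bilin_map_closed[OF f] by auto
  note lin = lin_map_free_lift[OF P pf]
  note lmr = lin_map_minus[OF F.module_axioms P lin] lin_map_add[OF lin] lin_map_smult[OF lin]
    free_lift_basis[OF P pf]
  note lf = lin_map_add[OF bilin_map_left[OF f]] lin_map_add[OF bilin_map_right[OF f]]
    lin_map_smult[OF bilin_map_left[OF f]] lin_map_smult[OF bilin_map_right[OF f]]
  note [simp] = free_basis_closed[OF M.R.cring_axioms] bilin_map_closed[OF f]
  have "tensor_relations R M N \<subseteq> {c \<in> carrier ?F. ?L c = \<zero>\<^bsub>P\<^esub>}"
    by (auto simp: tensor_relations_def Let_def lmr lf P.minus_eq P.r_neg)
  then have null: "tensor_null R M N \<subseteq> {c \<in> carrier ?F. ?L c = \<zero>\<^bsub>P\<^esub>}"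
    unfolding tensor_null_def
    by (intro submodule_span_minimal submodule_lin_map_kernel F.module_axioms P lin)
  \<comment> \<open>The representative picked by \<open>tensor_lift\<close>; it differs from
    \<open>c\<close> by an element of \<open>tensor_null\<close>, on which the linear extension
    vanishes.\<close>
  define c' where "c' = (SOME c'. c' \<in> tensor_null R M N +>\<^bsub>?F\<^esub> c)"
  have "c' \<in> tensor_null R M N +>\<^bsub>?F\<^esub> c"
    unfolding c'_def using N.a_rcos_self[OF c]
    by (rule someI[of "\<lambda>c'. c' \<in> tensor_null R M N +>\<^bsub>?F\<^esub> c"])
  then obtain n where n: "n \<in> tensor_null R M N" "c' = n \<oplus>\<^bsub>?F\<^esub> c" by (auto simp: a_r_coset_def')
  have "?L c' = ?L c"
    using n null c lin_map_closed[OF lin c] by (auto simp: lin_map_add[OF lin])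
  then show ?thesis by (simp add: tensor_lift_def free_lift_def c'_def)
qed

lemma lin_map_tensor_lift:
  assumes MN: "module R M" "module R N" and P: "module R P" and f: "bilin_map R M N P f"
  shows "lin_map R (tensor R M N) P (tensor_lift R M N P f)"
proof -
  interpret M: module R M by fact
  let ?B = "carrier M \<times> carrier N"
  interpret F: module R "free_module R ?B" by (rule module_free_module) (rule M.R.cring_axioms)
  note q = quotient_module_simps[OF F.module_axioms tensor_null_submodule[OF MN]]
  have pf: "(\<lambda>p. f (fst p) (snd p)) \<in> ?B \<rightarrow> carrier P"
    using bilin_map_closed[OF f] by auto
  note lin = lin_map_free_lift[OF P pf]
  show ?thesis
    unfolding tensor_def
    by (rule lin_mapI)
      (auto simp: q tensor_lift_coset[OF assms] lin_map_add[OF lin] lin_map_smult[OF lin] lin_map_closed[OF lin])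
qed

lemma tensor_lift_pure:
  assumes MN: "module R M" "module R N" and P: "module R P" and f: "bilin_map R M N P f"
    and "x \<in> carrier M" "y \<in> carrier N"
  shows "tensor_lift R M N P f (pure R M N x y) = f x y"
proof -
  interpret M: module R M by fact
  have pf: "(\<lambda>p. f (fst p) (snd p)) \<in> carrier M \<times> carrier N \<rightarrow> carrier P"
    using bilin_map_closed[OF f] by auto
  show ?thesis
    unfolding pure_def using assms(5,6)
    by (subst tensor_lift_coset[OF assms(1-4)])
      (simp_all add: free_basis_closed[OF M.R.cring_axioms] free_lift_basis[OF P pf])
qed

text \<open>Pure tensors generate additively. This is the uniqueness half of the universal property,
  from which most identities between lifts are derived.\<close>

lemma lin_map_tensor_eqI:
  assumes MN: "module R M" "module R N"
    and "lin_map R (tensor R M N) P f" "lin_map R (tensor R M N) P g"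
    and "\<And>x y. \<lbrakk>x \<in> carrier M; y \<in> carrier N\<rbrakk> \<Longrightarrow> f (pure R M N x y) = g (pure R M N x y)"
    and "t \<in> carrier (tensor R M N)"
  shows "f t = g t"
  using MN assms(6)
  by (induct t rule: tensor_induct) (simp_all add: assms(5) lin_map_add[OF assms(3)] lin_map_add[OF assms(4)])

section \<open>Linearity of expressions built from pure tensors and lifts\<close>

lemma lin_map_pure_left:
  "\<lbrakk>module R M; module R N; lin_map R L M g; y \<in> carrier N\<rbrakk> \<Longrightarrow>
    lin_map R L (tensor R M N) (\<lambda>v. pure R M N (g v) y)"
  by (rule lin_map_comp[OF bilin_map_left[OF bilin_map_pure]])

lemma lin_map_pure_right:
  "\<lbrakk>module R M; module R N; lin_map R L N g; x \<in> carrier M\<rbrakk> \<Longrightarrow>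
    lin_map R L (tensor R M N) (\<lambda>v. pure R M N x (g v))"
  by (rule lin_map_comp[OF bilin_map_right[OF bilin_map_pure]])

lemma lin_map_tensor_lift_arg:
  "\<lbrakk>module R M; module R N; module R P; lin_map R L (tensor R M N) g; bilin_map R M N P f\<rbrakk> \<Longrightarrow>
    lin_map R L P (\<lambda>v. tensor_lift R M N P f (g v))"
  by (rule lin_map_comp[OF lin_map_tensor_lift])

text \<open>In a nested lift the outer variables are parameters of the inner bilinear map, so
  linearity in such a parameter \<open>v\<close> at a fixed tensor is needed as well. Induction on
  the tensor reduces it to pure tensors, where the lift has the value
  \<open>f v x y\<close>.\<close>

lemma lin_map_tensor_lift_fun:
  assumes mods: "module R M" "module R N" "module R P" "module R L"
    and t: "t \<in> carrier (tensor R M N)"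
    and f: "\<And>v. v \<in> carrier L \<Longrightarrow> bilin_map R M N P (f v)"
    and lin: "\<And>x y. \<lbrakk>x \<in> carrier M; y \<in> carrier N\<rbrakk> \<Longrightarrow> lin_map R L P (\<lambda>v. f v x y)"
  shows "lin_map R L P (\<lambda>v. tensor_lift R M N P (f v) t)"
proof -
  interpret P: module R P by fact
  interpret L: module R L by fact
  let ?T = "tensor R M N"
  note lift = lin_map_tensor_lift[OF mods(1-3) f]
  show ?thesis
  proof (rule lin_mapI)
    fix v w assume v: "v \<in> carrier L" and w: "w \<in> carrier L"
    have vw: "v \<oplus>\<^bsub>L\<^esub> w \<in> carrier L" using v w by simp
    have "tensor_lift R M N P (f (v \<oplus>\<^bsub>L\<^esub> w)) s = tensor_lift R M N P (f v) s \<oplus>\<^bsub>P\<^esub> tensor_lift R M N P (f w) s"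
      if "s \<in> carrier ?T" for s
      using mods(1,2) that
    proof (induct s rule: tensor_induct)
      case (pure x y)
      then show ?case
        by (simp add: tensor_lift_pure[OF mods(1-3) f] v w lin_map_add[OF lin])
    next
      case (add s t)
      then show ?case
        using lin_map_closed[OF lift[OF v]] lin_map_closed[OF lift[OF w]]
        by (simp add: lin_map_add[OF lift] v w P.a_ac)
    qed
    then show "tensor_lift R M N P (f (v \<oplus>\<^bsub>L\<^esub> w)) t = tensor_lift R M N P (f v) t \<oplus>\<^bsub>P\<^esub> tensor_lift R M N P (f w) t"
      using t .
  next
    fix a v assume a: "a \<in> carrier R" and v: "v \<in> carrier L"
    have "tensor_lift R M N P (f (a \<odot>\<^bsub>L\<^esub> v)) s = a \<odot>\<^bsub>P\<^esub> tensor_lift R M N P (f v) s"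
      if "s \<in> carrier ?T" for s
      using mods(1,2) that
    proof (induct s rule: tensor_induct)
      case (pure x y)
      then show ?case
        by (simp add: tensor_lift_pure[OF mods(1-3) f] a v lin_map_smult[OF lin])
    next
      case (add s t)
      then show ?case
        using lin_map_closed[OF lift[OF v]]
        by (simp add: lin_map_add[OF lift] a v P.smult_r_distr)
    qed
    then show "tensor_lift R M N P (f (a \<odot>\<^bsub>L\<^esub> v)) t = a \<odot>\<^bsub>P\<^esub> tensor_lift R M N P (f v) t"
      using t .
  qed (use lin_map_closed[OF lift] t in auto)
qed

lemma bilin_map_cong:
  assumes "module R M" "module R N"
    and "\<And>x y. \<lbrakk>x \<in> carrier M; y \<in> carrier N\<rbrakk> \<Longrightarrow> f x y = g x y"
  shows "bilin_map R M N P f \<longleftrightarrow> bilin_map R M N P g"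
  unfolding bilin_map_def
  using assms by (intro conj_cong ball_cong refl lin_map_cong) auto

text \<open>This is rewriting under Sweedler notation. The two functions are compared on the
  carriers only, and \<open>g\<close> inherits bilinearity from \<open>f\<close>.\<close>

lemma tensor_lift_cong:
  assumes "module R M" "module R N" "module R P" "bilin_map R M N P f" "t \<in> carrier (tensor R M N)"
    and eq: "\<And>x y. \<lbrakk>x \<in> carrier M; y \<in> carrier N\<rbrakk> \<Longrightarrow> f x y = g x y"
  shows "tensor_lift R M N P f t = tensor_lift R M N P g t"
proof -
  have g: "bilin_map R M N P g" 
    by (rule iffD1[OF bilin_map_cong assms(4)]) (use assms in auto)
  show ?thesis
    using assms(1,2) lin_map_tensor_lift[OF assms(1-4)] lin_map_tensor_lift[OF assms(1-3) g] _ assms(5)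
    by (rule lin_map_tensor_eqI) (simp add: tensor_lift_pure assms g)
qed

lemma bilin_map_comp_lin:
  "\<lbrakk>lin_map R P Q g; bilin_map R M N P f\<rbrakk> \<Longrightarrow> bilin_map R M N Q (\<lambda>x y. g (f x y))"
  by (rule bilin_mapI; rule lin_map_comp[of R P Q g]) (simp_all add: bilin_map_left bilin_map_right)

text \<open>Both sides are linear in \<open>t\<close> and agree on pure tensors. In Sweedler terms,
  a linear map may be moved in and out of \<open>f(t\<^sub>1, t\<^sub>2)\<close>.\<close>

lemma lin_map_tensor_lift_apply:
  assumes "module R M" "module R N" "module R P" "module R Q" "lin_map R P Q g" "bilin_map R M N P f"
    and "t \<in> carrier (tensor R M N)"
  shows "g (tensor_lift R M N P f t) = tensor_lift R M N Q (\<lambda>x y. g (f x y)) t"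
  using assms(1,2) lin_map_comp[OF assms(5) lin_map_tensor_lift[OF assms(1-3,6)]]
    lin_map_tensor_lift[OF assms(1,2,4) bilin_map_comp_lin[OF assms(5,6)]] _ assms(7)
  by (rule lin_map_tensor_eqI) (simp add: tensor_lift_pure assms bilin_map_comp_lin[OF assms(5,6)])

lemma bilin_map_pure_comp:
  assumes "module R M" "module R N" "module R P" "module R Q" "lin_map R M P f" "lin_map R N Q g"
  shows "bilin_map R M N (tensor R P Q) (\<lambda>x y. pure R P Q (f x) (g y))"
  using assms
  by (intro bilin_mapI lin_map_pure_left lin_map_pure_right) (auto intro: lin_map_closed)

lemma lin_map_tensor_map:
  assumes "module R M" "module R N" "module R P" "module R Q" "lin_map R M P f" "lin_map R N Q g"
  shows "lin_map R (tensor R M N) (tensor R P Q) (tensor_map R M N P Q f g)"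
  unfolding tensor_map_def
  using assms by (intro lin_map_tensor_lift bilin_map_pure_comp module_tensor)

lemma lin_map_tensor_map_arg:
  assumes "module R M" "module R N" "module R P" "module R Q" "lin_map R L (tensor R M N) h"
    "lin_map R M P f" "lin_map R N Q g"
  shows "lin_map R L (tensor R P Q) (\<lambda>v. tensor_map R M N P Q f g (h v))"
  by (rule lin_map_comp[OF lin_map_tensor_map]) fact+

lemma tensor_map_closed:
  assumes "module R M" "module R N" "module R P" "module R Q" "lin_map R M P f" "lin_map R N Q g"
    and "t \<in> carrier (tensor R M N)"
  shows "tensor_map R M N P Q f g t \<in> carrier (tensor R P Q)"
  using lin_map_tensor_map[OF assms(1-6)] assms(7) by (rule lin_map_closed)

lemma tensor_map_pure:
  assumes "module R M" "module R N" "module R P" "module R Q" "lin_map R M P f" "lin_map R N Q g"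
    and "x \<in> carrier M" "y \<in> carrier N"
  shows "tensor_map R M N P Q f g (pure R M N x y) = pure R P Q (f x) (g y)"
  unfolding tensor_map_def
  using assms by (intro tensor_lift_pure bilin_map_pure_comp module_tensor)

lemma bilin_map_comp2:
  assumes "lin_map R M P f" "lin_map R N Q g" "bilin_map R P Q W h"
  shows "bilin_map R M N W (\<lambda>x y. h (f x) (g y))"
  using assms
  by (intro bilin_mapI lin_map_comp[where f = f and g = "\<lambda>x. h x _"] lin_map_comp[where f = g and g = "h _"])
    (auto intro: bilin_map_left bilin_map_right lin_map_closed)

text \<open>A change of variables: the legs of the image of \<open>t\<close> are the images of the
  legs of \<open>t\<close>. With the injections for \<open>f\<close> and \<open>g\<close>, it
  replaces the comultiplication of \<open>H\<close> by that of a component.\<close>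

lemma tensor_lift_tensor_map:
  assumes "module R M" "module R N" "module R P" "module R Q" "module R W"
    and "lin_map R M P f" "lin_map R N Q g" "bilin_map R P Q W h" "t \<in> carrier (tensor R M N)"
  shows "tensor_lift R P Q W h (tensor_map R M N P Q f g t) = tensor_lift R M N W (\<lambda>x y. h (f x) (g y)) t"
proof -
  note b = bilin_map_comp2[OF assms(6-8)]
  show ?thesis
    using assms(1,2) lin_map_comp[OF lin_map_tensor_lift[OF assms(3-5,8)] lin_map_tensor_map[OF assms(1-4,6,7)]]
      lin_map_tensor_lift[OF assms(1,2,5) b] _ assms(9)
    by (rule lin_map_tensor_eqI)
      (simp add: tensor_map_pure[OF assms(1-4,6,7)] tensor_lift_pure[OF assms(3-5,8)]
        tensor_lift_pure[OF assms(1,2,5) b] lin_map_closed[OF assms(6)] lin_map_closed[OF assms(7)])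
qed

lemma tensor_map_tensor_map:
  assumes "module R M" "module R N" "module R P" "module R Q" "module R U" "module R V"
    and "lin_map R M P f" "lin_map R N Q g" "lin_map R P U f'" "lin_map R Q V g'"
    and "t \<in> carrier (tensor R M N)"
  shows "tensor_map R P Q U V f' g' (tensor_map R M N P Q f g t) =
    tensor_map R M N U V (\<lambda>x. f' (f x)) (\<lambda>y. g' (g y)) t"
  unfolding tensor_map_def[of _ P Q] tensor_map_def[of _ M N U V]
  using assms by (intro tensor_lift_tensor_map module_tensor bilin_map_pure_comp)

lemma tensor_map_cong:
  assumes "module R M" "module R N" "module R P" "module R Q" "lin_map R M P f" "lin_map R N Q g"
    and "t \<in> carrier (tensor R M N)"
    and "\<And>x. x \<in> carrier M \<Longrightarrow> f x = f' x" "\<And>y. y \<in> carrier N \<Longrightarrow> g y = g' y"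
  shows "tensor_map R M N P Q f g t = tensor_map R M N P Q f' g' t"
  unfolding tensor_map_def
  using assms by (intro tensor_lift_cong module_tensor bilin_map_pure_comp) simp_all

lemma tensor_lift_zero:
  assumes "module R M" "module R N" "module R P" "t \<in> carrier (tensor R M N)"
  shows "tensor_lift R M N P (\<lambda>x y. \<zero>\<^bsub>P\<^esub>) t = \<zero>\<^bsub>P\<^esub>"
proof -
  have b: "bilin_map R M N P (\<lambda>x y. \<zero>\<^bsub>P\<^esub>)"
    by (intro bilin_mapI lin_map_const_zero assms)
  show ?thesis
    using assms(1,2) lin_map_tensor_lift[OF assms(1-3) b] lin_map_const_zero[OF assms(3)] _ assms(4)
    by (rule lin_map_tensor_eqI) (simp add: tensor_lift_pure[OF assms(1-3) b])
qed

lemma bilin_map_tensor_lift: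
  assumes "module R L" "module R M" "module R N" "module R P"
    and "\<And>x. x \<in> carrier L \<Longrightarrow> bilin_map R M N P (f x)"
    and "\<And>y z. \<lbrakk>y \<in> carrier M; z \<in> carrier N\<rbrakk> \<Longrightarrow> lin_map R L P (\<lambda>x. f x y z)"
  shows "bilin_map R L (tensor R M N) P (\<lambda>x. tensor_lift R M N P (f x))"
  using assms by - (rule bilin_mapI; intro lin_map_tensor_lift lin_map_tensor_lift_fun; simp)

text \<open>A map of four arguments, bilinear in the first pair and in the second pair, descends to
  a bilinear map on two tensor products. The product of a tensor algebra and the comultiplication of
  a tensor product of coalgebras both arise in this way.\<close>

lemma bilin_map_tensor_lift2:
  assumes mods: "module R M" "module R N" "module R M'" "module R N'" "module R P"
    and right: "\<And>x y. \<lbrakk>x \<in> carrier M; y \<in> carrier N\<rbrakk> \<Longrightarrow> bilin_map R M' N' P (f x y)"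
    and left: "\<And>x' y'. \<lbrakk>x' \<in> carrier M'; y' \<in> carrier N'\<rbrakk> \<Longrightarrow> bilin_map R M N P (\<lambda>x y. f x y x' y')"
  shows "bilin_map R (tensor R M N) (tensor R M' N') P
    (\<lambda>s t. tensor_lift R M N P (\<lambda>x y. tensor_lift R M' N' P (f x y) t) s)"
    and "t \<in> carrier (tensor R M' N') \<Longrightarrow> bilin_map R M N P (\<lambda>x y. tensor_lift R M' N' P (f x y) t)"
proof -
  have b: "bilin_map R M N P (\<lambda>x y. tensor_lift R M' N' P (f x y) t)"
    if t: "t \<in> carrier (tensor R M' N')" for t
  proof (rule bilin_mapI)
    show "lin_map R N P (\<lambda>y. tensor_lift R M' N' P (f x y) t)" if "x \<in> carrier M" for x
      using mods right left that t by (intro lin_map_tensor_lift_fun) (auto intro: bilin_map_right[OF left])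
    show "lin_map R M P (\<lambda>x. tensor_lift R M' N' P (f x y) t)" if "y \<in> carrier N" for y
      using mods right that t
      by (intro lin_map_tensor_lift_fun) (auto intro: bilin_map_left[OF left])
  qed
  then show "t \<in> carrier (tensor R M' N') \<Longrightarrow> bilin_map R M N P (\<lambda>x y. tensor_lift R M' N' P (f x y) t)" .
  show "bilin_map R (tensor R M N) (tensor R M' N') P
    (\<lambda>s t. tensor_lift R M N P (\<lambda>x y. tensor_lift R M' N' P (f x y) t) s)"
  proof (rule bilin_mapI)
    show "lin_map R (tensor R M' N') P (\<lambda>t. tensor_lift R M N P (\<lambda>x y. tensor_lift R M' N' P (f x y) t) s)"
      if "s \<in> carrier (tensor R M N)" for s
      using mods right that by (intro lin_map_tensor_lift_fun lin_map_tensor_lift b module_tensor) simp_all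
    show "lin_map R (tensor R M N) P (\<lambda>s. tensor_lift R M N P (\<lambda>x y. tensor_lift R M' N' P (f x y) t) s)"
      if "t \<in> carrier (tensor R M' N')" for t
      using mods that by (intro lin_map_tensor_lift b)
  qed
qed

section \<open>The associativity isomorphism and its naturality\<close>

lemma bilin_map_tensor_assoc_inner:
  assumes "module R L" "module R M" "module R N" "x \<in> carrier L"
  shows "bilin_map R M N (tensor R (tensor R L M) N) (\<lambda>y z. pure R (tensor R L M) N (pure R L M x y) z)"
  using assms by (intro bilin_map_pure_comp lin_map_pure_right lin_map_id module_tensor)

lemma bilin_map_tensor_assoc:
  assumes "module R L" "module R M" "module R N"
  shows "bilin_map R L (tensor R M N) (tensor R (tensor R L M) N)
    (\<lambda>x. tensor_lift R M N (tensor R (tensor R L M) N) (\<lambda>y z. pure R (tensor R L M) N (pure R L M x y) z))"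
  using assms
  by (intro bilin_map_tensor_lift bilin_map_tensor_assoc_inner lin_map_pure_left lin_map_id module_tensor)

lemma lin_map_tensor_assoc:
  assumes "module R L" "module R M" "module R N"
  shows "lin_map R (tensor R L (tensor R M N)) (tensor R (tensor R L M) N) (tensor_assoc R L M N)"
  unfolding tensor_assoc_def Let_def
  using assms by (intro lin_map_tensor_lift bilin_map_tensor_assoc module_tensor)

lemma tensor_assoc_pure:
  assumes "module R L" "module R M" "module R N" "x \<in> carrier L" "y \<in> carrier M" "z \<in> carrier N"
  shows "tensor_assoc R L M N (pure R L (tensor R M N) x (pure R M N y z)) =
    pure R (tensor R L M) N (pure R L M x y) z"
  unfolding tensor_assoc_def Let_def
  using assms
  by (simp add: tensor_lift_pure bilin_map_tensor_assoc bilin_map_tensor_assoc_inner module_tensor pure_closed)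

text \<open>Uniqueness is applied twice: to the outer tensor product, and then, with
  \<open>x\<close> fixed, to the inner one. Naturality is what carries coassociativity from a
  component to the direct sum.\<close>

lemma tensor_assoc_natural:
  assumes mods: "module R L" "module R M" "module R N" "module R L'" "module R M'" "module R N'"
    and f: "lin_map R L L' f" and g: "lin_map R M M' g" and h: "lin_map R N N' h"
    and t: "t \<in> carrier (tensor R L (tensor R M N))"
  shows "tensor_assoc R L' M' N'
      (tensor_map R L (tensor R M N) L' (tensor R M' N') f (tensor_map R M N M' N' g h) t) =
    tensor_map R (tensor R L M) N (tensor R L' M') N' (tensor_map R L M L' M' f g) h (tensor_assoc R L M N t)"
proof -
  note gh = lin_map_tensor_map[OF mods(2,3,5,6) g h]
  note fg = lin_map_tensor_map[OF mods(1,2,4,5) f g]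
  note MN = module_tensor[OF mods(2,3)] and MN' = module_tensor[OF mods(5,6)]
  note LM = module_tensor[OF mods(1,2)] and LM' = module_tensor[OF mods(4,5)]
  note lhs = lin_map_comp[OF lin_map_tensor_assoc[OF mods(4-6)] lin_map_tensor_map[OF mods(1) MN mods(4) MN' f gh]]
  note rhs = lin_map_comp[OF lin_map_tensor_map[OF LM mods(3) LM' mods(6) fg h] lin_map_tensor_assoc[OF mods(1-3)]]
  show ?thesis
    using mods(1) MN lhs rhs _ t
  proof (rule lin_map_tensor_eqI)
    fix x s assume x: "x \<in> carrier L" and s: "s \<in> carrier (tensor R M N)"
    note px = lin_map_pure_right[OF mods(1) MN lin_map_id x]
    show "tensor_assoc R L' M' N' (tensor_map R L (tensor R M N) L' (tensor R M' N') f (tensor_map R M N M' N' g h)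
        (pure R L (tensor R M N) x s)) =
      tensor_map R (tensor R L M) N (tensor R L' M') N' (tensor_map R L M L' M' f g) h
        (tensor_assoc R L M N (pure R L (tensor R M N) x s))"
      using mods(2,3) lin_map_comp[OF lhs px] lin_map_comp[OF rhs px] _ s
    proof (rule lin_map_tensor_eqI)
      fix y z assume "y \<in> carrier M" "z \<in> carrier N"
      then show "tensor_assoc R L' M' N' (tensor_map R L (tensor R M N) L' (tensor R M' N') f (tensor_map R M N M' N' g h)
          (pure R L (tensor R M N) x (pure R M N y z))) =
        tensor_map R (tensor R L M) N (tensor R L' M') N' (tensor_map R L M L' M' f g) h
          (tensor_assoc R L M N (pure R L (tensor R M N) x (pure R M N y z)))"
        using x lin_map_closed[OF f] lin_map_closed[OF g] lin_map_closed[OF h]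
        by (simp add: tensor_assoc_pure mods tensor_map_pure[OF mods(1) MN mods(4) MN' f gh]
            tensor_map_pure[OF mods(2,3,5,6) g h] tensor_map_pure[OF LM mods(3) LM' mods(6) fg h]
            tensor_map_pure[OF mods(1,2,4,5) f g] pure_closed)
    qed
  qed
qed

lemma bilin_map_smult:
  assumes "module R P" "lin_map R M (base_module R) f" "lin_map R N P g"
  shows "bilin_map R M N P (\<lambda>x y. f x \<odot>\<^bsub>P\<^esub> g y)"
  using assms lin_map_closed[OF assms(2)] lin_map_closed[OF assms(3)]
  by (intro bilin_mapI lin_map_smult_left lin_map_smult_right) simp_all

lemma bilin_map_flip: "bilin_map R M N P f \<Longrightarrow> bilin_map R N M P (\<lambda>y x. f x y)"
  by (simp add: bilin_map_def)

lemma bilin_map_base_mult: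
  assumes "cring R" "lin_map R M (base_module R) f" "lin_map R N (base_module R) g"
  shows "bilin_map R M N (base_module R) (\<lambda>x y. f x \<otimes>\<^bsub>R\<^esub> g y)"
  using bilin_map_smult[OF module_base_module[OF assms(1)] assms(2,3)] by simp

section \<open>The product on a tensor product of algebras\<close>

lemma tensor_algebra_simps [simp]:
  "carrier (tensor_algebra R M N) = carrier (tensor R M N)"
  "add (tensor_algebra R M N) = add (tensor R M N)"
  "zero (tensor_algebra R M N) = zero (tensor R M N)"
  "smult (tensor_algebra R M N) = smult (tensor R M N)"
  by (simp_all add: tensor_algebra_def)

text \<open>Stated for arbitrary bilinear products, so that a factor may itself be
  \<open>tensor_algebra R H H\<close>, as in the triple tensor products. The second and third parts
  are the side conditions for evaluating the outer and the inner lift in the product.\<close>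

lemma bilin_map_tensor_mult:
  assumes mods: "module R M" "module R N"
    and M: "bilin_map R M M M (mult M)" and N: "bilin_map R N N N (mult N)"
  shows "bilin_map R (tensor R M N) (tensor R M N) (tensor R M N) (mult (tensor_algebra R M N))"
    and "t \<in> carrier (tensor R M N) \<Longrightarrow> bilin_map R M N (tensor R M N)
      (\<lambda>x y. tensor_lift R M N (tensor R M N) (\<lambda>x' y'. pure R M N (x \<otimes>\<^bsub>M\<^esub> x') (y \<otimes>\<^bsub>N\<^esub> y')) t)"
    and "\<lbrakk>x \<in> carrier M; y \<in> carrier N\<rbrakk> \<Longrightarrow>
      bilin_map R M N (tensor R M N) (\<lambda>x' y'. pure R M N (x \<otimes>\<^bsub>M\<^esub> x') (y \<otimes>\<^bsub>N\<^esub> y'))"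
proof -
  have right: "bilin_map R M N (tensor R M N) (\<lambda>x' y'. pure R M N (x \<otimes>\<^bsub>M\<^esub> x') (y \<otimes>\<^bsub>N\<^esub> y'))"
    if "x \<in> carrier M" "y \<in> carrier N" for x y
    using mods that by (intro bilin_map_pure_comp bilin_map_right[OF M] bilin_map_right[OF N])
  have left: "bilin_map R M N (tensor R M N) (\<lambda>x y. pure R M N (x \<otimes>\<^bsub>M\<^esub> x') (y \<otimes>\<^bsub>N\<^esub> y'))"
    if "x' \<in> carrier M" "y' \<in> carrier N" for x' y'
    using mods that by (intro bilin_map_pure_comp bilin_map_left[OF M] bilin_map_left[OF N])
  note lift2 = bilin_map_tensor_lift2[OF mods mods module_tensor[OF mods] right left]
  show "bilin_map R (tensor R M N) (tensor R M N) (tensor R M N) (mult (tensor_algebra R M N))"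
    using lift2(1) by (simp add: tensor_algebra_def)
  show "t \<in> carrier (tensor R M N) \<Longrightarrow> bilin_map R M N (tensor R M N)
      (\<lambda>x y. tensor_lift R M N (tensor R M N) (\<lambda>x' y'. pure R M N (x \<otimes>\<^bsub>M\<^esub> x') (y \<otimes>\<^bsub>N\<^esub> y')) t)"
    by (rule lift2(2))
  show "\<lbrakk>x \<in> carrier M; y \<in> carrier N\<rbrakk> \<Longrightarrow>
      bilin_map R M N (tensor R M N) (\<lambda>x' y'. pure R M N (x \<otimes>\<^bsub>M\<^esub> x') (y \<otimes>\<^bsub>N\<^esub> y'))"
    by (rule right)
qed

lemma tensor_mult_pure:
  assumes mods: "module R M" "module R N"
    and M: "bilin_map R M M M (mult M)" and N: "bilin_map R N N N (mult N)"
    and "x \<in> carrier M" "y \<in> carrier N" "x' \<in> carrier M" "y' \<in> carrier N"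
  shows "pure R M N x y \<otimes>\<^bsub>tensor_algebra R M N\<^esub> pure R M N x' y' =
    pure R M N (x \<otimes>\<^bsub>M\<^esub> x') (y \<otimes>\<^bsub>N\<^esub> y')"
  using assms(5-8)
  by (simp add: tensor_algebra_def tensor_lift_pure mods module_tensor pure_closed
      bilin_map_tensor_mult[OF mods M N])

section \<open>Records with the same underlying module\<close>

lemma module_eqI:
  assumes "module R M" "carrier M' = carrier M" "add M' = add M" "zero M' = zero M" "smult M' = smult M"
  shows "module R M'"
proof -
  interpret M: module R M by fact
  have "abelian_group M'"
  proof (rule abelian_groupI)
    show "\<exists>y\<in>carrier M'. y \<oplus>\<^bsub>M'\<^esub> x = \<zero>\<^bsub>M'\<^esub>" if "x \<in> carrier M'" for x
      using that by (intro bexI[of _ "\<ominus>\<^bsub>M\<^esub> x"]) (simp_all add: assms(2-) M.l_neg)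
  qed (simp_all add: assms(2-) M.a_ac)
  then show ?thesis
    by (intro moduleI M.R.cring_axioms)
      (simp_all add: assms(2-) M.smult_l_distr M.smult_r_distr M.smult_assoc1)
qed

lemma lin_map_eq_iff:
  assumes "carrier M' = carrier M" "add M' = add M" "smult M' = smult M"
    and "carrier N' = carrier N" "add N' = add N" "smult N' = smult N"
  shows "lin_map R M' N' = lin_map R M N"
  unfolding lin_map_def using assms by auto

text \<open>The construction reads only the carrier, addition and scalar multiplication of its
  factors. Replacing the factor \<open>tensor R H H\<close> by \<open>tensor_algebra R H H\<close>,
  or \<open>hsum_module\<close> by \<open>hsum_algebra\<close>, therefore changes neither the tensor
  product nor its pure tensors.\<close>

lemma tensor_eqI:
  assumes "carrier M' = carrier M" "add M' = add M" "smult M' = smult M"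
    and "carrier N' = carrier N" "add N' = add N" "smult N' = smult N"
  shows "tensor R M' N' = tensor R M N" and "pure R M' N' = pure R M N"
proof -
  have "tensor_relations R M' N' = tensor_relations R M N"
    unfolding tensor_relations_def by (simp add: assms)
  then have "tensor_null R M' N' = tensor_null R M N"
    by (simp add: tensor_null_def assms)
  then show "tensor R M' N' = tensor R M N" "pure R M' N' = pure R M N"
    by (simp_all add: tensor_def pure_def[abs_def] assms)
qed

section \<open>Hopf categories\<close>

context hopf_category
begin

lemma module_hom: "\<lbrakk>x \<in> X; y \<in> X\<rbrakk> \<Longrightarrow> module R (A x y)"
  using hom_coalgebra by (simp add: coalgebra_def)

lemma lin_map_comult: "\<lbrakk>x \<in> X; y \<in> X\<rbrakk> \<Longrightarrow> lin_map R (A x y) (tensor R (A x y) (A x y)) (\<Delta> x y)"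
  and lin_map_counit: "\<lbrakk>x \<in> X; y \<in> X\<rbrakk> \<Longrightarrow> lin_map R (A x y) (base_module R) (\<epsilon> x y)"
  using hom_coalgebra[of x y] by (simp_all add: coalgebra.comult_linear coalgebra.counit_linear)

lemma lin_map_mult:
  "\<lbrakk>x \<in> X; y \<in> X; z \<in> X\<rbrakk> \<Longrightarrow> lin_map R (tensor R (A x y) (A y z)) (A x z) (m x y z)"
  using mult_coalgebra_hom by (simp add: coalgebra_hom_def)

lemma bilin_map_hprod:
  "\<lbrakk>x \<in> X; y \<in> X; z \<in> X\<rbrakk> \<Longrightarrow> bilin_map R (A x y) (A y z) (A x z) (hprod R A m x y z)"
  unfolding hprod_def by (intro bilin_map_comp_lin[OF lin_map_mult] bilin_map_pure module_hom)

lemma counit_hprod: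
  assumes "x \<in> X" "y \<in> X" "z \<in> X" "h \<in> carrier (A x y)" "l \<in> carrier (A y z)"
  shows "\<epsilon> x z (hprod R A m x y z h l) = \<epsilon> x y h \<otimes> \<epsilon> y z l"
proof -
  have "\<epsilon> x z (hprod R A m x y z h l) =
      tensor_counit R (A x y) (\<epsilon> x y) (A y z) (\<epsilon> y z) (pure R (A x y) (A y z) h l)"
    using mult_coalgebra_hom[OF assms(1-3)] assms unfolding coalgebra_hom_def hprod_def
    by (simp add: pure_closed module_hom)
  also have "\<dots> = \<epsilon> x y h \<otimes> \<epsilon> y z l"
    unfolding tensor_counit_def using assms
    by (intro tensor_lift_pure module_hom module_base_module bilin_map_base_mult lin_map_counit cring_axioms)
  finally show ?thesis .
qed

text \<open>Multiplication is a coalgebra morphism: \<open>m \<otimes> m\<close> is applied to the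
  comultiplication of the tensor product and moved through both lifts. The outcome is the Sweedler
  formula \<open>\<Delta>(h l) = h\<^sub>1 l\<^sub>1 \<otimes> h\<^sub>2 l\<^sub>2\<close>.\<close>

lemma comult_hprod:
  assumes X: "x \<in> X" "y \<in> X" "z \<in> X" and h: "h \<in> carrier (A x y)" and l: "l \<in> carrier (A y z)"
  shows "\<Delta> x z (hprod R A m x y z h l) =
    tensor_lift R (A x y) (A x y) (tensor R (A x z) (A x z))
      (\<lambda>h1 h2. tensor_lift R (A y z) (A y z) (tensor R (A x z) (A x z))
        (\<lambda>l1 l2. pure R (A x z) (A x z) (hprod R A m x y z h1 l1) (hprod R A m x y z h2 l2)) (\<Delta> y z l))
      (\<Delta> x y h)"
    (is "_ = tensor_lift R ?C ?C ?EE _ _")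
proof -
  let ?D = "A y z" and ?E = "A x z" and ?m = "m x y z"
  define T where "T = tensor R ?C ?D"
  define TT where "TT = tensor R T T"
  note C = module_hom[OF X(1,2)] and D = module_hom[OF X(2,3)] and E = module_hom[OF X(1,3)]
  have T: "module R T" unfolding T_def using C D by (rule module_tensor)
  have TT: "module R TT" unfolding TT_def using T T by (rule module_tensor)
  have EE: "module R ?EE" using E E by (rule module_tensor)
  have m: "lin_map R T ?E ?m" unfolding T_def using X by (rule lin_map_mult)
  have mm: "lin_map R TT ?EE (tensor_map R T T ?E ?E ?m ?m)"
    unfolding TT_def using T T E E m m by (rule lin_map_tensor_map)
  have right: "bilin_map R ?D ?D TT (\<lambda>d1 d2. pure R T T (pure R ?C ?D c1 d1) (pure R ?C ?D c2 d2))"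
    if "c1 \<in> carrier ?C" "c2 \<in> carrier ?C" for c1 c2
    unfolding TT_def T_def using that C D
    by (intro bilin_map_pure_comp lin_map_pure_right lin_map_id module_tensor)
  have left: "bilin_map R ?C ?C TT (\<lambda>c1 c2. pure R T T (pure R ?C ?D c1 d1) (pure R ?C ?D c2 d2))"
    if "d1 \<in> carrier ?D" "d2 \<in> carrier ?D" for d1 d2
    unfolding TT_def T_def using that C D
    by (intro bilin_map_pure_comp lin_map_pure_left lin_map_id module_tensor)
  note lift2 = bilin_map_tensor_lift2[OF C C D D TT right left]
  \<comment> \<open>The interchange sending \<open>c1 \<otimes> c2\<close> and
    \<open>d1 \<otimes> d2\<close> to \<open>(c1 \<otimes> d1) \<otimes> (c2 \<otimes> d2)\<close>.
    Precomposed with the two comultiplications, it is the bilinear map that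
    \<open>tensor_comult\<close> lifts.\<close>
  have comult_bilin: "bilin_map R (tensor R ?C ?C) (tensor R ?D ?D) TT
    (\<lambda>s t. tensor_lift R ?C ?C TT (\<lambda>c1 c2. tensor_lift R ?D ?D TT
      (\<lambda>d1 d2. pure R T T (pure R ?C ?D c1 d1) (pure R ?C ?D c2 d2)) t) s)"
    by (rule lift2(1))
  note \<Delta>h = lin_map_closed[OF lin_map_comult[OF X(1,2)] h]
  note \<Delta>l = lin_map_closed[OF lin_map_comult[OF X(2,3)] l]
  have b: "bilin_map R ?C ?C TT (\<lambda>c1 c2. tensor_lift R ?D ?D TT
      (\<lambda>d1 d2. pure R T T (pure R ?C ?D c1 d1) (pure R ?C ?D c2 d2)) (\<Delta> y z l))"
    using \<Delta>l by - (rule lift2(2))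
  have hl: "pure R ?C ?D h l \<in> carrier T" unfolding T_def using C D h l by (rule pure_closed)
  have "\<Delta> x z (hprod R A m x y z h l) = tensor_map R T T ?E ?E ?m ?m
      (tensor_comult R ?C (\<Delta> x y) ?D (\<Delta> y z) (pure R ?C ?D h l))"
    using mult_coalgebra_hom[OF X] hl unfolding coalgebra_hom_def hprod_def T_def by simp
  also have "tensor_comult R ?C (\<Delta> x y) ?D (\<Delta> y z) (pure R ?C ?D h l) =
      tensor_lift R ?C ?C TT (\<lambda>c1 c2. tensor_lift R ?D ?D TT
        (\<lambda>d1 d2. pure R T T (pure R ?C ?D c1 d1) (pure R ?C ?D c2 d2)) (\<Delta> y z l)) (\<Delta> x y h)"
    unfolding tensor_comult_def Let_def T_def[symmetric] TT_def[symmetric]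
    using C D TT bilin_map_comp2[OF lin_map_comult[OF X(1,2)] lin_map_comult[OF X(2,3)] comult_bilin] h l
    by (rule tensor_lift_pure)
  also have "tensor_map R T T ?E ?E ?m ?m \<dots> = tensor_lift R ?C ?C ?EE (\<lambda>c1 c2. tensor_map R T T ?E ?E ?m ?m
      (tensor_lift R ?D ?D TT (\<lambda>d1 d2. pure R T T (pure R ?C ?D c1 d1) (pure R ?C ?D c2 d2)) (\<Delta> y z l))) (\<Delta> x y h)"
    using C C TT EE mm b \<Delta>h by (rule lin_map_tensor_lift_apply)
  also have "\<dots> = tensor_lift R ?C ?C ?EE
      (\<lambda>h1 h2. tensor_lift R ?D ?D ?EE
        (\<lambda>l1 l2. pure R ?E ?E (hprod R A m x y z h1 l1) (hprod R A m x y z h2 l2)) (\<Delta> y z l))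
      (\<Delta> x y h)"
    using C C EE bilin_map_comp_lin[OF mm b] \<Delta>h
  proof (rule tensor_lift_cong)
    fix c1 c2 assume c: "c1 \<in> carrier ?C" "c2 \<in> carrier ?C"
    have "tensor_map R T T ?E ?E ?m ?m (tensor_lift R ?D ?D TT
          (\<lambda>d1 d2. pure R T T (pure R ?C ?D c1 d1) (pure R ?C ?D c2 d2)) (\<Delta> y z l)) =
        tensor_lift R ?D ?D ?EE (\<lambda>d1 d2. tensor_map R T T ?E ?E ?m ?m
          (pure R T T (pure R ?C ?D c1 d1) (pure R ?C ?D c2 d2))) (\<Delta> y z l)"
      using D D TT EE mm right[OF c] \<Delta>l by (rule lin_map_tensor_lift_apply)
    also have "\<dots> = tensor_lift R ?D ?D ?EE
        (\<lambda>l1 l2. pure R ?E ?E (hprod R A m x y z c1 l1) (hprod R A m x y z c2 l2)) (\<Delta> y z l)"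
      using D D EE bilin_map_comp_lin[OF mm right[OF c]] \<Delta>l
    proof (rule tensor_lift_cong)
      fix d1 d2 assume "d1 \<in> carrier ?D" "d2 \<in> carrier ?D"
      then show "tensor_map R T T ?E ?E ?m ?m (pure R T T (pure R ?C ?D c1 d1) (pure R ?C ?D c2 d2)) =
          pure R ?E ?E (hprod R A m x y z c1 d1) (hprod R A m x y z c2 d2)"
        unfolding hprod_def using c C D
        by (intro tensor_map_pure T E m) (simp_all add: T_def pure_closed)
    qed
    finally show "tensor_map R T T ?E ?E ?m ?m (tensor_lift R ?D ?D TT
          (\<lambda>d1 d2. pure R T T (pure R ?C ?D c1 d1) (pure R ?C ?D c2 d2)) (\<Delta> y z l)) =
        tensor_lift R ?D ?D ?EE
        (\<lambda>l1 l2. pure R ?E ?E (hprod R A m x y z c1 l1) (hprod R A m x y z c2 l2)) (\<Delta> y z l)" .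
  qed
  finally show ?thesis .
qed

text \<open>Both facts come from evaluating the coalgebra morphism
  \<open>a \<mapsto> a 1\<^sub>x\<close> at \<open>\<one>\<close>, whose comultiplication in the
  base ring is \<open>\<one> \<otimes> \<one>\<close>.\<close>

lemma counit_unit: "x \<in> X \<Longrightarrow> \<epsilon> x x (u x) = \<one>"
  and comult_unit: "x \<in> X \<Longrightarrow> \<Delta> x x (u x) = pure R (A x x) (A x x) (u x) (u x)"
proof -
  assume x: "x \<in> X"
  interpret Ax: module R "A x x" using x by (intro module_hom)
  note hom = unit_coalgebra_hom[OF x, unfolded coalgebra_hom_def]
  have u: "\<one> \<odot>\<^bsub>A x x\<^esub> u x = u x" using unit_closed[OF x] by simp
  have "\<epsilon> x x (\<one> \<odot>\<^bsub>A x x\<^esub> u x) = \<one>" using hom by simp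
  then show "\<epsilon> x x (u x) = \<one>" by (simp only: u)
  have "\<Delta> x x (\<one> \<odot>\<^bsub>A x x\<^esub> u x) = tensor_map R (base_module R) (base_module R) (A x x) (A x x)
      (\<lambda>a. a \<odot>\<^bsub>A x x\<^esub> u x) (\<lambda>a. a \<odot>\<^bsub>A x x\<^esub> u x) (base_comult R \<one>)"
    using hom by simp
  also have "\<dots> = pure R (A x x) (A x x) (\<one> \<odot>\<^bsub>A x x\<^esub> u x) (\<one> \<odot>\<^bsub>A x x\<^esub> u x)"
    unfolding base_comult_def
    using hom by (intro tensor_map_pure module_base_module module_hom x cring_axioms) simp_all
  finally show "\<Delta> x x (u x) = pure R (A x x) (A x x) (u x) (u x)" by (simp only: u)
qed

end

section \<open>Weak Hopf algebras from spanning components\<close>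

text \<open>
  The direct sum is used only through its structure maps on homogeneous elements \<open>inj x y a\<close> and
  the fact that these span \<open>H\<close>, so every identity that is linear in each argument is checked on them.
\<close>

locale hopf_category_total = hopf_category R X A \<Delta> \<epsilon> m u S
  for R (structure) and X :: "'x set" and A and \<Delta> and \<epsilon> and m and u and S +
  fixes H :: "('a, 'h, 'n) module_scheme" (structure)
    and inj :: "'x \<Rightarrow> 'x \<Rightarrow> 'b \<Rightarrow> 'h"
    and \<Delta>\<^sub>H \<epsilon>\<^sub>H S\<^sub>H
  assumes finite_X: "finite X"
    and module_H: "module R H"
    and lin_map_inj: "\<lbrakk>x \<in> X; y \<in> X\<rbrakk> \<Longrightarrow> lin_map R (A x y) H (inj x y)"
    and inj_induct: "\<lbrakk>h \<in> carrier H; P \<zero>\<^bsub>H\<^esub>; \<And>x y a. \<lbrakk>x \<in> X; y \<in> X; a \<in> carrier (A x y)\<rbrakk> \<Longrightarrow> P (inj x y a);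
      \<And>f g. \<lbrakk>f \<in> carrier H; g \<in> carrier H; P f; P g\<rbrakk> \<Longrightarrow> P (f \<oplus>\<^bsub>H\<^esub> g)\<rbrakk> \<Longrightarrow> P h"
    and bilin_map_mult: "bilin_map R H H H (mult H)"
    and mult_inj: "\<lbrakk>x \<in> X; y \<in> X; z \<in> X; w \<in> X; a \<in> carrier (A x y); b \<in> carrier (A z w)\<rbrakk> \<Longrightarrow>
      inj x y a \<otimes>\<^bsub>H\<^esub> inj z w b = (if y = z then inj x w (hprod R A m x y w a b) else \<zero>\<^bsub>H\<^esub>)"
    and one_eq: "\<one>\<^bsub>H\<^esub> = (\<Oplus>\<^bsub>H\<^esub> x\<in>X. inj x x (u x))"
    and lin_map_\<Delta>: "lin_map R H (tensor R H H) \<Delta>\<^sub>H"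
    and \<Delta>_inj: "\<lbrakk>x \<in> X; y \<in> X; a \<in> carrier (A x y)\<rbrakk> \<Longrightarrow>
      \<Delta>\<^sub>H (inj x y a) = tensor_map R (A x y) (A x y) H H (inj x y) (inj x y) (\<Delta> x y a)"
    and lin_map_\<epsilon>: "lin_map R H (base_module R) \<epsilon>\<^sub>H"
    and \<epsilon>_inj: "\<lbrakk>x \<in> X; y \<in> X; a \<in> carrier (A x y)\<rbrakk> \<Longrightarrow> \<epsilon>\<^sub>H (inj x y a) = \<epsilon> x y a"
    and lin_map_S: "lin_map R H H S\<^sub>H"
    and S_inj: "\<lbrakk>x \<in> X; y \<in> X; a \<in> carrier (A x y)\<rbrakk> \<Longrightarrow> S\<^sub>H (inj x y a) = inj y x (S x y a)"
begin

sublocale H: module R H by (rule module_H)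

abbreviation "HH \<equiv> tensor R H H"
abbreviation "e x \<equiv> inj x x (u x)"

lemma module_HH: "module R HH" and module_HHH: "module R (tensor R HH H)"
  using module_H by (simp_all add: module_tensor)

lemma module_base: "module R (base_module R)"
  by (rule module_base_module) (rule cring_axioms)

lemma inj_closed: "\<lbrakk>x \<in> X; y \<in> X; a \<in> carrier (A x y)\<rbrakk> \<Longrightarrow> inj x y a \<in> carrier H"
  by (rule lin_map_closed[OF lin_map_inj])

lemma e_closed: "x \<in> X \<Longrightarrow> e x \<in> carrier H"
  by (intro inj_closed unit_closed)

lemma one_closed: "\<one>\<^bsub>H\<^esub> \<in> carrier H"
  unfolding one_eq using e_closed by (intro H.finsum_closed) auto

lemma mult_closed: "\<lbrakk>h \<in> carrier H; l \<in> carrier H\<rbrakk> \<Longrightarrow> h \<otimes>\<^bsub>H\<^esub> l \<in> carrier H"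
  by (rule bilin_map_closed[OF bilin_map_mult])

lemma counit_closed: "h \<in> carrier H \<Longrightarrow> \<epsilon>\<^sub>H h \<in> carrier R"
  using lin_map_closed[OF lin_map_\<epsilon>] by simp

lemma comult_closed: "\<lbrakk>x \<in> X; y \<in> X; a \<in> carrier (A x y)\<rbrakk> \<Longrightarrow> \<Delta> x y a \<in> carrier (tensor R (A x y) (A x y))"
  by (rule lin_map_closed[OF lin_map_comult])

section \<open>Reduction of linear and bilinear identities to homogeneous elements\<close>

lemma lin_map_eqI:
  assumes "module R P" "lin_map R H P f" "lin_map R H P g"
    and "\<And>x y a. \<lbrakk>x \<in> X; y \<in> X; a \<in> carrier (A x y)\<rbrakk> \<Longrightarrow> f (inj x y a) = g (inj x y a)"
    and "h \<in> carrier H"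
  shows "f h = g h"
  using assms(5)
proof (rule inj_induct)
  show "f \<zero>\<^bsub>H\<^esub> = g \<zero>\<^bsub>H\<^esub>" using module_H assms(1-3) by (simp add: lin_map_zero[of R H P])
qed (simp_all add: assms(4) lin_map_add[OF assms(2)] lin_map_add[OF assms(3)])

lemma bilin_map_eqI:
  assumes P: "module R P" and f: "bilin_map R H H P f" and g: "bilin_map R H H P g"
    and eq: "\<And>x y z w a b. \<lbrakk>x \<in> X; y \<in> X; z \<in> X; w \<in> X; a \<in> carrier (A x y); b \<in> carrier (A z w)\<rbrakk> \<Longrightarrow>
      f (inj x y a) (inj z w b) = g (inj x y a) (inj z w b)"
    and hl: "h \<in> carrier H" "l \<in> carrier H"
  shows "f h l = g h l"
  using P bilin_map_left[OF f hl(2)] bilin_map_left[OF g hl(2)] _ hl(1)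
proof (rule lin_map_eqI)
  fix x y a assume xy: "x \<in> X" "y \<in> X" "a \<in> carrier (A x y)"
  show "f (inj x y a) l = g (inj x y a) l"
    using P bilin_map_right[OF f inj_closed[OF xy]] bilin_map_right[OF g inj_closed[OF xy]] _ hl(2)
    by (rule lin_map_eqI) (use eq xy in simp)
qed

lemma lin_map_mult_left: "\<lbrakk>lin_map R L H f; l \<in> carrier H\<rbrakk> \<Longrightarrow> lin_map R L H (\<lambda>v. f v \<otimes>\<^bsub>H\<^esub> l)"
  and lin_map_mult_right: "\<lbrakk>lin_map R L H f; h \<in> carrier H\<rbrakk> \<Longrightarrow> lin_map R L H (\<lambda>v. h \<otimes>\<^bsub>H\<^esub> f v)"
  by (rule lin_map_comp[OF bilin_map_left[OF bilin_map_mult]], assumption+)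
    (rule lin_map_comp[OF bilin_map_right[OF bilin_map_mult]], assumption+)

lemma lin_map_\<epsilon>_comp: "lin_map R L H f \<Longrightarrow> lin_map R L (base_module R) (\<lambda>v. \<epsilon>\<^sub>H (f v))"
  by (rule lin_map_comp[OF lin_map_\<epsilon>])

lemma finsum_delta:
  assumes "module R P" "z \<in> X" "c \<in> carrier P"
  shows "(\<Oplus>\<^bsub>P\<^esub> x\<in>X. if x = z then c else \<zero>\<^bsub>P\<^esub>) = c"
proof -
  interpret P: module R P by fact
  show ?thesis using P.add.finprod_singleton_swap[OF assms(2) finite_X, of "\<lambda>_. c"] assms(3) by simp
qed

section \<open>The unit and associativity\<close>

lemma e_mult_inj:
  "\<lbrakk>x \<in> X; z \<in> X; w \<in> X; b \<in> carrier (A z w)\<rbrakk> \<Longrightarrow> e x \<otimes>\<^bsub>H\<^esub> inj z w b = (if x = z then inj z w b else \<zero>\<^bsub>H\<^esub>)"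
  by (simp add: mult_inj unit_closed unit_left)

lemma inj_mult_e:
  "\<lbrakk>x \<in> X; z \<in> X; w \<in> X; b \<in> carrier (A z w)\<rbrakk> \<Longrightarrow> inj z w b \<otimes>\<^bsub>H\<^esub> e x = (if x = w then inj z w b else \<zero>\<^bsub>H\<^esub>)"
  by (auto simp add: mult_inj unit_closed unit_right)

text \<open>The product with the unit is the sum of the products with the \<open>1\<^sub>z\<close>.
  For an element of \<open>A x y\<close>, only \<open>z = x\<close> contributes on the left and only
  \<open>z = y\<close> on the right.\<close>

lemma one_mult: "h \<in> carrier H \<Longrightarrow> \<one>\<^bsub>H\<^esub> \<otimes>\<^bsub>H\<^esub> h = h"
  and mult_one: "h \<in> carrier H \<Longrightarrow> h \<otimes>\<^bsub>H\<^esub> \<one>\<^bsub>H\<^esub> = h"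
proof -
  assume h: "h \<in> carrier H"
  show "\<one>\<^bsub>H\<^esub> \<otimes>\<^bsub>H\<^esub> h = h"
    using module_H lin_map_mult_right[OF lin_map_id one_closed] lin_map_id _ h
  proof (rule lin_map_eqI)
    fix x y a assume a: "x \<in> X" "y \<in> X" "a \<in> carrier (A x y)"
    have "\<one>\<^bsub>H\<^esub> \<otimes>\<^bsub>H\<^esub> inj x y a = (\<Oplus>\<^bsub>H\<^esub> z\<in>X. e z \<otimes>\<^bsub>H\<^esub> inj x y a)"
      unfolding one_eq using e_closed
      by (intro lin_map_finsum[OF module_H module_H bilin_map_left[OF bilin_map_mult inj_closed[OF a]]]) auto
    also have "\<dots> = (\<Oplus>\<^bsub>H\<^esub> z\<in>X. if z = x then inj x y a else \<zero>\<^bsub>H\<^esub>)"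
      using a by (intro H.finsum_cong') (simp_all add: e_mult_inj inj_closed)
    finally show "\<one>\<^bsub>H\<^esub> \<otimes>\<^bsub>H\<^esub> inj x y a = inj x y a"
      using a by (simp add: finsum_delta[OF module_H] inj_closed)
  qed
  show "h \<otimes>\<^bsub>H\<^esub> \<one>\<^bsub>H\<^esub> = h"
    using module_H lin_map_mult_left[OF lin_map_id one_closed] lin_map_id _ h
  proof (rule lin_map_eqI)
    fix x y a assume a: "x \<in> X" "y \<in> X" "a \<in> carrier (A x y)"
    have "inj x y a \<otimes>\<^bsub>H\<^esub> \<one>\<^bsub>H\<^esub> = (\<Oplus>\<^bsub>H\<^esub> z\<in>X. inj x y a \<otimes>\<^bsub>H\<^esub> e z)"
      unfolding one_eq using e_closed
      by (intro lin_map_finsum[OF module_H module_H bilin_map_right[OF bilin_map_mult inj_closed[OF a]]]) auto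
    also have "\<dots> = (\<Oplus>\<^bsub>H\<^esub> z\<in>X. if z = y then inj x y a else \<zero>\<^bsub>H\<^esub>)"
      using a by (intro H.finsum_cong') (simp_all add: inj_mult_e inj_closed)
    finally show "inj x y a \<otimes>\<^bsub>H\<^esub> \<one>\<^bsub>H\<^esub> = inj x y a"
      using a by (simp add: finsum_delta[OF module_H] inj_closed)
  qed
qed

lemma hprod_closed:
  "\<lbrakk>x \<in> X; y \<in> X; z \<in> X; a \<in> carrier (A x y); b \<in> carrier (A y z)\<rbrakk> \<Longrightarrow> hprod R A m x y z a b \<in> carrier (A x z)"
  by (rule bilin_map_closed[OF bilin_map_hprod])

lemma zero_mult: "h \<in> carrier H \<Longrightarrow> \<zero>\<^bsub>H\<^esub> \<otimes>\<^bsub>H\<^esub> h = \<zero>\<^bsub>H\<^esub>"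
  and mult_zero: "h \<in> carrier H \<Longrightarrow> h \<otimes>\<^bsub>H\<^esub> \<zero>\<^bsub>H\<^esub> = \<zero>\<^bsub>H\<^esub>"
  using lin_map_zero[OF module_H module_H bilin_map_left[OF bilin_map_mult]]
    lin_map_zero[OF module_H module_H bilin_map_right[OF bilin_map_mult]] by auto

lemma mult_assoc:
  assumes "h \<in> carrier H" "k \<in> carrier H" "l \<in> carrier H"
  shows "h \<otimes>\<^bsub>H\<^esub> k \<otimes>\<^bsub>H\<^esub> l = h \<otimes>\<^bsub>H\<^esub> (k \<otimes>\<^bsub>H\<^esub> l)"
  using module_H lin_map_mult_right[OF lin_map_id mult_closed[OF assms(1,2)]]
    lin_map_mult_right[OF lin_map_mult_right[OF lin_map_id assms(2)] assms(1)] _ assms(3)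
proof (rule lin_map_eqI)
  fix p q c assume c: "p \<in> X" "q \<in> X" "c \<in> carrier (A p q)"
  note cH = inj_closed[OF c]
  \<comment> \<open>For homogeneous \<open>h\<close> and \<open>k\<close>, either some adjacent pair
    is not composable and both sides are zero, or this is \<open>hprod_assoc\<close>.\<close>
  show "h \<otimes>\<^bsub>H\<^esub> k \<otimes>\<^bsub>H\<^esub> inj p q c = h \<otimes>\<^bsub>H\<^esub> (k \<otimes>\<^bsub>H\<^esub> inj p q c)"
    using module_H bilin_map_comp_lin[OF bilin_map_left[OF bilin_map_mult cH] bilin_map_mult]
      bilin_map_comp2[OF lin_map_id lin_map_mult_left[OF lin_map_id cH] bilin_map_mult] _ assms(1,2)
    by (rule bilin_map_eqI)
      (use c in \<open>auto simp: mult_inj hprod_closed zero_mult mult_zero inj_closed hprod_assoc\<close>)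
qed

lemma assoc_algebra_H: "assoc_algebra R H"
proof -
  have "ring H"
    by (rule ringI)
      (auto intro: H.abelian_group_axioms monoidI mult_closed one_closed mult_assoc one_mult mult_one
        lin_map_add[OF bilin_map_left[OF bilin_map_mult]] lin_map_add[OF bilin_map_right[OF bilin_map_mult]])
  then show ?thesis
    by (intro assoc_algebra.intro assoc_algebra_axioms.intro module_H
        lin_map_smult[OF bilin_map_left[OF bilin_map_mult]] lin_map_smult[OF bilin_map_right[OF bilin_map_mult]])
qed

section \<open>The coalgebra axioms\<close>

text \<open>Since \<open>inj x y\<close> respects the comultiplications, the legs of
  \<open>inj x y a\<close> may be taken in the component. The check of an axiom with a Sweedler sum
  over a homogeneous element usually starts here.\<close>

lemma tensor_lift_\<Delta>_inj:
  assumes "module R P" "bilin_map R H H P f" "x \<in> X" "y \<in> X" "a \<in> carrier (A x y)"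
  shows "tensor_lift R H H P f (\<Delta>\<^sub>H (inj x y a)) =
    tensor_lift R (A x y) (A x y) P (\<lambda>b c. f (inj x y b) (inj x y c)) (\<Delta> x y a)"
  unfolding \<Delta>_inj[OF assms(3-5)]
  using assms by (intro tensor_lift_tensor_map module_hom module_H lin_map_inj comult_closed)

text \<open>The counit laws follow by applying \<open>inj x y\<close> to those of the component. For
  coassociativity, both sides are images of the corresponding sides in the component under the
  threefold tensor power of \<open>inj x y\<close>, which commutes with the associator by
  naturality.\<close>

lemma coalgebra_H: "coalgebra R H \<Delta>\<^sub>H \<epsilon>\<^sub>H"
proof (intro coalgebra.intro coalgebra_axioms.intro module_H lin_map_\<Delta> lin_map_\<epsilon>)
  have counit: "bilin_map R H H H (\<lambda>x y. \<epsilon>\<^sub>H x \<odot>\<^bsub>H\<^esub> y)"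
    by (intro bilin_map_smult module_H lin_map_\<epsilon> lin_map_id)
  fix h assume h: "h \<in> carrier H"
  show "tensor_lift R H H H (\<lambda>x y. \<epsilon>\<^sub>H x \<odot>\<^bsub>H\<^esub> y) (\<Delta>\<^sub>H h) = h"
    using module_H lin_map_tensor_lift_arg[OF module_H module_H module_H lin_map_\<Delta> counit] lin_map_id _ h
  proof (rule lin_map_eqI)
    fix x y a assume a: "x \<in> X" "y \<in> X" "a \<in> carrier (A x y)"
    interpret C: coalgebra R "A x y" "\<Delta> x y" "\<epsilon> x y" using a by (intro hom_coalgebra)
    have b: "bilin_map R (A x y) (A x y) (A x y) (\<lambda>b c. \<epsilon> x y b \<odot>\<^bsub>A x y\<^esub> c)"
      by (intro bilin_map_smult C.module_axioms C.counit_linear lin_map_id)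
    have "tensor_lift R H H H (\<lambda>x y. \<epsilon>\<^sub>H x \<odot>\<^bsub>H\<^esub> y) (\<Delta>\<^sub>H (inj x y a)) =
        tensor_lift R (A x y) (A x y) H (\<lambda>b c. \<epsilon>\<^sub>H (inj x y b) \<odot>\<^bsub>H\<^esub> inj x y c) (\<Delta> x y a)"
      using module_H counit a by (rule tensor_lift_\<Delta>_inj)
    also have "\<dots> = tensor_lift R (A x y) (A x y) H (\<lambda>b c. inj x y (\<epsilon> x y b \<odot>\<^bsub>A x y\<^esub> c)) (\<Delta> x y a)"
      using C.module_axioms C.module_axioms module_H bilin_map_comp2[OF lin_map_inj lin_map_inj counit] comult_closed[OF a]
      by (rule tensor_lift_cong)
        (use a lin_map_closed[OF C.counit_linear] in \<open>simp_all add: \<epsilon>_inj lin_map_smult[OF lin_map_inj]\<close>)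
    also have "\<dots> = inj x y (tensor_lift R (A x y) (A x y) (A x y) (\<lambda>b c. \<epsilon> x y b \<odot>\<^bsub>A x y\<^esub> c) (\<Delta> x y a))"
      using C.module_axioms C.module_axioms C.module_axioms module_H lin_map_inj[OF a(1,2)] b comult_closed[OF a]
      by (rule lin_map_tensor_lift_apply[symmetric])
    finally show "tensor_lift R H H H (\<lambda>x y. \<epsilon>\<^sub>H x \<odot>\<^bsub>H\<^esub> y) (\<Delta>\<^sub>H (inj x y a)) = inj x y a"
      using a by (simp add: C.counit_left)
  qed
  show "tensor_lift R H H H (\<lambda>x y. \<epsilon>\<^sub>H y \<odot>\<^bsub>H\<^esub> x) (\<Delta>\<^sub>H h) = h"
    using module_H lin_map_tensor_lift_arg[OF module_H module_H module_H lin_map_\<Delta> bilin_map_flip[OF counit]] lin_map_id _ h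
  proof (rule lin_map_eqI)
    fix x y a assume a: "x \<in> X" "y \<in> X" "a \<in> carrier (A x y)"
    interpret C: coalgebra R "A x y" "\<Delta> x y" "\<epsilon> x y" using a by (intro hom_coalgebra)
    have b: "bilin_map R (A x y) (A x y) (A x y) (\<lambda>c b. \<epsilon> x y b \<odot>\<^bsub>A x y\<^esub> c)"
      by (rule bilin_map_flip) (intro bilin_map_smult C.module_axioms C.counit_linear lin_map_id)
    have "tensor_lift R H H H (\<lambda>x y. \<epsilon>\<^sub>H y \<odot>\<^bsub>H\<^esub> x) (\<Delta>\<^sub>H (inj x y a)) =
        tensor_lift R (A x y) (A x y) H (\<lambda>b c. \<epsilon>\<^sub>H (inj x y c) \<odot>\<^bsub>H\<^esub> inj x y b) (\<Delta> x y a)"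
      using module_H bilin_map_flip[OF counit] a by (rule tensor_lift_\<Delta>_inj)
    also have "\<dots> = tensor_lift R (A x y) (A x y) H (\<lambda>b c. inj x y (\<epsilon> x y c \<odot>\<^bsub>A x y\<^esub> b)) (\<Delta> x y a)"
      using C.module_axioms C.module_axioms module_H
        bilin_map_comp2[OF lin_map_inj lin_map_inj bilin_map_flip[OF counit]] comult_closed[OF a]
      by (rule tensor_lift_cong)
        (use a lin_map_closed[OF C.counit_linear] in \<open>simp_all add: \<epsilon>_inj lin_map_smult[OF lin_map_inj]\<close>)
    also have "\<dots> = inj x y (tensor_lift R (A x y) (A x y) (A x y) (\<lambda>b c. \<epsilon> x y c \<odot>\<^bsub>A x y\<^esub> b) (\<Delta> x y a))"
      using C.module_axioms C.module_axioms C.module_axioms module_H lin_map_inj[OF a(1,2)] b comult_closed[OF a]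
      by (rule lin_map_tensor_lift_apply[symmetric])
    finally show "tensor_lift R H H H (\<lambda>x y. \<epsilon>\<^sub>H y \<odot>\<^bsub>H\<^esub> x) (\<Delta>\<^sub>H (inj x y a)) = inj x y a"
      using a by (simp add: C.counit_right)
  qed
  note lhs = lin_map_tensor_map_arg[OF module_H module_H module_HH module_H lin_map_\<Delta> lin_map_\<Delta> lin_map_id]
  note rhs = lin_map_comp[OF lin_map_tensor_assoc[OF module_H module_H module_H]
      lin_map_tensor_map_arg[OF module_H module_H module_H module_HH lin_map_\<Delta> lin_map_id lin_map_\<Delta>]]
  show "tensor_map R H H HH H \<Delta>\<^sub>H (\<lambda>x. x) (\<Delta>\<^sub>H h) =
      tensor_assoc R H H H (tensor_map R H H H HH (\<lambda>x. x) \<Delta>\<^sub>H (\<Delta>\<^sub>H h))"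
    using module_HHH lhs rhs _ h
  proof (rule lin_map_eqI)
    fix x y a assume a: "x \<in> X" "y \<in> X" "a \<in> carrier (A x y)"
    interpret C: coalgebra R "A x y" "\<Delta> x y" "\<epsilon> x y" using a by (intro hom_coalgebra)
    let ?C = "A x y" and ?i = "inj x y"
    let ?CC = "tensor R ?C ?C" and ?ii = "tensor_map R (A x y) (A x y) H H (inj x y) (inj x y)"
    note C = C.module_axioms
    note CC = module_tensor[OF C C]
    note i = lin_map_inj[OF a(1,2)]
    note ii = lin_map_tensor_map[OF C C module_H module_H i i]
    note \<Delta>a = comult_closed[OF a]
    have "tensor_map R H H HH H \<Delta>\<^sub>H (\<lambda>x. x) (\<Delta>\<^sub>H (?i a)) =
        tensor_map R ?C ?C HH H (\<lambda>b. \<Delta>\<^sub>H (?i b)) ?i (\<Delta> x y a)"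
      unfolding \<Delta>_inj[OF a]
      using C C module_H module_H module_HH module_H i i lin_map_\<Delta> lin_map_id \<Delta>a
      by (rule tensor_map_tensor_map)
    also have "\<dots> = tensor_map R ?C ?C HH H (\<lambda>b. ?ii (\<Delta> x y b)) ?i (\<Delta> x y a)"
      using C C module_HH module_H lin_map_comp[OF lin_map_\<Delta> i] i \<Delta>a
      by (rule tensor_map_cong) (simp_all add: \<Delta>_inj a)
    \<comment> \<open>Separating the injections from the comultiplication exposes
      \<open>(\<Delta> \<otimes> id) (\<Delta> a)\<close>, to which coassociativity of the component
      applies.\<close>
    also have "\<dots> = tensor_map R ?CC ?C HH H ?ii ?i (tensor_map R ?C ?C ?CC ?C (\<Delta> x y) (\<lambda>x. x) (\<Delta> x y a))"
      using C C CC C module_HH module_H C.comult_linear lin_map_id ii i \<Delta>a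
      by (rule tensor_map_tensor_map[symmetric])
    also have "\<dots> = tensor_map R ?CC ?C HH H ?ii ?i
        (tensor_assoc R ?C ?C ?C (tensor_map R ?C ?C ?C ?CC (\<lambda>x. x) (\<Delta> x y) (\<Delta> x y a)))"
      using C.coassoc[OF a(3)] by simp
    also have "\<dots> = tensor_assoc R H H H (tensor_map R ?C ?CC H HH ?i ?ii
        (tensor_map R ?C ?C ?C ?CC (\<lambda>x. x) (\<Delta> x y) (\<Delta> x y a)))"
      using C C C module_H module_H module_H i i i tensor_map_closed[OF C C C CC lin_map_id C.comult_linear \<Delta>a]
      by (rule tensor_assoc_natural[symmetric])
    also have "tensor_map R ?C ?CC H HH ?i ?ii (tensor_map R ?C ?C ?C ?CC (\<lambda>x. x) (\<Delta> x y) (\<Delta> x y a)) =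
        tensor_map R ?C ?C H HH ?i (\<lambda>b. ?ii (\<Delta> x y b)) (\<Delta> x y a)"
      using C C C CC module_H module_HH lin_map_id C.comult_linear i ii \<Delta>a
      by (rule tensor_map_tensor_map)
    also have "\<dots> = tensor_map R ?C ?C H HH ?i (\<lambda>b. \<Delta>\<^sub>H (?i b)) (\<Delta> x y a)"
      using C C module_H module_HH i lin_map_comp[OF ii C.comult_linear] \<Delta>a
      by (rule tensor_map_cong) (simp_all add: \<Delta>_inj a)
    also have "\<dots> = tensor_map R H H H HH (\<lambda>x. x) \<Delta>\<^sub>H (\<Delta>\<^sub>H (?i a))"
      unfolding \<Delta>_inj[OF a]
      using C C module_H module_H module_H module_HH i i lin_map_id lin_map_\<Delta> \<Delta>a
      by (rule tensor_map_tensor_map[symmetric])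
    finally show "tensor_map R H H HH H \<Delta>\<^sub>H (\<lambda>x. x) (\<Delta>\<^sub>H (?i a)) =
      tensor_assoc R H H H (tensor_map R H H H HH (\<lambda>x. x) \<Delta>\<^sub>H (\<Delta>\<^sub>H (?i a)))" .
  qed
qed

section \<open>Multiplicativity of the comultiplication\<close>

lemma bilin_map_HH_mult: "bilin_map R HH HH HH (mult (tensor_algebra R H H))"
  by (intro bilin_map_tensor_mult module_H bilin_map_mult)

text \<open>On homogeneous elements the right-hand side is a double lift over the legs of
  \<open>a\<close> and of \<open>b\<close>. If \<open>y\<close> and \<open>z\<close> differ, all
  products of legs vanish, as does the product of \<open>a\<close> and \<open>b\<close>; if they
  agree, the legs multiply in the category and \<open>comult_hprod\<close> is transported along
  \<open>inj x w\<close>.\<close>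

lemma comult_mult:
  assumes hl: "h \<in> carrier H" "l \<in> carrier H"
  shows "\<Delta>\<^sub>H (h \<otimes>\<^bsub>H\<^esub> l) = \<Delta>\<^sub>H h \<otimes>\<^bsub>tensor_algebra R H H\<^esub> \<Delta>\<^sub>H l"
  using module_HH bilin_map_comp_lin[OF lin_map_\<Delta> bilin_map_mult]
    bilin_map_comp2[OF lin_map_\<Delta> lin_map_\<Delta> bilin_map_HH_mult] _ hl
proof (rule bilin_map_eqI)
  fix x y z w a b
  assume X: "x \<in> X" "y \<in> X" "z \<in> X" "w \<in> X" and a: "a \<in> carrier (A x y)" and b: "b \<in> carrier (A z w)"
  let ?C = "A x y" and ?D = "A z w" and ?i = "inj x y" and ?j = "inj z w"
  note C = module_hom[OF X(1,2)] and D = module_hom[OF X(3,4)]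
  note i = lin_map_inj[OF X(1,2)] and j = lin_map_inj[OF X(3,4)]
  note \<Delta>a = comult_closed[OF X(1,2) a] and \<Delta>b = comult_closed[OF X(3,4) b]
  note right = bilin_map_tensor_mult(3)[OF module_H module_H bilin_map_mult bilin_map_mult]
  note outer = bilin_map_tensor_mult(2)[OF module_H module_H bilin_map_mult bilin_map_mult]
  have "\<Delta>\<^sub>H (?j b) \<in> carrier HH" using inj_closed[OF X(3,4) b] by (rule lin_map_closed[OF lin_map_\<Delta>])
  note outer = outer[OF this]
  have "\<Delta>\<^sub>H (?i a) \<otimes>\<^bsub>tensor_algebra R H H\<^esub> \<Delta>\<^sub>H (?j b) =
      tensor_lift R H H HH (\<lambda>x y. tensor_lift R H H HH
        (\<lambda>x' y'. pure R H H (x \<otimes>\<^bsub>H\<^esub> x') (y \<otimes>\<^bsub>H\<^esub> y')) (\<Delta>\<^sub>H (?j b))) (\<Delta>\<^sub>H (?i a))"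
    by (simp add: tensor_algebra_def)
  also have "\<dots> = tensor_lift R ?C ?C HH (\<lambda>x y. tensor_lift R H H HH
        (\<lambda>x' y'. pure R H H (?i x \<otimes>\<^bsub>H\<^esub> x') (?i y \<otimes>\<^bsub>H\<^esub> y')) (\<Delta>\<^sub>H (?j b))) (\<Delta> x y a)"
    using module_HH outer X(1,2) a by (rule tensor_lift_\<Delta>_inj)
  also have "\<dots> = tensor_lift R ?C ?C HH (\<lambda>x y. tensor_lift R ?D ?D HH
        (\<lambda>x' y'. pure R H H (?i x \<otimes>\<^bsub>H\<^esub> ?j x') (?i y \<otimes>\<^bsub>H\<^esub> ?j y')) (\<Delta> z w b)) (\<Delta> x y a)"
    using C C module_HH bilin_map_comp2[OF i i outer] \<Delta>a
  proof (rule tensor_lift_cong)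
    fix c1 c2 assume c: "c1 \<in> carrier ?C" "c2 \<in> carrier ?C"
    show "tensor_lift R H H HH (\<lambda>x' y'. pure R H H (?i c1 \<otimes>\<^bsub>H\<^esub> x') (?i c2 \<otimes>\<^bsub>H\<^esub> y')) (\<Delta>\<^sub>H (?j b)) =
        tensor_lift R ?D ?D HH (\<lambda>x' y'. pure R H H (?i c1 \<otimes>\<^bsub>H\<^esub> ?j x') (?i c2 \<otimes>\<^bsub>H\<^esub> ?j y')) (\<Delta> z w b)"
      using module_HH right[OF inj_closed[OF X(1,2) c(1)] inj_closed[OF X(1,2) c(2)]] X(3,4) b
      by (rule tensor_lift_\<Delta>_inj)
  qed
  finally have rhs: "\<Delta>\<^sub>H (?i a) \<otimes>\<^bsub>tensor_algebra R H H\<^esub> \<Delta>\<^sub>H (?j b) =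
      tensor_lift R ?C ?C HH (\<lambda>x y. tensor_lift R ?D ?D HH
        (\<lambda>x' y'. pure R H H (?i x \<otimes>\<^bsub>H\<^esub> ?j x') (?i y \<otimes>\<^bsub>H\<^esub> ?j y')) (\<Delta> z w b)) (\<Delta> x y a)" .
  have lift_D: "bilin_map R ?D ?D HH (\<lambda>x' y'. pure R H H (?i c1 \<otimes>\<^bsub>H\<^esub> ?j x') (?i c2 \<otimes>\<^bsub>H\<^esub> ?j y'))"
    if c: "c1 \<in> carrier ?C" "c2 \<in> carrier ?C" for c1 c2
    using j j right[OF inj_closed[OF X(1,2) c(1)] inj_closed[OF X(1,2) c(2)]] by (rule bilin_map_comp2)
  have "bilin_map R ?C ?C HH (\<lambda>x' y'. pure R H H (?i x' \<otimes>\<^bsub>H\<^esub> ?j d1) (?i y' \<otimes>\<^bsub>H\<^esub> ?j d2))"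
    if d: "d1 \<in> carrier ?D" "d2 \<in> carrier ?D" for d1 d2
    using d inj_closed[OF X(3,4)]
    by (intro bilin_map_pure_comp C module_H lin_map_mult_left i)
  then have lift_C: "bilin_map R ?C ?C HH (\<lambda>x y. tensor_lift R ?D ?D HH
        (\<lambda>x' y'. pure R H H (?i x \<otimes>\<^bsub>H\<^esub> ?j x') (?i y \<otimes>\<^bsub>H\<^esub> ?j y')) (\<Delta> z w b))"
    using \<Delta>b lift_D by (intro bilin_map_tensor_lift2(2) C D module_HH)
  show "\<Delta>\<^sub>H (?i a \<otimes>\<^bsub>H\<^esub> ?j b) = \<Delta>\<^sub>H (?i a) \<otimes>\<^bsub>tensor_algebra R H H\<^esub> \<Delta>\<^sub>H (?j b)"
  proof (cases "y = z")
    case False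
    have zero: "pure R H H \<zero>\<^bsub>H\<^esub> \<zero>\<^bsub>H\<^esub> = \<zero>\<^bsub>HH\<^esub>"
      by (rule lin_map_zero[OF module_H module_HH bilin_map_right[OF bilin_map_pure]]) (simp_all add: module_H)
    have "tensor_lift R ?C ?C HH (\<lambda>x y. tensor_lift R ?D ?D HH
        (\<lambda>x' y'. pure R H H (?i x \<otimes>\<^bsub>H\<^esub> ?j x') (?i y \<otimes>\<^bsub>H\<^esub> ?j y')) (\<Delta> z w b)) (\<Delta> x y a) =
      tensor_lift R ?C ?C HH (\<lambda>x y. \<zero>\<^bsub>HH\<^esub>) (\<Delta> x y a)"
      using C C module_HH lift_C \<Delta>a
    proof (rule tensor_lift_cong)
      fix c1 c2 assume c: "c1 \<in> carrier ?C" "c2 \<in> carrier ?C"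
      have "tensor_lift R ?D ?D HH (\<lambda>x' y'. pure R H H (?i c1 \<otimes>\<^bsub>H\<^esub> ?j x') (?i c2 \<otimes>\<^bsub>H\<^esub> ?j y')) (\<Delta> z w b) =
          tensor_lift R ?D ?D HH (\<lambda>x' y'. \<zero>\<^bsub>HH\<^esub>) (\<Delta> z w b)"
        using D D module_HH lift_D[OF c] \<Delta>b
        by (rule tensor_lift_cong) (use False c X in \<open>simp add: mult_inj zero\<close>)
      also have "\<dots> = \<zero>\<^bsub>HH\<^esub>" using D D module_HH \<Delta>b by (rule tensor_lift_zero)
      finally show "tensor_lift R ?D ?D HH (\<lambda>x' y'. pure R H H (?i c1 \<otimes>\<^bsub>H\<^esub> ?j x') (?i c2 \<otimes>\<^bsub>H\<^esub> ?j y')) (\<Delta> z w b)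
          = \<zero>\<^bsub>HH\<^esub>" .
    qed
    also have "\<dots> = \<zero>\<^bsub>HH\<^esub>" using C C module_HH \<Delta>a by (rule tensor_lift_zero)
    finally show ?thesis
      using False X a b by (simp add: rhs mult_inj lin_map_zero[OF module_H module_HH lin_map_\<Delta>])
  next
    case True
    \<comment> \<open>The orientation matters: \<open>z\<close> is replaced by \<open>y\<close>, so
      that facts about composites of \<open>A x y\<close> with \<open>A y w\<close> fit elements of
      \<open>A z w\<close>.\<close>
    note [simp] = True[symmetric]
    let ?E = "A x w" and ?k = "inj x w" and ?p = "hprod R A m x y w"
    note E = module_hom[OF X(1,4)]
    note EE = module_tensor[OF E E]
    note k = lin_map_inj[OF X(1,4)]
    let ?kk = "tensor_map R ?E ?E H H ?k ?k"
    note kk = lin_map_tensor_map[OF E E module_H module_H k k]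
    have p: "bilin_map R ?C ?D ?E ?p" using bilin_map_hprod[OF X(1,2,4)] by simp
    have right: "bilin_map R ?D ?D (tensor R ?E ?E) (\<lambda>d1 d2. pure R ?E ?E (?p c1 d1) (?p c2 d2))"
      if c: "c1 \<in> carrier ?C" "c2 \<in> carrier ?C" for c1 c2
      using D D E E bilin_map_right[OF p c(1)] bilin_map_right[OF p c(2)] by (rule bilin_map_pure_comp)
    have left: "bilin_map R ?C ?C (tensor R ?E ?E) (\<lambda>c1 c2. pure R ?E ?E (?p c1 d1) (?p c2 d2))"
      if d: "d1 \<in> carrier ?D" "d2 \<in> carrier ?D" for d1 d2
      using C C E E bilin_map_left[OF p d(1)] bilin_map_left[OF p d(2)] by (rule bilin_map_pure_comp)
    have outer: "bilin_map R ?C ?C (tensor R ?E ?E) (\<lambda>c1 c2. tensor_lift R ?D ?D (tensor R ?E ?E)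
        (\<lambda>d1 d2. pure R ?E ?E (?p c1 d1) (?p c2 d2)) (\<Delta> z w b))"
      using right left \<Delta>b by (intro bilin_map_tensor_lift2(2) C D EE)
    have pab: "?p a b \<in> carrier ?E" using a b by (rule bilin_map_closed[OF p])
    have "\<Delta>\<^sub>H (?i a \<otimes>\<^bsub>H\<^esub> ?j b) = ?kk (\<Delta> x w (?p a b))"
      using X a b pab by (simp add: mult_inj \<Delta>_inj)
    also have "\<Delta> x w (?p a b) = tensor_lift R ?C ?C (tensor R ?E ?E) (\<lambda>c1 c2. tensor_lift R ?D ?D (tensor R ?E ?E)
        (\<lambda>d1 d2. pure R ?E ?E (?p c1 d1) (?p c2 d2)) (\<Delta> z w b)) (\<Delta> x y a)"
      using comult_hprod[OF X(1,2,4) a] b by simp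
    also have "?kk \<dots> = tensor_lift R ?C ?C HH (\<lambda>c1 c2. ?kk (tensor_lift R ?D ?D (tensor R ?E ?E)
        (\<lambda>d1 d2. pure R ?E ?E (?p c1 d1) (?p c2 d2)) (\<Delta> z w b))) (\<Delta> x y a)"
      using C C EE module_HH kk outer \<Delta>a by (rule lin_map_tensor_lift_apply)
    also have "\<dots> = tensor_lift R ?C ?C HH (\<lambda>x y. tensor_lift R ?D ?D HH
        (\<lambda>x' y'. pure R H H (?i x \<otimes>\<^bsub>H\<^esub> ?j x') (?i y \<otimes>\<^bsub>H\<^esub> ?j y')) (\<Delta> z w b)) (\<Delta> x y a)"
      using C C module_HH bilin_map_comp_lin[OF kk outer] \<Delta>a
    proof (rule tensor_lift_cong)
      fix c1 c2 assume c: "c1 \<in> carrier ?C" "c2 \<in> carrier ?C"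
      have "?kk (tensor_lift R ?D ?D (tensor R ?E ?E) (\<lambda>d1 d2. pure R ?E ?E (?p c1 d1) (?p c2 d2)) (\<Delta> z w b)) =
          tensor_lift R ?D ?D HH (\<lambda>d1 d2. ?kk (pure R ?E ?E (?p c1 d1) (?p c2 d2))) (\<Delta> z w b)"
        using D D EE module_HH kk right[OF c] \<Delta>b by (rule lin_map_tensor_lift_apply)
      also have "\<dots> = tensor_lift R ?D ?D HH (\<lambda>d1 d2. pure R H H (?i c1 \<otimes>\<^bsub>H\<^esub> ?j d1) (?i c2 \<otimes>\<^bsub>H\<^esub> ?j d2)) (\<Delta> z w b)"
        using D D module_HH bilin_map_comp_lin[OF kk right[OF c]] \<Delta>b
      proof (rule tensor_lift_cong)
        fix d1 d2 assume d: "d1 \<in> carrier ?D" "d2 \<in> carrier ?D"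
        show "?kk (pure R ?E ?E (?p c1 d1) (?p c2 d2)) = pure R H H (?i c1 \<otimes>\<^bsub>H\<^esub> ?j d1) (?i c2 \<otimes>\<^bsub>H\<^esub> ?j d2)"
          using tensor_map_pure[OF E E module_H module_H k k] bilin_map_closed[OF p] X c d
          by (simp add: mult_inj)
      qed
      finally show "?kk (tensor_lift R ?D ?D (tensor R ?E ?E) (\<lambda>d1 d2. pure R ?E ?E (?p c1 d1) (?p c2 d2)) (\<Delta> z w b)) =
        tensor_lift R ?D ?D HH (\<lambda>d1 d2. pure R H H (?i c1 \<otimes>\<^bsub>H\<^esub> ?j d1) (?i c2 \<otimes>\<^bsub>H\<^esub> ?j d2)) (\<Delta> z w b)" .
    qed
    finally show ?thesis unfolding rhs .
  qed
qed

section \<open>Weak multiplicativity of the counit\<close>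

lemma counit_mult_inj:
  "\<lbrakk>x \<in> X; y \<in> X; z \<in> X; w \<in> X; a \<in> carrier (A x y); b \<in> carrier (A z w)\<rbrakk> \<Longrightarrow>
    \<epsilon>\<^sub>H (inj x y a \<otimes>\<^bsub>H\<^esub> inj z w b) = (if y = z then \<epsilon> x y a \<otimes> \<epsilon> z w b else \<zero>)"
  using lin_map_zero[OF module_H module_base lin_map_\<epsilon>]
  by (auto simp: mult_inj \<epsilon>_inj hprod_closed counit_hprod)

lemma counit_hom_closed: "\<lbrakk>x \<in> X; y \<in> X; a \<in> carrier (A x y)\<rbrakk> \<Longrightarrow> \<epsilon> x y a \<in> carrier R"
  using lin_map_closed[OF lin_map_counit] by fastforce

text \<open>Obtained by applying \<open>\<epsilon>\<close> to the counit law
  \<open>\<epsilon>(a\<^sub>1) a\<^sub>2 = a\<close> and taking out the scalar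
  \<open>\<epsilon>(a\<^sub>1)\<close>.\<close>

lemma counit_counit:
  assumes "x \<in> X" "y \<in> X" "a \<in> carrier (A x y)"
  shows "tensor_lift R (A x y) (A x y) (base_module R) (\<lambda>b c. \<epsilon> x y b \<otimes> \<epsilon> x y c) (\<Delta> x y a) = \<epsilon> x y a"
proof -
  interpret C: coalgebra R "A x y" "\<Delta> x y" "\<epsilon> x y" using assms by (intro hom_coalgebra)
  note C = C.module_axioms
  have b: "bilin_map R (A x y) (A x y) (A x y) (\<lambda>b c. \<epsilon> x y b \<odot>\<^bsub>A x y\<^esub> c)"
    by (intro bilin_map_smult C C.counit_linear lin_map_id)
  have "\<epsilon> x y (tensor_lift R (A x y) (A x y) (A x y) (\<lambda>b c. \<epsilon> x y b \<odot>\<^bsub>A x y\<^esub> c) (\<Delta> x y a)) =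
      tensor_lift R (A x y) (A x y) (base_module R) (\<lambda>b c. \<epsilon> x y (\<epsilon> x y b \<odot>\<^bsub>A x y\<^esub> c)) (\<Delta> x y a)"
    using C C C module_base C.counit_linear b comult_closed[OF assms] by (rule lin_map_tensor_lift_apply)
  also have "\<dots> = tensor_lift R (A x y) (A x y) (base_module R) (\<lambda>b c. \<epsilon> x y b \<otimes> \<epsilon> x y c) (\<Delta> x y a)"
    using C C module_base bilin_map_comp_lin[OF C.counit_linear b] comult_closed[OF assms]
    by (rule tensor_lift_cong)
      (simp add: lin_map_smult[OF C.counit_linear] counit_hom_closed assms(1,2))
  finally show ?thesis using assms by (simp add: C.counit_left)
qed

text \<open>The common core of both weak counit axioms, with \<open>g\<close> standing for either
  arrangement of the legs of \<open>b\<close>. On composable elements each arrangement is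
  \<open>\<epsilon>(a) \<epsilon>(c) \<epsilon>(b\<^sub>1) \<epsilon>(b\<^sub>2)\<close>, symmetric
  in the legs, which \<open>counit_counit\<close> collapses; otherwise each is zero.\<close>

lemma counit_product:
  assumes X: "x \<in> X" "y \<in> X" "z \<in> X" "w \<in> X" "p \<in> X" "q \<in> X"
    and a: "a \<in> carrier (A x y)" and b: "b \<in> carrier (A z w)" and c: "c \<in> carrier (A p q)"
    and g: "bilin_map R (A z w) (A z w) (base_module R) g"
    and g_eq: "\<And>b1 b2. \<lbrakk>b1 \<in> carrier (A z w); b2 \<in> carrier (A z w)\<rbrakk> \<Longrightarrow> g b1 b2 =
      (if y = z \<and> w = p then (\<epsilon> x y a \<otimes> \<epsilon> p q c) \<otimes> (\<epsilon> z w b1 \<otimes> \<epsilon> z w b2) else \<zero>)"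
  shows "\<epsilon>\<^sub>H (inj x y a \<otimes>\<^bsub>H\<^esub> inj z w b \<otimes>\<^bsub>H\<^esub> inj p q c) =
    tensor_lift R (A z w) (A z w) (base_module R) g (\<Delta> z w b)"
proof -
  note D = module_hom[OF X(3,4)] and \<Delta>b = comult_closed[OF X(3,4) b]
  have [simp]: "\<epsilon> x y a \<in> carrier R" "\<epsilon> z w b \<in> carrier R" "\<epsilon> p q c \<in> carrier R"
    using X a b c by (simp_all add: counit_hom_closed)
  show ?thesis
  proof (cases "y = z \<and> w = p")
    case False
    have "\<epsilon>\<^sub>H (inj x y a \<otimes>\<^bsub>H\<^esub> inj z w b \<otimes>\<^bsub>H\<^esub> inj p q c) = \<zero>"
      using X a b c lin_map_zero[OF module_H module_base lin_map_\<epsilon>] False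
      by (auto simp: mult_inj hprod_closed zero_mult inj_closed)
    moreover have "tensor_lift R (A z w) (A z w) (base_module R) g (\<Delta> z w b) =
        tensor_lift R (A z w) (A z w) (base_module R) (\<lambda>b1 b2. \<zero>\<^bsub>base_module R\<^esub>) (\<Delta> z w b)"
      using D D module_base g \<Delta>b by (rule tensor_lift_cong) (use False in \<open>auto simp: g_eq\<close>)
    ultimately show ?thesis using tensor_lift_zero[OF D D module_base \<Delta>b] by simp
  next
    case True
    then have eq: "z = y" "p = w" by simp_all
    have "\<epsilon>\<^sub>H (inj x y a \<otimes>\<^bsub>H\<^esub> inj z w b \<otimes>\<^bsub>H\<^esub> inj p q c) = (\<epsilon> x y a \<otimes> \<epsilon> p q c) \<otimes> \<epsilon> z w b"
      using X a b c counit_hom_closed unfolding eq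
      by (simp add: mult_inj hprod_closed \<epsilon>_inj counit_hprod m_ac)
    also have "\<dots> = (\<epsilon> x y a \<otimes> \<epsilon> p q c) \<otimes>
        tensor_lift R (A z w) (A z w) (base_module R) (\<lambda>b1 b2. \<epsilon> z w b1 \<otimes> \<epsilon> z w b2) (\<Delta> z w b)"
      using X b by (simp add: counit_counit)
    also have "\<dots> = tensor_lift R (A z w) (A z w) (base_module R)
        (\<lambda>b1 b2. (\<epsilon> x y a \<otimes> \<epsilon> p q c) \<otimes> (\<epsilon> z w b1 \<otimes> \<epsilon> z w b2)) (\<Delta> z w b)"
    proof (rule lin_map_tensor_lift_apply[OF D D module_base module_base _ _ \<Delta>b])
      show "lin_map R (base_module R) (base_module R) (\<lambda>t. (\<epsilon> x y a \<otimes> \<epsilon> p q c) \<otimes> t)"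
        using lin_map_smult_right[OF module_base lin_map_id, of "\<epsilon> x y a \<otimes> \<epsilon> p q c"] by simp
      show "bilin_map R (A z w) (A z w) (base_module R) (\<lambda>b1 b2. \<epsilon> z w b1 \<otimes> \<epsilon> z w b2)"
        using X by (intro bilin_map_base_mult lin_map_counit cring_axioms)
    qed
    also have "\<dots> = tensor_lift R (A z w) (A z w) (base_module R) g (\<Delta> z w b)"
      using D D module_base g \<Delta>b by (rule tensor_lift_cong[symmetric]) (use True in \<open>simp add: g_eq\<close>)
    finally show ?thesis .
  qed
qed

lemma trilin_map_eqI:
  assumes P: "module R P"
    and f: "\<And>k l. \<lbrakk>k \<in> carrier H; l \<in> carrier H\<rbrakk> \<Longrightarrow> lin_map R H P (\<lambda>h. f h k l)"
      "\<And>h l. \<lbrakk>h \<in> carrier H; l \<in> carrier H\<rbrakk> \<Longrightarrow> lin_map R H P (\<lambda>k. f h k l)"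
      "\<And>h k. \<lbrakk>h \<in> carrier H; k \<in> carrier H\<rbrakk> \<Longrightarrow> lin_map R H P (\<lambda>l. f h k l)"
    and g: "\<And>k l. \<lbrakk>k \<in> carrier H; l \<in> carrier H\<rbrakk> \<Longrightarrow> lin_map R H P (\<lambda>h. g h k l)"
      "\<And>h l. \<lbrakk>h \<in> carrier H; l \<in> carrier H\<rbrakk> \<Longrightarrow> lin_map R H P (\<lambda>k. g h k l)"
      "\<And>h k. \<lbrakk>h \<in> carrier H; k \<in> carrier H\<rbrakk> \<Longrightarrow> lin_map R H P (\<lambda>l. g h k l)"
    and eq: "\<And>x y z w p q a b c. \<lbrakk>x \<in> X; y \<in> X; z \<in> X; w \<in> X; p \<in> X; q \<in> X;
      a \<in> carrier (A x y); b \<in> carrier (A z w); c \<in> carrier (A p q)\<rbrakk> \<Longrightarrow>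
      f (inj x y a) (inj z w b) (inj p q c) = g (inj x y a) (inj z w b) (inj p q c)"
    and hkl: "h \<in> carrier H" "k \<in> carrier H" "l \<in> carrier H"
  shows "f h k l = g h k l"
  using P f(1)[OF hkl(2,3)] g(1)[OF hkl(2,3)] _ hkl(1)
proof (rule lin_map_eqI)
  fix x y a assume a: "x \<in> X" "y \<in> X" "a \<in> carrier (A x y)"
  show "f (inj x y a) k l = g (inj x y a) k l"
    using P _ _ _ hkl(2,3)
  proof (rule bilin_map_eqI)
    show "bilin_map R H H P (f (inj x y a))" "bilin_map R H H P (g (inj x y a))"
      using f(2,3) g(2,3) inj_closed[OF a] by (auto intro: bilin_mapI)
  qed (simp add: eq a)
qed

lemma counit_weak1:
  assumes "h \<in> carrier H" "k \<in> carrier H" "l \<in> carrier H"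
  shows "\<epsilon>\<^sub>H (h \<otimes>\<^bsub>H\<^esub> k \<otimes>\<^bsub>H\<^esub> l) = tensor_lift R H H (base_module R)
    (\<lambda>k1 k2. \<epsilon>\<^sub>H (h \<otimes>\<^bsub>H\<^esub> k1) \<otimes> \<epsilon>\<^sub>H (k2 \<otimes>\<^bsub>H\<^esub> l)) (\<Delta>\<^sub>H k)"
proof -
  have b: "bilin_map R H H (base_module R) (\<lambda>k1 k2. \<epsilon>\<^sub>H (h \<otimes>\<^bsub>H\<^esub> k1) \<otimes> \<epsilon>\<^sub>H (k2 \<otimes>\<^bsub>H\<^esub> l))"
    if "h \<in> carrier H" "l \<in> carrier H" for h l
    using that
    by (intro bilin_map_base_mult cring_axioms lin_map_\<epsilon>_comp lin_map_mult_left lin_map_mult_right lin_map_id)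
  have lin1: "lin_map R H (base_module R) (\<lambda>v. f v \<otimes> r)" and lin2: "lin_map R H (base_module R) (\<lambda>v. r \<otimes> f v)"
    if "lin_map R H (base_module R) f" "r \<in> carrier R" for f r
    using lin_map_smult_left[OF module_base that(1)] lin_map_smult_right[OF module_base that(1)] that(2) by simp_all
  show ?thesis
  proof (rule trilin_map_eqI[OF module_base _ _ _ _ _ _ _ assms])
    fix x y z w p q a b c
    assume X: "x \<in> X" "y \<in> X" "z \<in> X" "w \<in> X" "p \<in> X" "q \<in> X"
      and abc: "a \<in> carrier (A x y)" "b \<in> carrier (A z w)" "c \<in> carrier (A p q)"
    note iab = inj_closed[OF X(1,2) abc(1)] inj_closed[OF X(5,6) abc(3)]
    have "tensor_lift R H H (base_module R)
        (\<lambda>k1 k2. \<epsilon>\<^sub>H (inj x y a \<otimes>\<^bsub>H\<^esub> k1) \<otimes> \<epsilon>\<^sub>H (k2 \<otimes>\<^bsub>H\<^esub> inj p q c)) (\<Delta>\<^sub>H (inj z w b)) =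
      tensor_lift R (A z w) (A z w) (base_module R)
        (\<lambda>k1 k2. \<epsilon>\<^sub>H (inj x y a \<otimes>\<^bsub>H\<^esub> inj z w k1) \<otimes> \<epsilon>\<^sub>H (inj z w k2 \<otimes>\<^bsub>H\<^esub> inj p q c)) (\<Delta> z w b)"
      using module_base b[OF iab] X(3,4) abc(2) by (rule tensor_lift_\<Delta>_inj)
    \<comment> \<open>One factor under the lift contributes the condition \<open>y = z\<close> and
      the other \<open>w = p\<close>; commutativity of \<open>R\<close> brings their product into
      the shape required by \<open>g_eq\<close>.\<close>
    also have "\<dots> = \<epsilon>\<^sub>H (inj x y a \<otimes>\<^bsub>H\<^esub> inj z w b \<otimes>\<^bsub>H\<^esub> inj p q c)"
      by (rule counit_product[symmetric, OF X abc bilin_map_comp2[OF lin_map_inj lin_map_inj b[OF iab]]])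
        (use X abc counit_hom_closed in \<open>auto simp: counit_mult_inj m_ac\<close>)
    finally show "\<epsilon>\<^sub>H (inj x y a \<otimes>\<^bsub>H\<^esub> inj z w b \<otimes>\<^bsub>H\<^esub> inj p q c) = tensor_lift R H H (base_module R)
        (\<lambda>k1 k2. \<epsilon>\<^sub>H (inj x y a \<otimes>\<^bsub>H\<^esub> k1) \<otimes> \<epsilon>\<^sub>H (k2 \<otimes>\<^bsub>H\<^esub> inj p q c)) (\<Delta>\<^sub>H (inj z w b))"
      by simp
  qed (intro lin_map_tensor_lift_arg[OF module_H module_H module_base] lin_map_tensor_lift_fun[OF module_H module_H module_base module_H]
      lin_map_closed[OF lin_map_\<Delta>] b lin_map_\<Delta> lin1 lin2 counit_closed mult_closed
      lin_map_\<epsilon>_comp lin_map_mult_left lin_map_mult_right lin_map_id; assumption)+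
qed

lemma counit_weak2:
  assumes "h \<in> carrier H" "k \<in> carrier H" "l \<in> carrier H"
  shows "\<epsilon>\<^sub>H (h \<otimes>\<^bsub>H\<^esub> k \<otimes>\<^bsub>H\<^esub> l) = tensor_lift R H H (base_module R)
    (\<lambda>k1 k2. \<epsilon>\<^sub>H (h \<otimes>\<^bsub>H\<^esub> k2) \<otimes> \<epsilon>\<^sub>H (k1 \<otimes>\<^bsub>H\<^esub> l)) (\<Delta>\<^sub>H k)"
proof -
  have b: "bilin_map R H H (base_module R) (\<lambda>k1 k2. \<epsilon>\<^sub>H (h \<otimes>\<^bsub>H\<^esub> k2) \<otimes> \<epsilon>\<^sub>H (k1 \<otimes>\<^bsub>H\<^esub> l))"
    if "h \<in> carrier H" "l \<in> carrier H" for h l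
    by (rule bilin_map_flip) (use that in \<open>intro bilin_map_base_mult cring_axioms
      lin_map_\<epsilon>_comp lin_map_mult_left lin_map_mult_right lin_map_id\<close>)
  have lin1: "lin_map R H (base_module R) (\<lambda>v. f v \<otimes> r)" and lin2: "lin_map R H (base_module R) (\<lambda>v. r \<otimes> f v)"
    if "lin_map R H (base_module R) f" "r \<in> carrier R" for f r
    using lin_map_smult_left[OF module_base that(1)] lin_map_smult_right[OF module_base that(1)] that(2) by simp_all
  show ?thesis
  proof (rule trilin_map_eqI[OF module_base _ _ _ _ _ _ _ assms])
    fix x y z w p q a b c
    assume X: "x \<in> X" "y \<in> X" "z \<in> X" "w \<in> X" "p \<in> X" "q \<in> X"
      and abc: "a \<in> carrier (A x y)" "b \<in> carrier (A z w)" "c \<in> carrier (A p q)"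
    note iab = inj_closed[OF X(1,2) abc(1)] inj_closed[OF X(5,6) abc(3)]
    have "tensor_lift R H H (base_module R)
        (\<lambda>k1 k2. \<epsilon>\<^sub>H (inj x y a \<otimes>\<^bsub>H\<^esub> k2) \<otimes> \<epsilon>\<^sub>H (k1 \<otimes>\<^bsub>H\<^esub> inj p q c)) (\<Delta>\<^sub>H (inj z w b)) =
      tensor_lift R (A z w) (A z w) (base_module R)
        (\<lambda>k1 k2. \<epsilon>\<^sub>H (inj x y a \<otimes>\<^bsub>H\<^esub> inj z w k2) \<otimes> \<epsilon>\<^sub>H (inj z w k1 \<otimes>\<^bsub>H\<^esub> inj p q c)) (\<Delta> z w b)"
      using module_base b[OF iab] X(3,4) abc(2) by (rule tensor_lift_\<Delta>_inj)
    also have "\<dots> = \<epsilon>\<^sub>H (inj x y a \<otimes>\<^bsub>H\<^esub> inj z w b \<otimes>\<^bsub>H\<^esub> inj p q c)"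
      by (rule counit_product[symmetric, OF X abc bilin_map_comp2[OF lin_map_inj lin_map_inj b[OF iab]]])
        (use X abc counit_hom_closed in \<open>auto simp: counit_mult_inj m_ac\<close>)
    finally show "\<epsilon>\<^sub>H (inj x y a \<otimes>\<^bsub>H\<^esub> inj z w b \<otimes>\<^bsub>H\<^esub> inj p q c) = tensor_lift R H H (base_module R)
        (\<lambda>k1 k2. \<epsilon>\<^sub>H (inj x y a \<otimes>\<^bsub>H\<^esub> k2) \<otimes> \<epsilon>\<^sub>H (k1 \<otimes>\<^bsub>H\<^esub> inj p q c)) (\<Delta>\<^sub>H (inj z w b))"
      by simp
  qed (intro lin_map_tensor_lift_arg[OF module_H module_H module_base] lin_map_tensor_lift_fun[OF module_H module_H module_base module_H]
      lin_map_closed[OF lin_map_\<Delta>] b lin_map_\<Delta> lin1 lin2 counit_closed mult_closed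
      lin_map_\<epsilon>_comp lin_map_mult_left lin_map_mult_right lin_map_id; assumption)+
qed

section \<open>The comultiplication of the unit\<close>

lemma pure_e_closed: "x \<in> X \<Longrightarrow> pure R H H (e x) (e x) \<in> carrier HH"
  by (intro pure_closed module_H e_closed)

lemma comult_one: "\<Delta>\<^sub>H \<one>\<^bsub>H\<^esub> = (\<Oplus>\<^bsub>HH\<^esub> x\<in>X. pure R H H (e x) (e x))"
proof -
  interpret HH: module R HH by (rule module_HH)
  have "\<Delta>\<^sub>H \<one>\<^bsub>H\<^esub> = (\<Oplus>\<^bsub>HH\<^esub> x\<in>X. \<Delta>\<^sub>H (e x))"
    unfolding one_eq using e_closed by (intro lin_map_finsum[OF module_H module_HH lin_map_\<Delta>]) auto
  also have "\<dots> = (\<Oplus>\<^bsub>HH\<^esub> x\<in>X. pure R H H (e x) (e x))"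
  proof (rule HH.finsum_cong')
    show "\<Delta>\<^sub>H (e x) = pure R H H (e x) (e x)" if x: "x \<in> X" for x
      using x by (simp add: \<Delta>_inj unit_closed comult_unit
          tensor_map_pure[OF module_hom[OF x x] module_hom[OF x x] module_H module_H lin_map_inj[OF x x] lin_map_inj[OF x x]])
  qed (use pure_e_closed in auto)
  finally show ?thesis .
qed

text \<open>In each summand of the comultiplication of the unit both legs are the same
  \<open>1\<^sub>x\<close>. This evaluates \<open>(\<Delta> \<otimes> id) (\<Delta>(1))\<close> and
  the right-hand sides of the first two antipode axioms.\<close>

lemma tensor_lift_comult_one:
  assumes "module R P" "bilin_map R H H P f"
  shows "tensor_lift R H H P f (\<Delta>\<^sub>H \<one>\<^bsub>H\<^esub>) = (\<Oplus>\<^bsub>P\<^esub> x\<in>X. f (e x) (e x))"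
proof -
  interpret P: module R P by fact
  have "tensor_lift R H H P f (\<Delta>\<^sub>H \<one>\<^bsub>H\<^esub>) = (\<Oplus>\<^bsub>P\<^esub> x\<in>X. tensor_lift R H H P f (pure R H H (e x) (e x)))"
    unfolding comult_one using pure_e_closed
    by (intro lin_map_finsum[OF module_HH assms(1) lin_map_tensor_lift[OF module_H module_H assms]]) auto
  also have "\<dots> = (\<Oplus>\<^bsub>P\<^esub> x\<in>X. f (e x) (e x))"
    using assms e_closed bilin_map_closed[OF assms(2)]
    by (intro P.finsum_cong') (auto simp: tensor_lift_pure[OF module_H module_H])
  finally show ?thesis .
qed

lemma e_mult_e: "\<lbrakk>x \<in> X; y \<in> X\<rbrakk> \<Longrightarrow> e x \<otimes>\<^bsub>H\<^esub> e y = (if x = y then e y else \<zero>\<^bsub>H\<^esub>)"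
  by (simp add: e_mult_inj unit_closed)

text \<open>Both products expand into double sums over \<open>x\<close> and \<open>y\<close> whose
  middle tensor factor is \<open>1\<^sub>x 1\<^sub>y\<close>. Orthogonality leaves the diagonal
  terms \<open>1\<^sub>x \<otimes> 1\<^sub>x \<otimes> 1\<^sub>x\<close>, in either order of
  multiplication.\<close>

lemma comult_one12:
  shows "tensor_map R H H HH H \<Delta>\<^sub>H (\<lambda>x. x) (\<Delta>\<^sub>H \<one>\<^bsub>H\<^esub>) =
      pure R HH H (\<Delta>\<^sub>H \<one>\<^bsub>H\<^esub>) \<one>\<^bsub>H\<^esub> \<otimes>\<^bsub>tensor_algebra R (tensor_algebra R H H) H\<^esub>
      tensor_assoc R H H H (pure R H HH \<one>\<^bsub>H\<^esub> (\<Delta>\<^sub>H \<one>\<^bsub>H\<^esub>))" (is "?d = ?l \<otimes>\<^bsub>?A3\<^esub> ?r")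
    and "tensor_map R H H HH H \<Delta>\<^sub>H (\<lambda>x. x) (\<Delta>\<^sub>H \<one>\<^bsub>H\<^esub>) =
      tensor_assoc R H H H (pure R H HH \<one>\<^bsub>H\<^esub> (\<Delta>\<^sub>H \<one>\<^bsub>H\<^esub>))
      \<otimes>\<^bsub>tensor_algebra R (tensor_algebra R H H) H\<^esub> pure R HH H (\<Delta>\<^sub>H \<one>\<^bsub>H\<^esub>) \<one>\<^bsub>H\<^esub>"
proof -
  let ?A = "tensor_algebra R H H"
  let ?T = "tensor R HH H"
  interpret T: module R ?T by (rule module_HHH)
  interpret HH: module R HH by (rule module_HH)
  \<comment> \<open>The axiom multiplies in a tensor algebra over \<open>?A\<close>, while its
    factors are built over \<open>HH\<close>. These records differ only in product and unit, so the
    two triple tensor products coincide.\<close>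
  have A: "module R ?A" using module_HH by (rule module_eqI) simp_all
  have T_eq: "tensor R ?A H = ?T" "pure R ?A H = pure R HH H"
    by (intro tensor_eqI; simp)+
  have A_mult: "bilin_map R ?A ?A ?A (mult ?A)"
    using bilin_map_HH_mult unfolding bilin_map_def lin_map_def by simp
  have T_mult: "bilin_map R ?T ?T ?T (mult ?A3)"
    using bilin_map_tensor_mult(1)[OF A module_H A_mult bilin_map_mult] by (simp add: T_eq)
  have T_mult_pure: "pure R HH H s x \<otimes>\<^bsub>?A3\<^esub> pure R HH H t y = pure R HH H (s \<otimes>\<^bsub>?A\<^esub> t) (x \<otimes>\<^bsub>H\<^esub> y)"
    if "s \<in> carrier HH" "t \<in> carrier HH" "x \<in> carrier H" "y \<in> carrier H" for s t x y
    using tensor_mult_pure[OF A module_H A_mult bilin_map_mult, of s x t y] that by (simp add: T_eq)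
  note A_mult_pure = tensor_mult_pure[OF module_H module_H bilin_map_mult bilin_map_mult]
  \<comment> \<open>\<open>L\<close> and \<open>Q\<close> are the summands of
    \<open>\<Delta>(1) \<otimes> 1\<close> and \<open>1 \<otimes> \<Delta>(1)\<close>, and
    \<open>D\<close> those of \<open>(\<Delta> \<otimes> id) (\<Delta>(1))\<close>.\<close>
  define L where "L x = pure R HH H (pure R H H (e x) (e x)) \<one>\<^bsub>H\<^esub>" for x
  define Q where "Q x = pure R HH H (pure R H H \<one>\<^bsub>H\<^esub> (e x)) (e x)" for x
  define D where "D x = pure R HH H (pure R H H (e x) (e x)) (e x)" for x
  have closed: "L x \<in> carrier ?T" "Q x \<in> carrier ?T" "D x \<in> carrier ?T" if "x \<in> X" for x
    unfolding L_def Q_def D_def using that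
    by (intro pure_closed module_HH module_H e_closed one_closed; assumption)+
  have l: "?l = (\<Oplus>\<^bsub>?T\<^esub> x\<in>X. L x)"
    unfolding comult_one L_def using pure_e_closed
    by (intro lin_map_finsum[OF module_HH module_HHH lin_map_pure_left[OF module_HH module_H lin_map_id one_closed]]) auto
  have "?r = (\<Oplus>\<^bsub>?T\<^esub> x\<in>X. tensor_assoc R H H H (pure R H HH \<one>\<^bsub>H\<^esub> (pure R H H (e x) (e x))))"
    unfolding comult_one using pure_e_closed
    by (intro lin_map_finsum[OF module_HH module_HHH lin_map_comp[OF lin_map_tensor_assoc[OF module_H module_H module_H]
          lin_map_pure_right[OF module_H module_HH lin_map_id one_closed]]]) auto
  also have "\<dots> = (\<Oplus>\<^bsub>?T\<^esub> x\<in>X. Q x)"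
    using closed by (intro T.finsum_cong') (auto simp: Q_def tensor_assoc_pure module_H one_closed e_closed)
  finally have r: "?r = (\<Oplus>\<^bsub>?T\<^esub> x\<in>X. Q x)" .
  have d: "?d = (\<Oplus>\<^bsub>?T\<^esub> x\<in>X. D x)"
  proof -
    have "?d = (\<Oplus>\<^bsub>?T\<^esub> x\<in>X. pure R HH H (\<Delta>\<^sub>H (e x)) (e x))"
      unfolding tensor_map_def
      by (intro tensor_lift_comult_one module_HHH bilin_map_pure_comp module_H module_HH lin_map_\<Delta> lin_map_id)
    also have "\<dots> = (\<Oplus>\<^bsub>?T\<^esub> x\<in>X. D x)"
    proof (rule T.finsum_cong')
      fix x assume x: "x \<in> X"
      then show "pure R HH H (\<Delta>\<^sub>H (e x)) (e x) = D x"
        by (simp add: D_def \<Delta>_inj unit_closed comult_unit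
          tensor_map_pure[OF module_hom[OF x x] module_hom[OF x x] module_H module_H lin_map_inj[OF x x] lin_map_inj[OF x x]])
    qed (use closed in auto)
    finally show ?thesis .
  qed
  \<comment> \<open>Kept general in \<open>F\<close> and \<open>G\<close> because \<open>L\<close>
    and \<open>Q\<close> satisfy the orthogonality condition in both orders.\<close>
  have sum_mult: "(\<Oplus>\<^bsub>?T\<^esub> x\<in>X. F x) \<otimes>\<^bsub>?A3\<^esub> (\<Oplus>\<^bsub>?T\<^esub> y\<in>X. G y) = (\<Oplus>\<^bsub>?T\<^esub> x\<in>X. D x)"
    if F: "\<And>x. x \<in> X \<Longrightarrow> F x \<in> carrier ?T" and G: "\<And>x. x \<in> X \<Longrightarrow> G x \<in> carrier ?T"
      and FG: "\<And>x y. \<lbrakk>x \<in> X; y \<in> X\<rbrakk> \<Longrightarrow> F x \<otimes>\<^bsub>?A3\<^esub> G y = (if y = x then D x else \<zero>\<^bsub>?T\<^esub>)" for F G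
  proof -
    have sG: "(\<Oplus>\<^bsub>?T\<^esub> y\<in>X. G y) \<in> carrier ?T" using G by (intro T.finsum_closed) auto
    have "(\<Oplus>\<^bsub>?T\<^esub> x\<in>X. F x) \<otimes>\<^bsub>?A3\<^esub> (\<Oplus>\<^bsub>?T\<^esub> y\<in>X. G y) =
        (\<Oplus>\<^bsub>?T\<^esub> x\<in>X. F x \<otimes>\<^bsub>?A3\<^esub> (\<Oplus>\<^bsub>?T\<^esub> y\<in>X. G y))"
      using F by (intro lin_map_finsum[OF module_HHH module_HHH bilin_map_left[OF T_mult sG]]) auto
    also have "\<dots> = (\<Oplus>\<^bsub>?T\<^esub> x\<in>X. D x)"
    proof (rule T.finsum_cong')
      fix x assume x: "x \<in> X"
      have "F x \<otimes>\<^bsub>?A3\<^esub> (\<Oplus>\<^bsub>?T\<^esub> y\<in>X. G y) = (\<Oplus>\<^bsub>?T\<^esub> y\<in>X. F x \<otimes>\<^bsub>?A3\<^esub> G y)"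
        using G by (intro lin_map_finsum[OF module_HHH module_HHH bilin_map_right[OF T_mult F[OF x]]]) auto
      also have "\<dots> = (\<Oplus>\<^bsub>?T\<^esub> y\<in>X. if y = x then D x else \<zero>\<^bsub>?T\<^esub>)"
        using x closed by (intro T.finsum_cong') (auto simp: FG)
      also have "\<dots> = D x" using x closed by (intro finsum_delta module_HHH)
      finally show "F x \<otimes>\<^bsub>?A3\<^esub> (\<Oplus>\<^bsub>?T\<^esub> y\<in>X. G y) = D x" .
    qed (use closed in auto)
    finally show ?thesis .
  qed
  have zero: "pure R HH H (pure R H H x \<zero>\<^bsub>H\<^esub>) y = \<zero>\<^bsub>?T\<^esub>" "pure R HH H (pure R H H x y) \<zero>\<^bsub>H\<^esub> = \<zero>\<^bsub>?T\<^esub>"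
    if "x \<in> carrier H" "y \<in> carrier H" for x y
  proof -
    show "pure R HH H (pure R H H x \<zero>\<^bsub>H\<^esub>) y = \<zero>\<^bsub>?T\<^esub>"
      using that by (intro lin_map_zero[OF module_H module_HHH] lin_map_pure_left lin_map_pure_right module_H module_HH lin_map_id)
    show "pure R HH H (pure R H H x y) \<zero>\<^bsub>H\<^esub> = \<zero>\<^bsub>?T\<^esub>"
      using that by (intro lin_map_zero[OF module_H module_HHH] lin_map_pure_right module_H module_HH lin_map_id pure_closed)
  qed
  have LQ: "L x \<otimes>\<^bsub>?A3\<^esub> Q y = (if y = x then D x else \<zero>\<^bsub>?T\<^esub>)"
    and QL: "Q x \<otimes>\<^bsub>?A3\<^esub> L y = (if y = x then D x else \<zero>\<^bsub>?T\<^esub>)" if "x \<in> X" "y \<in> X" for x y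
    unfolding L_def Q_def D_def using that
    by (simp_all add: T_mult_pure A_mult_pure pure_closed module_H e_closed one_closed one_mult mult_one
        e_mult_e zero)
  show "?d = ?l \<otimes>\<^bsub>?A3\<^esub> ?r" unfolding d l r using closed LQ by (intro sum_mult[symmetric])
  show "?d = ?r \<otimes>\<^bsub>?A3\<^esub> ?l" unfolding d l r using closed QL by (intro sum_mult[symmetric])
qed

section \<open>The antipode axioms\<close>

lemma bilin_map_antipode_right: "bilin_map R H H H (\<lambda>x y. x \<otimes>\<^bsub>H\<^esub> S\<^sub>H y)"
  by (rule bilin_map_comp2[OF lin_map_id lin_map_S bilin_map_mult])

lemma bilin_map_antipode_left: "bilin_map R H H H (\<lambda>x y. S\<^sub>H x \<otimes>\<^bsub>H\<^esub> y)"
  by (rule bilin_map_comp2[OF lin_map_S lin_map_id bilin_map_mult])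

lemma S_hom_closed: "\<lbrakk>x \<in> X; y \<in> X; a \<in> carrier (A x y)\<rbrakk> \<Longrightarrow> S x y a \<in> carrier (A y x)"
  by (rule lin_map_closed[OF antipode_linear])

text \<open>The legs lie in \<open>A x y\<close> and their antipodes in \<open>A y x\<close>, so all
  products that occur are composable and the antipode law of the category applies under
  \<open>inj x x\<close>.\<close>

lemma antipode_right_inj:
  assumes a: "x \<in> X" "y \<in> X" "a \<in> carrier (A x y)"
  shows "tensor_lift R H H H (\<lambda>h1 h2. h1 \<otimes>\<^bsub>H\<^esub> S\<^sub>H h2) (\<Delta>\<^sub>H (inj x y a)) = \<epsilon> x y a \<odot>\<^bsub>H\<^esub> e x"
proof -
  note C = module_hom[OF a(1,2)] and B = module_hom[OF a(1,1)]
  note i = lin_map_inj[OF a(1,2)]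
  have b: "bilin_map R (A x y) (A x y) (A x x) (\<lambda>h1 h2. hprod R A m x y x h1 (S x y h2))"
    using a by (intro bilin_map_comp2[OF lin_map_id antipode_linear bilin_map_hprod])
  have "tensor_lift R H H H (\<lambda>h1 h2. h1 \<otimes>\<^bsub>H\<^esub> S\<^sub>H h2) (\<Delta>\<^sub>H (inj x y a)) =
      tensor_lift R (A x y) (A x y) H (\<lambda>h1 h2. inj x y h1 \<otimes>\<^bsub>H\<^esub> S\<^sub>H (inj x y h2)) (\<Delta> x y a)"
    using module_H bilin_map_antipode_right a by (rule tensor_lift_\<Delta>_inj)
  also have "\<dots> = tensor_lift R (A x y) (A x y) H (\<lambda>h1 h2. inj x x (hprod R A m x y x h1 (S x y h2))) (\<Delta> x y a)"
    using C C module_H bilin_map_comp2[OF i i bilin_map_antipode_right] comult_closed[OF a]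
    by (rule tensor_lift_cong) (use a in \<open>simp add: S_inj mult_inj S_hom_closed\<close>)
  also have "\<dots> = inj x x (tensor_lift R (A x y) (A x y) (A x x) (\<lambda>h1 h2. hprod R A m x y x h1 (S x y h2)) (\<Delta> x y a))"
    using C C B module_H lin_map_inj[OF a(1,1)] b comult_closed[OF a]
    by (rule lin_map_tensor_lift_apply[symmetric])
  also have "\<dots> = \<epsilon> x y a \<odot>\<^bsub>H\<^esub> e x"
    using a by (simp add: antipode_right lin_map_smult[OF lin_map_inj] counit_hom_closed unit_closed)
  finally show ?thesis .
qed

text \<open>With the antipode on the first leg the products run from \<open>y\<close> to
  \<open>x\<close> and back, so they lie in \<open>A y y\<close> and the unit at the target
  \<open>y\<close> appears.\<close>

lemma antipode_left_inj:
  assumes a: "x \<in> X" "y \<in> X" "a \<in> carrier (A x y)"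
  shows "tensor_lift R H H H (\<lambda>h1 h2. S\<^sub>H h1 \<otimes>\<^bsub>H\<^esub> h2) (\<Delta>\<^sub>H (inj x y a)) = \<epsilon> x y a \<odot>\<^bsub>H\<^esub> e y"
proof -
  note C = module_hom[OF a(1,2)] and B = module_hom[OF a(2,2)]
  note i = lin_map_inj[OF a(1,2)]
  have b: "bilin_map R (A x y) (A x y) (A y y) (\<lambda>h1 h2. hprod R A m y x y (S x y h1) h2)"
    using a by (intro bilin_map_comp2[OF antipode_linear lin_map_id bilin_map_hprod])
  have "tensor_lift R H H H (\<lambda>h1 h2. S\<^sub>H h1 \<otimes>\<^bsub>H\<^esub> h2) (\<Delta>\<^sub>H (inj x y a)) =
      tensor_lift R (A x y) (A x y) H (\<lambda>h1 h2. S\<^sub>H (inj x y h1) \<otimes>\<^bsub>H\<^esub> inj x y h2) (\<Delta> x y a)"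
    using module_H bilin_map_antipode_left a by (rule tensor_lift_\<Delta>_inj)
  also have "\<dots> = tensor_lift R (A x y) (A x y) H (\<lambda>h1 h2. inj y y (hprod R A m y x y (S x y h1) h2)) (\<Delta> x y a)"
    using C C module_H bilin_map_comp2[OF i i bilin_map_antipode_left] comult_closed[OF a]
    by (rule tensor_lift_cong) (use a in \<open>simp add: S_inj mult_inj S_hom_closed\<close>)
  also have "\<dots> = inj y y (tensor_lift R (A x y) (A x y) (A y y) (\<lambda>h1 h2. hprod R A m y x y (S x y h1) h2) (\<Delta> x y a))"
    using C C B module_H lin_map_inj[OF a(2,2)] b comult_closed[OF a]
    by (rule lin_map_tensor_lift_apply[symmetric])
  also have "\<dots> = \<epsilon> x y a \<odot>\<^bsub>H\<^esub> e y"
    using a by (simp add: antipode_left lin_map_smult[OF lin_map_inj] counit_hom_closed unit_closed)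
  finally show ?thesis .
qed

lemma antipode_right_H:
  assumes "h \<in> carrier H"
  shows "tensor_lift R H H H (\<lambda>h1 h2. h1 \<otimes>\<^bsub>H\<^esub> S\<^sub>H h2) (\<Delta>\<^sub>H h) =
    tensor_lift R H H H (\<lambda>e1 e2. \<epsilon>\<^sub>H (e1 \<otimes>\<^bsub>H\<^esub> h) \<odot>\<^bsub>H\<^esub> e2) (\<Delta>\<^sub>H \<one>\<^bsub>H\<^esub>)"
proof -
  have one: "tensor_lift R H H H (\<lambda>e1 e2. \<epsilon>\<^sub>H (e1 \<otimes>\<^bsub>H\<^esub> h) \<odot>\<^bsub>H\<^esub> e2) (\<Delta>\<^sub>H \<one>\<^bsub>H\<^esub>) =
      (\<Oplus>\<^bsub>H\<^esub> z\<in>X. \<epsilon>\<^sub>H (e z \<otimes>\<^bsub>H\<^esub> h) \<odot>\<^bsub>H\<^esub> e z)" if "h \<in> carrier H" for h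
    using that by (intro tensor_lift_comult_one bilin_map_smult module_H lin_map_\<epsilon>_comp lin_map_mult_left lin_map_id)
  \<comment> \<open>Replacing the lift over the comultiplication of the unit by an explicit sum
    makes its linearity in \<open>h\<close> directly visible.\<close>
  have lin: "lin_map R H H (\<lambda>h. \<Oplus>\<^bsub>H\<^esub> z\<in>X. \<epsilon>\<^sub>H (e z \<otimes>\<^bsub>H\<^esub> h) \<odot>\<^bsub>H\<^esub> e z)"
    by (intro lin_map_finsum_fun lin_map_smult_left module_H lin_map_\<epsilon>_comp lin_map_mult_right lin_map_id e_closed)
  show ?thesis unfolding one[OF assms]
    using module_H lin_map_tensor_lift_arg[OF module_H module_H module_H lin_map_\<Delta> bilin_map_antipode_right] lin _ assms
  proof (rule lin_map_eqI)
    fix x y a assume a: "x \<in> X" "y \<in> X" "a \<in> carrier (A x y)"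
    have "(\<Oplus>\<^bsub>H\<^esub> z\<in>X. \<epsilon>\<^sub>H (e z \<otimes>\<^bsub>H\<^esub> inj x y a) \<odot>\<^bsub>H\<^esub> e z) =
        (\<Oplus>\<^bsub>H\<^esub> z\<in>X. if z = x then \<epsilon> x y a \<odot>\<^bsub>H\<^esub> e x else \<zero>\<^bsub>H\<^esub>)"
      using a e_closed counit_hom_closed
      by (intro H.finsum_cong') (auto simp: counit_mult_inj unit_closed counit_unit)
    also have "\<dots> = \<epsilon> x y a \<odot>\<^bsub>H\<^esub> e x"
      using a e_closed counit_hom_closed by (intro finsum_delta module_H) auto
    finally show "tensor_lift R H H H (\<lambda>h1 h2. h1 \<otimes>\<^bsub>H\<^esub> S\<^sub>H h2) (\<Delta>\<^sub>H (inj x y a)) =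
        (\<Oplus>\<^bsub>H\<^esub> z\<in>X. \<epsilon>\<^sub>H (e z \<otimes>\<^bsub>H\<^esub> inj x y a) \<odot>\<^bsub>H\<^esub> e z)"
      using antipode_right_inj[OF a] by simp
  qed
qed

lemma antipode_left_H:
  assumes "h \<in> carrier H"
  shows "tensor_lift R H H H (\<lambda>h1 h2. S\<^sub>H h1 \<otimes>\<^bsub>H\<^esub> h2) (\<Delta>\<^sub>H h) =
    tensor_lift R H H H (\<lambda>e1 e2. \<epsilon>\<^sub>H (h \<otimes>\<^bsub>H\<^esub> e2) \<odot>\<^bsub>H\<^esub> e1) (\<Delta>\<^sub>H \<one>\<^bsub>H\<^esub>)"
proof -
  have one: "tensor_lift R H H H (\<lambda>e1 e2. \<epsilon>\<^sub>H (h \<otimes>\<^bsub>H\<^esub> e2) \<odot>\<^bsub>H\<^esub> e1) (\<Delta>\<^sub>H \<one>\<^bsub>H\<^esub>) =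
      (\<Oplus>\<^bsub>H\<^esub> z\<in>X. \<epsilon>\<^sub>H (h \<otimes>\<^bsub>H\<^esub> e z) \<odot>\<^bsub>H\<^esub> e z)" if "h \<in> carrier H" for h
    by (rule tensor_lift_comult_one[OF module_H bilin_map_flip])
      (use that in \<open>intro bilin_map_smult module_H lin_map_\<epsilon>_comp lin_map_mult_right lin_map_id\<close>)
  have lin: "lin_map R H H (\<lambda>h. \<Oplus>\<^bsub>H\<^esub> z\<in>X. \<epsilon>\<^sub>H (h \<otimes>\<^bsub>H\<^esub> e z) \<odot>\<^bsub>H\<^esub> e z)"
    by (intro lin_map_finsum_fun lin_map_smult_left module_H lin_map_\<epsilon>_comp lin_map_mult_left lin_map_id e_closed)
  show ?thesis unfolding one[OF assms]
    using module_H lin_map_tensor_lift_arg[OF module_H module_H module_H lin_map_\<Delta> bilin_map_antipode_left] lin _ assms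
  proof (rule lin_map_eqI)
    fix x y a assume a: "x \<in> X" "y \<in> X" "a \<in> carrier (A x y)"
    \<comment> \<open>Here \<open>1\<^sub>z\<close> multiplies from the right, which selects the
      target \<open>y\<close> of \<open>a\<close>; the coefficient is \<open>\<epsilon>(a)\<close>
      because \<open>\<epsilon>(1\<^sub>y) = 1\<close>.\<close>
    have "(\<Oplus>\<^bsub>H\<^esub> z\<in>X. \<epsilon>\<^sub>H (inj x y a \<otimes>\<^bsub>H\<^esub> e z) \<odot>\<^bsub>H\<^esub> e z) =
        (\<Oplus>\<^bsub>H\<^esub> z\<in>X. if z = y then \<epsilon> x y a \<odot>\<^bsub>H\<^esub> e y else \<zero>\<^bsub>H\<^esub>)"
      using a e_closed counit_hom_closed
      by (intro H.finsum_cong') (auto simp: counit_mult_inj unit_closed counit_unit)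
    also have "\<dots> = \<epsilon> x y a \<odot>\<^bsub>H\<^esub> e y"
      using a e_closed counit_hom_closed by (intro finsum_delta module_H) auto
    finally show "tensor_lift R H H H (\<lambda>h1 h2. S\<^sub>H h1 \<otimes>\<^bsub>H\<^esub> h2) (\<Delta>\<^sub>H (inj x y a)) =
        (\<Oplus>\<^bsub>H\<^esub> z\<in>X. \<epsilon>\<^sub>H (inj x y a \<otimes>\<^bsub>H\<^esub> e z) \<odot>\<^bsub>H\<^esub> e z)"
      using antipode_left_inj[OF a] by simp
  qed
qed

text \<open>On \<open>A x y\<close> the computation is \<open>S(h\<^sub>1) h\<^sub>2 S(h\<^sub>3) =
  \<epsilon>(h\<^sub>1) 1\<^sub>y S(h\<^sub>2) = S(\<epsilon>(h\<^sub>1) h\<^sub>2) = S(h)\<close>.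
  It uses the left antipode law on the first two legs, absorbs \<open>1\<^sub>y\<close> because
  \<open>S(h\<^sub>2)\<close> lies in \<open>A y x\<close>, and ends with the counit law.\<close>

lemma antipode_sandwich_H:
  assumes h: "h \<in> carrier H"
  shows "tensor_lift R HH H H
      (\<lambda>t h3. tensor_lift R H H H (\<lambda>h1 h2. S\<^sub>H h1 \<otimes>\<^bsub>H\<^esub> h2 \<otimes>\<^bsub>H\<^esub> S\<^sub>H h3) t)
      (tensor_map R H H HH H \<Delta>\<^sub>H (\<lambda>x. x) (\<Delta>\<^sub>H h)) = S\<^sub>H h"
proof -
  let ?f = "\<lambda>h1 h2 h3. S\<^sub>H h1 \<otimes>\<^bsub>H\<^esub> h2 \<otimes>\<^bsub>H\<^esub> S\<^sub>H h3"
  let ?F = "\<lambda>t h3. tensor_lift R H H H (\<lambda>h1 h2. ?f h1 h2 h3) t"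
  have f: "bilin_map R H H H (\<lambda>h1 h2. ?f h1 h2 h3)" if "h3 \<in> carrier H" for h3
    using that lin_map_closed[OF lin_map_S]
    by (intro bilin_map_comp_lin[OF _ bilin_map_antipode_left] lin_map_mult_left lin_map_id)
  have F: "bilin_map R HH H H ?F"
    by (rule bilin_map_flip, rule bilin_map_tensor_lift)
      (auto intro!: module_H f lin_map_mult_right lin_map_S mult_closed lin_map_closed[OF lin_map_S])
  \<comment> \<open>Of the three legs, the first two are regrouped as the comultiplication of the
    first leg \<open>x\<close> of \<open>h\<close>, where the left antipode law can act.\<close>
  have eq: "tensor_lift R HH H H ?F (tensor_map R H H HH H \<Delta>\<^sub>H (\<lambda>x. x) (\<Delta>\<^sub>H h)) =
      tensor_lift R H H H (\<lambda>x y. ?F (\<Delta>\<^sub>H x) y) (\<Delta>\<^sub>H h)"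
    using module_H module_H module_HH module_H module_H lin_map_\<Delta> lin_map_id F lin_map_closed[OF lin_map_\<Delta> h]
    by (rule tensor_lift_tensor_map)
  have G: "bilin_map R H H H (\<lambda>x y. ?F (\<Delta>\<^sub>H x) y)"
    using lin_map_\<Delta> lin_map_id F by (rule bilin_map_comp2)
  \<comment> \<open>Right multiplication by \<open>S\<^sub>H c\<close> is linear and leaves the
    lift; what remains inside is the left antipode law.\<close>
  have F_\<Delta>: "?F (\<Delta>\<^sub>H (inj x y b)) c = \<epsilon> x y b \<odot>\<^bsub>H\<^esub> e y \<otimes>\<^bsub>H\<^esub> S\<^sub>H c"
    if b: "x \<in> X" "y \<in> X" "b \<in> carrier (A x y)" and c: "c \<in> carrier H" for x y b c
  proof -
    have "?F (\<Delta>\<^sub>H (inj x y b)) c = tensor_lift R H H H (\<lambda>h1 h2. S\<^sub>H h1 \<otimes>\<^bsub>H\<^esub> h2) (\<Delta>\<^sub>H (inj x y b)) \<otimes>\<^bsub>H\<^esub> S\<^sub>H c"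
      by (rule lin_map_tensor_lift_apply[OF module_H module_H module_H module_H
            bilin_map_left[OF bilin_map_mult lin_map_closed[OF lin_map_S c]] bilin_map_antipode_left
            lin_map_closed[OF lin_map_\<Delta> inj_closed[OF b]], symmetric])
    then show ?thesis using antipode_left_inj[OF b] by simp
  qed
  show ?thesis unfolding eq
    using module_H lin_map_tensor_lift_arg[OF module_H module_H module_H lin_map_\<Delta> G] lin_map_S _ h
  proof (rule lin_map_eqI)
    fix x y a assume a: "x \<in> X" "y \<in> X" "a \<in> carrier (A x y)"
    interpret C: coalgebra R "A x y" "\<Delta> x y" "\<epsilon> x y" using a by (intro hom_coalgebra)
    note C = C.module_axioms
    note i = lin_map_inj[OF a(1,2)]
    have Si: "lin_map R (A x y) H (\<lambda>b. inj y x (S x y b))"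
      using a by (intro lin_map_comp[OF lin_map_inj antipode_linear])
    have b: "bilin_map R (A x y) (A x y) (A x y) (\<lambda>b c. \<epsilon> x y b \<odot>\<^bsub>A x y\<^esub> c)"
      by (intro bilin_map_smult C C.counit_linear lin_map_id)
    have "tensor_lift R H H H (\<lambda>x y. ?F (\<Delta>\<^sub>H x) y) (\<Delta>\<^sub>H (inj x y a)) =
        tensor_lift R (A x y) (A x y) H (\<lambda>b c. ?F (\<Delta>\<^sub>H (inj x y b)) (inj x y c)) (\<Delta> x y a)"
      using module_H G a by (rule tensor_lift_\<Delta>_inj)
    also have "\<dots> = tensor_lift R (A x y) (A x y) H (\<lambda>b c. inj y x (S x y (\<epsilon> x y b \<odot>\<^bsub>A x y\<^esub> c))) (\<Delta> x y a)"
      using C C module_H bilin_map_comp2[OF i i G] comult_closed[OF a]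
    proof (rule tensor_lift_cong)
      fix b c assume b: "b \<in> carrier (A x y)" and c: "c \<in> carrier (A x y)"
      have Sc: "S x y c \<in> carrier (A y x)" using a(1,2) c by (rule S_hom_closed)
      have "?F (\<Delta>\<^sub>H (inj x y b)) (inj x y c) = \<epsilon> x y b \<odot>\<^bsub>H\<^esub> e y \<otimes>\<^bsub>H\<^esub> inj y x (S x y c)"
        using F_\<Delta>[OF a(1,2) b inj_closed[OF a(1,2) c]] a c by (simp add: S_inj)
      also have "\<dots> = \<epsilon> x y b \<odot>\<^bsub>H\<^esub> inj y x (S x y c)"
        using a b Sc lin_map_smult[OF bilin_map_left[OF bilin_map_mult]]
        by (simp add: counit_hom_closed e_closed inj_closed e_mult_inj)
      also have "\<dots> = inj y x (S x y (\<epsilon> x y b \<odot>\<^bsub>A x y\<^esub> c))"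
        using a b c by (simp add: lin_map_smult[OF Si] counit_hom_closed)
      finally show "?F (\<Delta>\<^sub>H (inj x y b)) (inj x y c) = inj y x (S x y (\<epsilon> x y b \<odot>\<^bsub>A x y\<^esub> c))" .
    qed
    also have "\<dots> = inj y x (S x y (tensor_lift R (A x y) (A x y) (A x y) (\<lambda>b c. \<epsilon> x y b \<odot>\<^bsub>A x y\<^esub> c) (\<Delta> x y a)))"
      using C C C module_H Si b comult_closed[OF a] by (rule lin_map_tensor_lift_apply[symmetric])
    also have "\<dots> = S\<^sub>H (inj x y a)"
      using a by (simp add: C.counit_left S_inj)
    finally show "tensor_lift R H H H (\<lambda>x y. ?F (\<Delta>\<^sub>H x) y) (\<Delta>\<^sub>H (inj x y a)) = S\<^sub>H (inj x y a)" .
  qed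
qed

theorem weak_hopf_algebra_H: "weak_hopf_algebra R H \<Delta>\<^sub>H \<epsilon>\<^sub>H S\<^sub>H"
  by (intro weak_hopf_algebra.intro weak_hopf_algebra_axioms.intro assoc_algebra_H coalgebra_H
      comult_mult counit_weak1 counit_weak2 comult_one12 lin_map_S antipode_right_H antipode_left_H
      antipode_sandwich_H)

end

section \<open>The direct sum\<close>

lemma hsum_algebra_simps [simp]:
  "carrier (hsum_algebra R X A m u) = carrier (hsum_module X A)"
  "add (hsum_algebra R X A m u) = add (hsum_module X A)"
  "zero (hsum_algebra R X A m u) = zero (hsum_module X A)"
  "smult (hsum_algebra R X A m u) = smult (hsum_module X A)"
  by (simp_all add: hsum_algebra_def Let_def)

context hopf_category
begin

abbreviation "D \<equiv> hsum_module X A"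
abbreviation "i \<equiv> hsum_inj X A"

lemma module_hsum: "module R D"
  unfolding hsum_module_def by (intro module_direct_sum cring_axioms) (auto intro: module_hom)

lemma lin_map_hsum_inj: "\<lbrakk>x \<in> X; y \<in> X\<rbrakk> \<Longrightarrow> lin_map R (A x y) D (i x y)"
  using lin_map_inj_sum[of "X \<times> X" R "\<lambda>(x, y). A x y" "(x, y)"] module_hom
  by (auto simp: hsum_module_def hsum_inj_def)

lemma lin_map_hsum_proj: "\<lbrakk>x \<in> X; y \<in> X\<rbrakk> \<Longrightarrow> lin_map R D (A x y) (\<lambda>f. f (x, y))"
  using lin_map_direct_sum_proj[of "(x, y)" "X \<times> X" R "\<lambda>(x, y). A x y"] by (simp add: hsum_module_def)

lemma hsum_inj_apply:
  "\<lbrakk>x \<in> X; y \<in> X\<rbrakk> \<Longrightarrow> i p q a (x, y) = (if x = p \<and> y = q then a else \<zero>\<^bsub>A x y\<^esub>)"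
  by (simp add: hsum_inj_def inj_sum_def)

lemma lin_map_hsum_finsum:
  assumes "module R P" "\<And>x y. \<lbrakk>x \<in> X; y \<in> X\<rbrakk> \<Longrightarrow> lin_map R (A x y) P (F x y)"
  shows "lin_map R D P (\<lambda>f. \<Oplus>\<^bsub>P\<^esub> x\<in>X. \<Oplus>\<^bsub>P\<^esub> y\<in>X. F x y (f (x, y)))"
  using assms by (intro lin_map_finsum_fun lin_map_comp[OF assms(2) lin_map_hsum_proj])

text \<open>All coordinates of an injected element other than the one at \<open>(p, q)\<close> are
  zero, and linear maps kill them. The comultiplication, the counit, the antipode and, in each
  argument separately, the product are evaluated on homogeneous elements in this way.\<close>

lemma finsum_hsum_inj:
  assumes P: "module R P" and F: "\<And>x y. \<lbrakk>x \<in> X; y \<in> X\<rbrakk> \<Longrightarrow> lin_map R (A x y) P (F x y)"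
    and X: "finite X" and pq: "p \<in> X" "q \<in> X" and a: "a \<in> carrier (A p q)"
  shows "(\<Oplus>\<^bsub>P\<^esub> x\<in>X. \<Oplus>\<^bsub>P\<^esub> y\<in>X. F x y (i p q a (x, y))) = F p q a"
proof -
  interpret P: module R P by fact
  have c: "F p q a \<in> carrier P" by (rule lin_map_closed[OF F[OF pq] a])
  have delta: "(\<Oplus>\<^bsub>P\<^esub> x\<in>X. if x = z then F p q a else \<zero>\<^bsub>P\<^esub>) = F p q a" if "z \<in> X" for z
    using P.add.finprod_singleton_swap[OF that X, of "\<lambda>_. F p q a"] c by simp
  have "(\<Oplus>\<^bsub>P\<^esub> y\<in>X. F x y (i p q a (x, y))) = (if x = p then F p q a else \<zero>\<^bsub>P\<^esub>)" if x: "x \<in> X" for x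
  proof -
    have "(\<Oplus>\<^bsub>P\<^esub> y\<in>X. F x y (i p q a (x, y))) =
        (\<Oplus>\<^bsub>P\<^esub> y\<in>X. if y = q then (if x = p then F p q a else \<zero>\<^bsub>P\<^esub>) else \<zero>\<^bsub>P\<^esub>)"
      using x c by (intro P.finsum_cong')
        (auto simp: hsum_inj_apply lin_map_zero[OF module_hom P F])
    then show ?thesis using delta[OF pq(2)] by (cases "x = p") simp_all
  qed
  then have "(\<Oplus>\<^bsub>P\<^esub> x\<in>X. \<Oplus>\<^bsub>P\<^esub> y\<in>X. F x y (i p q a (x, y))) =
      (\<Oplus>\<^bsub>P\<^esub> x\<in>X. if x = p then F p q a else \<zero>\<^bsub>P\<^esub>)"
    using c by (intro P.finsum_cong') auto
  then show ?thesis using delta[OF pq(1)] by simp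
qed

lemma lin_map_if_zero:
  "\<lbrakk>module R N; b \<Longrightarrow> lin_map R M N f\<rbrakk> \<Longrightarrow> lin_map R M N (\<lambda>v. if b then f v else \<zero>\<^bsub>N\<^esub>)"
  by (cases b) (simp_all add: lin_map_const_zero)

text \<open>Each structure map is a finite sum of linear maps of the coordinates, which yields both
  its linearity and its values on homogeneous elements. The sums are defined over the module
  \<open>D\<close> while the conclusion is about the algebra on it, so facts are carried across the
  module fields that the two records share.\<close>

lemma hopf_category_total_hsum:
  assumes X: "finite X"
  shows "hopf_category_total R X A \<Delta> \<epsilon> m u S (hsum_algebra R X A m u) (hsum_inj X A)
    (hsum_comult R X A \<Delta>) (hsum_counit R X \<epsilon>) (hsum_antipode X A S)"
proof -
  let ?H = "hsum_algebra R X A m u"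
  interpret D: module R D by (rule module_hsum)
  note D = module_hsum
  have DD: "module R (tensor R D D)" using D D by (rule module_tensor)
  have base: "module R (base_module R)" by (rule module_base_module) (rule cring_axioms)
  have HH: "tensor R ?H ?H = tensor R D D" "pure R ?H ?H = pure R D D"
    by (rule tensor_eqI; simp)+
  have tensor_map_H: "tensor_map R M N ?H ?H f g = tensor_map R M N D D f g"
    for M N :: "('a, 'b, 'm) module_scheme" and f g
    unfolding tensor_map_def HH ..
  have mult: "f \<otimes>\<^bsub>?H\<^esub> g = (\<Oplus>\<^bsub>D\<^esub> x\<in>X. \<Oplus>\<^bsub>D\<^esub> y\<in>X. \<Oplus>\<^bsub>D\<^esub> z\<in>X. \<Oplus>\<^bsub>D\<^esub> w\<in>X.
      if y = z then i x w (hprod R A m x y w (f (x, y)) (g (z, w))) else \<zero>\<^bsub>D\<^esub>)" for f g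
    by (simp add: hsum_algebra_def Let_def)
  \<comment> \<open>For fixed \<open>g\<close> the inner double sum is linear in the left
    coordinate, which makes the product an instance of \<open>lin_map_hsum_finsum\<close>.
    \<open>lin_right\<close> plays the same role for the innermost summand and the right
    coordinate.\<close>
  have lin_left: "lin_map R (A x y) D (\<lambda>a. \<Oplus>\<^bsub>D\<^esub> z\<in>X. \<Oplus>\<^bsub>D\<^esub> w\<in>X.
      if y = z then i x w (hprod R A m x y w a (g (z, w))) else \<zero>\<^bsub>D\<^esub>)"
    if "g \<in> carrier D" "x \<in> X" "y \<in> X" for g x y
    using that lin_map_closed[OF lin_map_hsum_proj]
    by (intro lin_map_finsum_fun lin_map_if_zero D lin_map_comp[OF lin_map_hsum_inj] bilin_map_left[OF bilin_map_hprod])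
      auto
  have lin_right: "lin_map R (A z w) D (\<lambda>b. if y = z then i x w (hprod R A m x y w a b) else \<zero>\<^bsub>D\<^esub>)"
    if "x \<in> X" "y \<in> X" "z \<in> X" "w \<in> X" "a \<in> carrier (A x y)" for x y z w a
    by (rule lin_map_if_zero[OF D])
      (use that in \<open>auto intro!: lin_map_comp[OF lin_map_hsum_inj] bilin_map_right[OF bilin_map_hprod]\<close>)
  have lin_\<Delta>: "lin_map R (A x y) (tensor R D D)
      (\<lambda>a. tensor_map R (A x y) (A x y) D D (i x y) (i x y) (\<Delta> x y a))" if "x \<in> X" "y \<in> X" for x y
    using that by (intro lin_map_tensor_map_arg module_hom D lin_map_hsum_inj lin_map_comult)
  have lin_S: "lin_map R (A x y) D (\<lambda>a. i y x (S x y a))" if "x \<in> X" "y \<in> X" for x y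
    using that by (intro lin_map_comp[OF lin_map_hsum_inj antipode_linear])
  show ?thesis
  proof (intro hopf_category_total.intro hopf_category_total_axioms.intro hopf_category_axioms X)
    show "module R ?H" using D by (rule module_eqI) simp_all
    show "lin_map R (A x y) ?H (i x y)" if "x \<in> X" "y \<in> X" for x y
      using lin_map_hsum_inj[OF that] lin_map_eq_iff[of "A x y" "A x y" ?H D R] by simp
    show "P h" if "h \<in> carrier ?H" and "P \<zero>\<^bsub>?H\<^esub>"
      and inj: "\<And>x y a. \<lbrakk>x \<in> X; y \<in> X; a \<in> carrier (A x y)\<rbrakk> \<Longrightarrow> P (i x y a)"
      and "\<And>f g. \<lbrakk>f \<in> carrier ?H; g \<in> carrier ?H; P f; P g\<rbrakk> \<Longrightarrow> P (f \<oplus>\<^bsub>?H\<^esub> g)" for P h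
    proof (rule direct_sum_induct[of "X \<times> X" R "\<lambda>(x, y). A x y" h P])
      show "P (inj_sum (X \<times> X) (\<lambda>(x, y). A x y) p a)"
        if "p \<in> X \<times> X" "a \<in> carrier (case p of (x, y) \<Rightarrow> A x y)" for p a
        using that inj by (auto simp: hsum_inj_def)
    qed (use that module_hom in \<open>auto simp: hsum_module_def\<close>)
    show "bilin_map R ?H ?H ?H (mult ?H)"
    proof -
      have "bilin_map R D D D (mult ?H)"
      proof (rule bilin_mapI)
        show "lin_map R D D (\<lambda>g. f \<otimes>\<^bsub>?H\<^esub> g)" if "f \<in> carrier D" for f
          unfolding mult using that lin_map_closed[OF lin_map_hsum_proj]
          by (intro lin_map_finsum_fun D lin_map_comp[OF lin_right lin_map_hsum_proj]) auto
        show "lin_map R D D (\<lambda>f. f \<otimes>\<^bsub>?H\<^esub> g)" if "g \<in> carrier D" for g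
          unfolding mult using D lin_left[OF that] by (rule lin_map_hsum_finsum)
      qed
      then show ?thesis unfolding bilin_map_def lin_map_def by simp
    qed
    show "i x y a \<otimes>\<^bsub>?H\<^esub> i z w b = (if y = z then i x w (hprod R A m x y w a b) else \<zero>\<^bsub>?H\<^esub>)"
      if xyzw: "x \<in> X" "y \<in> X" "z \<in> X" "w \<in> X" and a: "a \<in> carrier (A x y)" and b: "b \<in> carrier (A z w)"
      for x y z w a b
    proof -
      have ib: "i z w b \<in> carrier D" using b by (rule lin_map_closed[OF lin_map_hsum_inj[OF xyzw(3,4)]])
      \<comment> \<open>The quadruple sum is treated as two nested double sums: the outer one
        collapses to \<open>(x, y)\<close>, then the inner one to \<open>(z, w)\<close>.\<close>
      have "i x y a \<otimes>\<^bsub>?H\<^esub> i z w b = (\<Oplus>\<^bsub>D\<^esub> z'\<in>X. \<Oplus>\<^bsub>D\<^esub> w'\<in>X.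
          if y = z' then i x w' (hprod R A m x y w' a (i z w b (z', w'))) else \<zero>\<^bsub>D\<^esub>)"
        unfolding mult using D lin_left[OF ib] X xyzw(1,2) a by (rule finsum_hsum_inj)
      also have "\<dots> = (if y = z then i x w (hprod R A m x y w a b) else \<zero>\<^bsub>D\<^esub>)"
        using D lin_right[OF xyzw(1,2) _ _ a] X xyzw(3,4) b by (rule finsum_hsum_inj)
      finally show ?thesis by simp
    qed
    show "\<one>\<^bsub>?H\<^esub> = (\<Oplus>\<^bsub>?H\<^esub> x\<in>X. i x x (u x))"
      using finsum_eqI[of ?H D "\<lambda>x. i x x (u x)" X] by (simp add: hsum_algebra_def Let_def)
    have "lin_map R D (tensor R D D) (hsum_comult R X A \<Delta>)"
      unfolding hsum_comult_def[abs_def] Let_def using DD lin_\<Delta> by (rule lin_map_hsum_finsum)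
    then show "lin_map R ?H (tensor R ?H ?H) (hsum_comult R X A \<Delta>)" unfolding HH lin_map_def by simp
    show "hsum_comult R X A \<Delta> (i x y a) = tensor_map R (A x y) (A x y) ?H ?H (i x y) (i x y) (\<Delta> x y a)"
      if "x \<in> X" "y \<in> X" "a \<in> carrier (A x y)" for x y a
      unfolding hsum_comult_def Let_def tensor_map_H using DD lin_\<Delta> X that by (rule finsum_hsum_inj)
    have "lin_map R D (base_module R) (hsum_counit R X \<epsilon>)"
      using lin_map_hsum_finsum[OF base lin_map_counit] by (simp add: hsum_counit_def[abs_def])
    then show "lin_map R ?H (base_module R) (hsum_counit R X \<epsilon>)" unfolding lin_map_def by simp
    show "hsum_counit R X \<epsilon> (i x y a) = \<epsilon> x y a" if "x \<in> X" "y \<in> X" "a \<in> carrier (A x y)" for x y a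
      using finsum_hsum_inj[OF base lin_map_counit X that] by (simp add: hsum_counit_def)
    have "lin_map R D D (hsum_antipode X A S)"
      unfolding hsum_antipode_def[abs_def] Let_def using D lin_S by (rule lin_map_hsum_finsum)
    then show "lin_map R ?H ?H (hsum_antipode X A S)" unfolding lin_map_def by simp
    show "hsum_antipode X A S (i x y a) = i y x (S x y a)" if "x \<in> X" "y \<in> X" "a \<in> carrier (A x y)" for x y a
      unfolding hsum_antipode_def Let_def using D lin_S X that by (rule finsum_hsum_inj)
  qed
qed

end

theorem proposition6p1:
  fixes k :: "('k, 'r) ring_scheme"
    and X :: "'x set"
    and A :: "'x \<Rightarrow> 'x \<Rightarrow> ('k, 'a, 'm) module_scheme"
    and \<Delta> :: "'x \<Rightarrow> 'x \<Rightarrow> 'a \<Rightarrow> ('a \<times> 'a \<Rightarrow> 'k) set"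
    and \<epsilon> :: "'x \<Rightarrow> 'x \<Rightarrow> 'a \<Rightarrow> 'k"
    and m :: "'x \<Rightarrow> 'x \<Rightarrow> 'x \<Rightarrow> ('a \<times> 'a \<Rightarrow> 'k) set \<Rightarrow> 'a"
    and u :: "'x \<Rightarrow> 'a"
    and S :: "'x \<Rightarrow> 'x \<Rightarrow> 'a \<Rightarrow> 'a"
  assumes "cring k"
    and "hopf_category k X A \<Delta> \<epsilon> m u S"
    and "finite X"
  shows "weak_hopf_algebra k (hsum_algebra k X A m u)
           (hsum_comult k X A \<Delta>) (hsum_counit k X \<epsilon>) (hsum_antipode X A S)"
  by (rule hopf_category_total.weak_hopf_algebra_H[OF hopf_category.hopf_category_total_hsum[OF assms(2,3)]])

end
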